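(* For every topologically invariant mean $\eta$ on $CB(\mathbf{R})$, there exists an $\eta$-Dirac state, i.e. a state $\delta$ on $\mathcal{L}(L^2(\mathbf{R}))$ such that for every $f\in CB(\mathbf{R})$, $$\langle f(Q),\delta\rangle=f(0)\quad\text{and}\quad \langle f(P),\delta\rangle=\eta(f).$$
   Context: $CB(\mathbf{R})$ is the space of bounded continuous functions on $\mathbf{R}$. A mean on $CB(\mathbf{R})$ is a positive linear functional $\eta$ with $\eta(1)=1$. It is topologically invariant if $\eta(f*g)=\eta(f)$ for all $f\in CB(\mathbf{R})$ and all $g\in L^1(\mathbf{R})$ with $g\ge 0$, $\int g=1$, where $(f*g)(u)=\int f(u-p)g(p)\,dp$. $\mathcal{L}(L^2(\mathbf{R}))$ is the algebra of bounded operators on $L^2(\mathbf{R})$. A state on it is a positive linear functional of norm one (not required to be normal), its value at $A$ being written $\langle A,\delta\rangle$. $Q$ is the position operator (multiplication by $q$) and $P=-i\,d/dq$ is the momentum operator on $L^2(\mathbf{R})$; $f(Q)$ and $f(P)$ are defined by the spectral functional calculus. *)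

theory Defs
  imports "HOL-Analysis.Analysis"
begin

section \<open>The Hilbert space of square-integrable functions on the real line\<close>

definition square_integrable :: "(real \<Rightarrow> complex) \<Rightarrow> bool" where
  "square_integrable f \<longleftrightarrow>
     f \<in> borel_measurable lborel \<and> integrable lborel (\<lambda>x. (cmod (f x))\<^sup>2)"

lemma square_integrable_measurable:
  "square_integrable f \<Longrightarrow> f \<in> borel_measurable borel"
  by (simp add: square_integrable_def)

lemma square_integrable_zero: "square_integrable (\<lambda>x. 0)"
  by (simp add: square_integrable_def)

lemma square_integrable_cmult:
  assumes "square_integrable f"
  shows "square_integrable (\<lambda>x. c * f x)"
  using assms by (auto simp: square_integrable_def norm_mult power_mult_distrib)

lemma square_integrable_add:
  assumes f: "square_integrable f" and g: "square_integrable g"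
  shows "square_integrable (\<lambda>x. f x + g x)"
proof -
  have [measurable]: "f \<in> borel_measurable borel" "g \<in> borel_measurable borel"
    using f g by (auto intro: square_integrable_measurable)
  have "integrable lborel (\<lambda>x. 2 * (cmod (f x))\<^sup>2 + 2 * (cmod (g x))\<^sup>2)"
    using f g by (simp add: square_integrable_def)
  then have "integrable lborel (\<lambda>x. (cmod (f x + g x))\<^sup>2)"
  proof (rule Bochner_Integration.integrable_bound)
    show "AE x in lborel. norm ((cmod (f x + g x))\<^sup>2)
            \<le> norm (2 * (cmod (f x))\<^sup>2 + 2 * (cmod (g x))\<^sup>2)"
    proof (rule AE_I2)
      fix x
      have "(cmod (f x + g x))\<^sup>2 \<le> (cmod (f x) + cmod (g x))\<^sup>2"
        by (intro power_mono norm_triangle_ineq) simp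
      also have "\<dots> \<le> 2 * (cmod (f x))\<^sup>2 + 2 * (cmod (g x))\<^sup>2"
        using zero_le_power2[of "cmod (f x) - cmod (g x)"]
        by (simp add: power2_sum power2_diff)
      finally show "norm ((cmod (f x + g x))\<^sup>2)
            \<le> norm (2 * (cmod (f x))\<^sup>2 + 2 * (cmod (g x))\<^sup>2)"
        by simp
    qed
  qed measurable
  then show ?thesis by (simp add: square_integrable_def)
qed

lemma measurable_cnj [measurable]: "cnj \<in> borel_measurable borel"
  by (intro borel_measurable_continuous_onI continuous_intros)

lemma square_integrable_cnj_mult:
  assumes f: "square_integrable f" and g: "square_integrable g"
  shows "integrable lborel (\<lambda>x. cnj (f x) * g x)"
proof -
  have [measurable]: "f \<in> borel_measurable borel" "g \<in> borel_measurable borel"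
    using f g by (auto intro: square_integrable_measurable)
  have "integrable lborel (\<lambda>x. (cmod (f x))\<^sup>2 + (cmod (g x))\<^sup>2)"
    using f g by (simp add: square_integrable_def)
  then show ?thesis
  proof (rule Bochner_Integration.integrable_bound)
    show "AE x in lborel. norm (cnj (f x) * g x)
            \<le> norm ((cmod (f x))\<^sup>2 + (cmod (g x))\<^sup>2)"
    proof (rule AE_I2)
      fix x
      have "cmod (f x) * cmod (g x) \<le> (cmod (f x))\<^sup>2 + (cmod (g x))\<^sup>2"
        using sum_squares_bound[of "cmod (f x)" "cmod (g x)"]
          mult_nonneg_nonneg[OF norm_ge_zero norm_ge_zero, of "f x" "g x"] by linarith
      then show "norm (cnj (f x) * g x) \<le> norm ((cmod (f x))\<^sup>2 + (cmod (g x))\<^sup>2)"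
        by (simp add: norm_mult)
    qed
  qed measurable
qed

definition l2rel :: "(real \<Rightarrow> complex) \<Rightarrow> (real \<Rightarrow> complex) \<Rightarrow> bool" where
  "l2rel f g \<longleftrightarrow>
     square_integrable f \<and> square_integrable g \<and> (AE x in lborel. f x = g x)"

lemma part_equivp_l2rel: "part_equivp l2rel"
proof (rule part_equivpI)
  show "\<exists>f. l2rel f f"
    using square_integrable_zero by (auto simp: l2rel_def)
  show "symp l2rel"
    by (rule sympI) (auto simp: l2rel_def elim: eventually_mono)
  show "transp l2rel"
    by (rule transpI) (auto simp: l2rel_def elim: eventually_elim2)
qed

quotient_type l2 = "real \<Rightarrow> complex" / partial: l2rel
  morphisms Rep_l2 L2_class
  by (rule part_equivp_l2rel)

lift_definition scaleC :: "complex \<Rightarrow> l2 \<Rightarrow> l2" (infixr \<open>*\<^sub>C\<close> 75) is "\<lambda>c f x. c * f x"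
  by (auto simp: l2rel_def square_integrable_cmult elim: eventually_mono)

text \<open>The inner product is antilinear in the first argument.\<close>

lift_definition cinner :: "l2 \<Rightarrow> l2 \<Rightarrow> complex"
  is "\<lambda>f g. LINT x|lborel. cnj (f x) * g x"
proof -
  fix f f' g g' assume *: "l2rel f f'" "l2rel g g'"
  then have [measurable]: "f \<in> borel_measurable borel" "f' \<in> borel_measurable borel"
    "g \<in> borel_measurable borel" "g' \<in> borel_measurable borel"
    by (auto simp: l2rel_def square_integrable_measurable)
  have "AE x in lborel. f x = f' x" "AE x in lborel. g x = g' x"
    using * by (auto simp: l2rel_def)
  then have "AE x in lborel. cnj (f x) * g x = cnj (f' x) * g' x"
    by eventually_elim simp
  then show "(LINT x|lborel. cnj (f x) * g x) = (LINT x|lborel. cnj (f' x) * g' x)"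
    by (intro integral_cong_AE) measurable
qed

text \<open>As a real normed space (the only scalars the library's type classes know),
  \<^typ>\<open>l2\<close> carries the real part of the complex inner product; it induces the usual
  \<open>L\<^sup>2\<close> norm.\<close>

instantiation l2 :: real_inner
begin

lift_definition zero_l2 :: l2 is "\<lambda>x. 0"
  by (simp add: l2rel_def square_integrable_zero)

lift_definition plus_l2 :: "l2 \<Rightarrow> l2 \<Rightarrow> l2" is "\<lambda>f g x. f x + g x"
  by (auto simp: l2rel_def square_integrable_add elim: eventually_elim2)

definition uminus_l2 :: "l2 \<Rightarrow> l2" where "uminus_l2 \<psi> = (-1) *\<^sub>C \<psi>"

definition minus_l2 :: "l2 \<Rightarrow> l2 \<Rightarrow> l2" where "minus_l2 \<phi> \<psi> = \<phi> + - \<psi>"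

definition scaleR_l2 :: "real \<Rightarrow> l2 \<Rightarrow> l2" where "scaleR_l2 r \<psi> = complex_of_real r *\<^sub>C \<psi>"

definition inner_l2 :: "l2 \<Rightarrow> l2 \<Rightarrow> real" where "inner_l2 \<phi> \<psi> = Re (cinner \<phi> \<psi>)"

definition norm_l2 :: "l2 \<Rightarrow> real" where "norm_l2 \<psi> = sqrt (inner \<psi> \<psi>)"

definition sgn_l2 :: "l2 \<Rightarrow> l2" where "sgn_l2 \<psi> = complex_of_real (inverse (norm \<psi>)) *\<^sub>C \<psi>"

definition dist_l2 :: "l2 \<Rightarrow> l2 \<Rightarrow> real" where "dist_l2 \<phi> \<psi> = norm (\<phi> - \<psi>)"

definition uniformity_l2 :: "(l2 \<times> l2) filter"
  where "uniformity_l2 = (INF e\<in>{0<..}. principal {(x, y). dist x y < e})"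

definition open_l2 :: "l2 set \<Rightarrow> bool"
  where "open_l2 U = (\<forall>x\<in>U. \<forall>\<^sub>F (x', y) in uniformity. x' = x \<longrightarrow> y \<in> U)"

instance
proof
  fix a b :: real and x y z :: l2
  show "x + y + z = x + (y + z)"
    by transfer (auto simp: l2rel_def add.assoc intro!: square_integrable_add)
  show "x + y = y + x"
    by transfer (auto simp: l2rel_def add.commute intro!: square_integrable_add)
  show "0 + x = x"
    by transfer (auto simp: l2rel_def)
  show "- x + x = 0"
    unfolding uminus_l2_def
    by transfer (auto simp: l2rel_def square_integrable_zero)
  show "x - y = x + - y"
    by (rule minus_l2_def)
  show "a *\<^sub>R (x + y) = a *\<^sub>R x + a *\<^sub>R y"
    unfolding scaleR_l2_def
    by transfer (auto simp: l2rel_def distrib_left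
        intro!: square_integrable_add square_integrable_cmult)
  show "(a + b) *\<^sub>R x = a *\<^sub>R x + b *\<^sub>R x"
    unfolding scaleR_l2_def
    by transfer (auto simp: l2rel_def distrib_right
        intro!: square_integrable_add square_integrable_cmult)
  show "a *\<^sub>R b *\<^sub>R x = (a * b) *\<^sub>R x"
    unfolding scaleR_l2_def
    by transfer
      (simp add: l2rel_def mult.assoc[symmetric]
        square_integrable_cmult)
  show "1 *\<^sub>R x = x"
    unfolding scaleR_l2_def by transfer (auto simp: l2rel_def)
  show "sgn x = inverse (norm x) *\<^sub>R x"
    by (simp only: sgn_l2_def scaleR_l2_def)
  show "dist x y = norm (x - y)"
    by (rule dist_l2_def)
  show "uniformity = (INF e\<in>{0<..}. principal {(x::l2, y). dist x y < e})"
    by (rule uniformity_l2_def)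
  show "open U = (\<forall>x\<in>U. \<forall>\<^sub>F (x', y) in uniformity. x' = x \<longrightarrow> y \<in> U)" for U :: "l2 set"
    by (rule open_l2_def)
  show "norm x = sqrt (inner x x)"
    by (rule norm_l2_def)
  have "cinner x y = cnj (cinner y x)"
    by transfer (simp flip: Bochner_Integration.integral_cnj add: mult.commute)
  then show "inner x y = inner y x"
    by (simp add: inner_l2_def)
  have "cinner (x + y) z = cinner x z + cinner y z"
    by transfer (simp add: l2rel_def distrib_right square_integrable_cnj_mult)
  then show "inner (x + y) z = inner x z + inner y z"
    by (simp add: inner_l2_def)
  have "cinner (complex_of_real a *\<^sub>C x) y = complex_of_real a * cinner x y"
    by transfer (simp add: mult.assoc)
  then show "inner (a *\<^sub>R x) y = a * inner x y"
    by (simp add: inner_l2_def scaleR_l2_def)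
  have self: "Re (LINT u|lborel. cnj (f u) * f u) = (LINT u|lborel. (cmod (f u))\<^sup>2)"
    for f :: "real \<Rightarrow> complex"
    by (subst mult.commute)
      (simp add: complex_norm_square[symmetric] integral_complex_of_real del: of_real_power)
  show "0 \<le> inner x x"
    unfolding inner_l2_def
    by transfer (simp add: self)
  show "inner x x = 0 \<longleftrightarrow> x = 0"
    unfolding inner_l2_def
  proof transfer
    fix f assume "l2rel f f"
    then have f: "square_integrable f" by (simp add: l2rel_def)
    then have "(LINT u|lborel. (cmod (f u))\<^sup>2) = 0 \<longleftrightarrow> (AE u in lborel. (cmod (f u))\<^sup>2 = 0)"
      by (intro integral_nonneg_eq_0_iff_AE) (auto simp: square_integrable_def)
    then show "Re (LINT u|lborel. cnj (f u) * f u) = 0 \<longleftrightarrow> l2rel f (\<lambda>u. 0)"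
      using f by (simp add: self l2rel_def square_integrable_zero)
  qed
qed

end


section \<open>Bounded operators and states\<close>

definition bounded_clinear :: "(l2 \<Rightarrow> l2) \<Rightarrow> bool" where
  "bounded_clinear A \<longleftrightarrow> bounded_linear A \<and> (\<forall>c \<psi>. A (c *\<^sub>C \<psi>) = c *\<^sub>C A \<psi>)"

definition positive_operator :: "(l2 \<Rightarrow> l2) \<Rightarrow> bool" where
  "positive_operator A \<longleftrightarrow> bounded_clinear A \<and> (\<forall>\<psi>. cinner \<psi> (A \<psi>) \<in> \<real>\<^sub>\<ge>\<^sub>0)"

text \<open>A functional on the bounded operators is a function on all maps, of which only the
  values at bounded complex-linear maps matter. The boundedness conjunct is what
  makes the real supremum, i.e. the functional's norm, meaningful.\<close>

definition is_state :: "((l2 \<Rightarrow> l2) \<Rightarrow> complex) \<Rightarrow> bool" where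
  "is_state \<delta> \<longleftrightarrow>
     (\<forall>A B. bounded_clinear A \<longrightarrow> bounded_clinear B \<longrightarrow>
        \<delta> (\<lambda>\<psi>. A \<psi> + B \<psi>) = \<delta> A + \<delta> B) \<and>
     (\<forall>A c. bounded_clinear A \<longrightarrow> \<delta> (\<lambda>\<psi>. c *\<^sub>C A \<psi>) = c * \<delta> A) \<and>
     (\<forall>A. positive_operator A \<longrightarrow> \<delta> A \<in> \<real>\<^sub>\<ge>\<^sub>0) \<and>
     bdd_above ((\<lambda>A. cmod (\<delta> A)) ` {A. bounded_clinear A \<and> onorm A \<le> 1}) \<and>
     (SUP A\<in>{A. bounded_clinear A \<and> onorm A \<le> 1}. cmod (\<delta> A)) = 1"


section \<open>Spectral functional calculus\<close>

definition orthogonal_projection :: "(l2 \<Rightarrow> l2) \<Rightarrow> bool" where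
  "orthogonal_projection E \<longleftrightarrow>
     bounded_clinear E \<and> E \<circ> E = E \<and> (\<forall>\<phi> \<psi>. cinner (E \<phi>) \<psi> = cinner \<phi> (E \<psi>))"

definition projection_valued_measure :: "(real set \<Rightarrow> l2 \<Rightarrow> l2) \<Rightarrow> bool" where
  "projection_valued_measure E \<longleftrightarrow>
     (\<forall>S\<in>sets borel. orthogonal_projection (E S)) \<and>
     E {} = (\<lambda>\<psi>. 0) \<and> E UNIV = id \<and>
     (\<forall>S\<in>sets borel. \<forall>T\<in>sets borel. E (S \<inter> T) = E S \<circ> E T) \<and>
     (\<forall>S :: nat \<Rightarrow> real set. range S \<subseteq> sets borel \<longrightarrow> disjoint_family S \<longrightarrow>
        (\<forall>\<psi>. (\<lambda>n. E (S n) \<psi>) sums E (\<Union>n. S n) \<psi>))"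

definition diagonal_measure :: "(real set \<Rightarrow> l2 \<Rightarrow> l2) \<Rightarrow> l2 \<Rightarrow> real measure" where
  "diagonal_measure E \<psi> = measure_of UNIV (sets borel) (\<lambda>S. ennreal (Re (cinner \<psi> (E S \<psi>))))"

text \<open>A possibly unbounded operator is represented by its graph.\<close>

definition linear_graph :: "(l2 \<times> l2) set \<Rightarrow> bool" where
  "linear_graph T \<longleftrightarrow>
     single_valued T \<and> (0, 0) \<in> T \<and>
     (\<forall>\<psi> \<phi> \<psi>' \<phi>'. (\<psi>, \<phi>) \<in> T \<longrightarrow> (\<psi>', \<phi>') \<in> T \<longrightarrow> (\<psi> + \<psi>', \<phi> + \<phi>') \<in> T) \<and>
     (\<forall>c \<psi> \<phi>. (\<psi>, \<phi>) \<in> T \<longrightarrow> (c *\<^sub>C \<psi>, c *\<^sub>C \<phi>) \<in> T)"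

text \<open>\<open>T = \<integral> \<lambda> dE(\<lambda>)\<close>: the domain of \<open>T\<close> consists of the \<open>\<psi>\<close> for which
  \<open>\<lambda>\<^sup>2\<close> is integrable against \<open>\<langle>\<psi>, dE \<psi>\<rangle>\<close>, and there \<open>\<langle>\<psi>, T \<psi>\<rangle> = \<integral> \<lambda> \<langle>\<psi>, dE \<psi>\<rangle>\<close>.
  By polarization these diagonal values determine a linear operator on the (dense) domain.\<close>

definition spectral_resolution :: "(real set \<Rightarrow> l2 \<Rightarrow> l2) \<Rightarrow> (l2 \<times> l2) set \<Rightarrow> bool" where
  "spectral_resolution E T \<longleftrightarrow>
     projection_valued_measure E \<and> linear_graph T \<and>
     Domain T = {\<psi>. integrable (diagonal_measure E \<psi>) (\<lambda>x. x\<^sup>2)} \<and>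
     (\<forall>(\<psi>, \<phi>)\<in>T. cinner \<psi> \<phi> = complex_of_real (LINT x|diagonal_measure E \<psi>. x))"

text \<open>The bounded operator \<open>\<integral> f dE\<close>, for bounded Borel \<open>f\<close>.\<close>

definition spectral_integral ::
  "(real set \<Rightarrow> l2 \<Rightarrow> l2) \<Rightarrow> (real \<Rightarrow> complex) \<Rightarrow> l2 \<Rightarrow> l2" where
  "spectral_integral E f =
     (THE B. bounded_clinear B \<and> (\<forall>\<psi>. cinner \<psi> (B \<psi>) = (LINT x|diagonal_measure E \<psi>. f x)))"

text \<open>The spectral measure of a self-adjoint operator is unique on Borel sets. The choice
  below is only over its irrelevant values at non-Borel sets.\<close>

definition spectral_measure :: "(l2 \<times> l2) set \<Rightarrow> real set \<Rightarrow> l2 \<Rightarrow> l2" where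
  "spectral_measure T = (SOME E. spectral_resolution E T)"

definition fun_calc :: "(real \<Rightarrow> complex) \<Rightarrow> (l2 \<times> l2) set \<Rightarrow> l2 \<Rightarrow> l2" where
  "fun_calc f T = spectral_integral (spectral_measure T) f"


section \<open>Position and momentum\<close>

definition position_op :: "(l2 \<times> l2) set" where
  "position_op = {(L2_class f, L2_class g) | f g.
     square_integrable f \<and> square_integrable g \<and> (\<forall>x. g x = complex_of_real x * f x)}"

text \<open>\<open>-\<i> d/dq\<close> on its self-adjoint domain: the square-integrable \<open>f\<close> that are absolutely
  continuous on bounded intervals with \<open>g = -\<i> f'\<close> (almost everywhere) square-integrable,
  i.e. \<open>f\<close> is an indefinite integral of \<open>\<i> g\<close>.\<close>

definition momentum_op :: "(l2 \<times> l2) set" where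
  "momentum_op = {(L2_class f, L2_class g) | f g.
     square_integrable f \<and> square_integrable g \<and>
     (\<forall>a b. a \<le> b \<longrightarrow> f b - f a = (LINT x:{a..b}|lborel. \<i> * g x))}"


section \<open>Topologically invariant means\<close>

text \<open>The carrier is the library's set \<^const>\<open>bcontfun\<close> of bounded continuous functions
  \<^typ>\<open>real \<Rightarrow> complex\<close>. Values outside it do not matter.\<close>

definition is_mean :: "((real \<Rightarrow> complex) \<Rightarrow> complex) \<Rightarrow> bool" where
  "is_mean \<eta> \<longleftrightarrow>
     (\<forall>f\<in>bcontfun. \<forall>g\<in>bcontfun. \<eta> (\<lambda>x. f x + g x) = \<eta> f + \<eta> g) \<and>
     (\<forall>c. \<forall>f\<in>bcontfun. \<eta> (\<lambda>x. c * f x) = c * \<eta> f) \<and>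
     (\<forall>f\<in>bcontfun. (\<forall>x. f x \<in> \<real>\<^sub>\<ge>\<^sub>0) \<longrightarrow> \<eta> f \<in> \<real>\<^sub>\<ge>\<^sub>0) \<and>
     \<eta> (\<lambda>x. 1) = 1"

definition fun_conv :: "(real \<Rightarrow> complex) \<Rightarrow> (real \<Rightarrow> real) \<Rightarrow> real \<Rightarrow> complex" where
  "fun_conv f g u = (LINT p|lborel. f (u - p) * complex_of_real (g p))"

definition topologically_invariant :: "((real \<Rightarrow> complex) \<Rightarrow> complex) \<Rightarrow> bool" where
  "topologically_invariant \<eta> \<longleftrightarrow>
     (\<forall>f\<in>bcontfun. \<forall>g. integrable lborel g \<longrightarrow> (\<forall>p. 0 \<le> g p) \<longrightarrow> (LINT p|lborel. g p) = 1 \<longrightarrow>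
        \<eta> (fun_conv f g) = \<eta> f)"


section \<open>Dirac states\<close>

definition dirac_state :: "((real \<Rightarrow> complex) \<Rightarrow> complex) \<Rightarrow> ((l2 \<Rightarrow> l2) \<Rightarrow> complex) \<Rightarrow> bool" where
  "dirac_state \<eta> \<delta> \<longleftrightarrow>
     is_state \<delta> \<and>
     (\<forall>f\<in>bcontfun. \<delta> (fun_calc f position_op) = f 0 \<and> \<delta> (fun_calc f momentum_op) = \<eta> f)"

end

theory Submission
  imports Defs "HOL-Probability.Sinc_Integral"
begin

text \<open>
  For a normalized wave packet \<open>\<psi>\<close> with position in \<open>(0, w]\<close> let \<open>\<psi>\<^sub>p\<close> be its translate by \<open>p\<close> in momentum,
  \<open>\<psi>\<^sub>p(q) = exp(\<i> p q) \<psi>(q)\<close>. The function \<open>p \<mapsto> \<langle>\<psi>\<^sub>p, f(P) \<psi>\<^sub>p\<rangle>\<close> is the convolution of \<open>f\<close> with a probability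
  density (the reflected momentum density of \<open>\<psi>\<close>), so its mean is \<open>\<eta>(f)\<close>; the function
  \<open>p \<mapsto> \<langle>\<psi>\<^sub>p, f(Q) \<psi>\<^sub>p\<rangle>\<close> is a constant close to \<open>f(0)\<close> when \<open>w\<close> is small. Letting \<open>w\<close> depend on a parameter
  \<open>s\<close> with \<open>w(s) \<longrightarrow> 0\<close> as \<open>\<bar>s\<bar> \<longrightarrow> \<infinity>\<close>, and applying \<open>\<eta>\<close> once more in \<open>s\<close> in place of an ultrafilter limit, gives
  \<open>\<delta>(A) = \<eta>\<^sub>s(\<eta>\<^sub>p \<langle>\<psi>(s, p), A \<psi>(s, p)\<rangle>)\<close>: a topologically invariant mean of a function with a limit at infinity is
  that limit.

  The functional calculus is computed from the spectral resolution of \<open>Q\<close> by indicator functions. It is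
  unique: any resolution \<open>E\<close> commutes with \<open>Q\<close>, and on the range of \<open>E (a, b]\<close> the operator \<open>Q - (a + b)/2\<close> has
  norm at most \<open>(b - a)/2\<close>, so bounding its powers forces every vector there to be supported in \<open>[a, b]\<close>.
  The operator \<open>P\<close> is unitarily equivalent to \<open>Q\<close> by the Fourier transform, which is obtained as the isometric
  extension of its values on step functions.
\<close>

section \<open>Calculus in \<open>L\<^sup>2\<close>\<close>

text \<open>The two requirements decouple. For each fixed \<open>s\<close> the inner mean of the
  momentum expectation is exactly \<open>\<eta> f\<close>, whatever density the packet produces, so
  the shape and width of the packet can be chosen for position alone, where only a limit is
  available. The price of using \<open>\<eta>\<close> in place of an ultrafilter is that the inner
  mean must depend continuously on \<open>s\<close>: the packets have to vary norm-continuously with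
  \<open>s\<close>, uniformly in \<open>p\<close>, and the width has to be a continuous function on
  the whole line that vanishes at both ends.

  The main obstacle is that \<open>fun_calc\<close> refers to an unspecified resolution, of which
  only the domain and the quadratic form are given. That its projections commute with the operator
  has to be extracted from diagonal values by polarization.

  Step functions suit the Fourier transform because the squared distance of two of them is the
  distance of their endpoints, and the same holds for their transforms by rescaling a single
  integral. The Gram matrices then agree, which is what an isometric extension requires.\<close>

lemma square_integrable_Rep: "square_integrable (Rep_l2 \<psi>)"
  using Quotient3_rep_reflp[OF Quotient3_l2, of \<psi>] by (simp add: l2rel_def)

lemma L2_class_Rep [simp]: "L2_class (Rep_l2 \<psi>) = \<psi>"
  by (rule Quotient3_abs_rep[OF Quotient3_l2])

lemma L2_class_eq_iff:
  "square_integrable f \<Longrightarrow> square_integrable g \<Longrightarrow>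
    L2_class f = L2_class g \<longleftrightarrow> (AE x in lborel. f x = g x)"
  using Quotient3_rel[OF Quotient3_l2, of f g] by (simp add: l2rel_def)

lemma Rep_L2_class:
  assumes "square_integrable f"
  shows "AE x in lborel. Rep_l2 (L2_class f) x = f x"
  using L2_class_eq_iff[OF square_integrable_Rep assms, of "L2_class f"] by simp

lemma L2_class_add:
  assumes "square_integrable f" "square_integrable g"
  shows "L2_class f + L2_class g = L2_class (\<lambda>x. f x + g x)"
  using assms plus_l2.abs_eq[of f g] by (simp add: l2rel_def eq_onp_def)

lemma L2_class_scaleC:
  assumes "square_integrable f"
  shows "c *\<^sub>C L2_class f = L2_class (\<lambda>x. c * f x)"
  using assms scaleC.abs_eq[of f c] by (simp add: l2rel_def eq_onp_def)

lemma L2_class_zero: "L2_class (\<lambda>x. 0) = 0"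
  by (simp add: zero_l2_def)

lemma cinner_L2_class:
  assumes "square_integrable f" "square_integrable g"
  shows "cinner (L2_class f) (L2_class g) = (LINT x|lborel. cnj (f x) * g x)"
  using assms cinner.abs_eq[of f g] by (simp add: l2rel_def eq_onp_def)

lemma L2_cases: obtains f where "square_integrable f" "\<psi> = L2_class f"
  using square_integrable_Rep L2_class_Rep by metis

lemma L2_class_uminus:
  "square_integrable f \<Longrightarrow> - L2_class f = L2_class (\<lambda>x. - f x)"
  using L2_class_scaleC[of f "-1"] by (simp add: uminus_l2_def)

lemma square_integrable_uminus: "square_integrable f \<Longrightarrow> square_integrable (\<lambda>x. - f x)"
  using square_integrable_cmult[of f "-1"] by simp

lemma square_integrable_diff:
  "square_integrable f \<Longrightarrow> square_integrable g \<Longrightarrow> square_integrable (\<lambda>x. f x - g x)"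
  using square_integrable_add[OF _ square_integrable_uminus] by fastforce

lemma L2_class_diff:
  assumes "square_integrable f" "square_integrable g"
  shows "L2_class f - L2_class g = L2_class (\<lambda>x. f x - g x)"
  unfolding minus_l2_def using assms by (simp only: L2_class_uminus L2_class_add square_integrable_uminus diff_conv_add_uminus)

lemma cinner_cnj: "cnj (cinner \<phi> \<psi>) = cinner \<psi> \<phi>"
  by transfer (simp flip: Bochner_Integration.integral_cnj add: mult.commute)

lemma cinner_add_right: "cinner \<phi> (\<psi> + \<xi>) = cinner \<phi> \<psi> + cinner \<phi> \<xi>"
  by transfer (simp add: l2rel_def distrib_left square_integrable_cnj_mult)

lemma cinner_scaleC_right: "cinner \<phi> (c *\<^sub>C \<psi>) = c * cinner \<phi> \<psi>"
  by transfer (simp add: mult.left_commute)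

lemma cinner_add_left: "cinner (\<phi> + \<psi>) \<xi> = cinner \<phi> \<xi> + cinner \<psi> \<xi>"
  by (metis cinner_cnj cinner_add_right complex_cnj_add)

lemma cinner_scaleC_left: "cinner (c *\<^sub>C \<phi>) \<psi> = cnj c * cinner \<phi> \<psi>"
  by (metis cinner_cnj cinner_scaleC_right complex_cnj_mult)

lemma cinner_uminus_right: "cinner \<phi> (- \<psi>) = - cinner \<phi> \<psi>"
  by (simp add: uminus_l2_def cinner_scaleC_right)

lemma cinner_uminus_left: "cinner (- \<phi>) \<psi> = - cinner \<phi> \<psi>"
  by (simp add: uminus_l2_def cinner_scaleC_left)

lemma cinner_diff_right: "cinner \<phi> (\<psi> - \<xi>) = cinner \<phi> \<psi> - cinner \<phi> \<xi>"
  by (simp only: minus_l2_def cinner_add_right cinner_uminus_right diff_conv_add_uminus)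

lemma cinner_diff_left: "cinner (\<phi> - \<psi>) \<xi> = cinner \<phi> \<xi> - cinner \<psi> \<xi>"
  by (simp only: minus_l2_def cinner_add_left cinner_uminus_left diff_conv_add_uminus)

lemma cinner_self: "cinner \<psi> \<psi> = complex_of_real ((norm \<psi>)\<^sup>2)"
proof -
  have "Im (cinner \<psi> \<psi>) = 0"
    using cinner_cnj[of \<psi> \<psi>] by (simp add: complex_eq_iff)
  then show ?thesis
    by (simp add: complex_eq_iff power2_norm_eq_inner inner_l2_def)
qed

lemma cinner_zero_right [simp]: "cinner \<phi> 0 = 0"
  using cinner_diff_right[of \<phi> 0 0] by simp

lemma scaleC_one [simp]: "1 *\<^sub>C (\<psi> :: l2) = \<psi>"
  using scaleR_one[of \<psi>] by (simp add: scaleR_l2_def)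

text \<open>Nondegeneracy, by testing against the difference itself. The algebraic laws of
  \<open>scaleC\<close> below follow from it without returning to representatives.\<close>

lemma cinner_ext: "(\<And>\<phi>. cinner \<phi> \<psi> = cinner \<phi> \<xi>) \<Longrightarrow> \<psi> = \<xi>"
  using cinner_self[of "\<psi> - \<xi>"] by (simp add: cinner_diff_right)

lemma scaleC_scaleC [simp]: "a *\<^sub>C b *\<^sub>C \<psi> = (a * b) *\<^sub>C \<psi>"
  by (rule cinner_ext) (simp add: cinner_scaleC_right)

lemma scaleC_add_right: "a *\<^sub>C (\<psi> + \<xi>) = a *\<^sub>C \<psi> + a *\<^sub>C \<xi>"
  by (rule cinner_ext) (simp add: cinner_scaleC_right cinner_add_right ring_distribs)

lemma scaleC_diff_right: "a *\<^sub>C (\<psi> - \<xi>) = a *\<^sub>C \<psi> - a *\<^sub>C \<xi>"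
  by (rule cinner_ext) (simp add: cinner_scaleC_right cinner_diff_right ring_distribs)

lemma scaleC_zero_right [simp]: "a *\<^sub>C (0 :: l2) = 0"
  by (rule cinner_ext) (simp add: cinner_scaleC_right)

lemma norm_scaleC: "norm (c *\<^sub>C \<psi>) = cmod c * norm (\<psi> :: l2)"
proof -
  have "complex_of_real ((norm (c *\<^sub>C \<psi>))\<^sup>2) = cinner (c *\<^sub>C \<psi>) (c *\<^sub>C \<psi>)"
    by (simp only: cinner_self)
  also have "\<dots> = (c * cnj c) * cinner \<psi> \<psi>"
    by (simp add: cinner_scaleC_left cinner_scaleC_right)
  also have "\<dots> = complex_of_real ((cmod c * norm \<psi>)\<^sup>2)"
    by (simp add: cinner_self complex_mult_cnj cmod_power2 power_mult_distrib)
  finally have "(norm (c *\<^sub>C \<psi>))\<^sup>2 = (cmod c * norm \<psi>)\<^sup>2"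
    by (simp only: of_real_eq_iff)
  then show ?thesis by (simp add: power2_eq_iff_nonneg)
qed

text \<open>A phase \<open>c\<close> turns the complex inner product into its modulus, and the real
  Cauchy-Schwarz inequality applies to the rotated vector.\<close>

lemma cmod_cinner_le: "cmod (cinner \<phi> \<psi>) \<le> norm \<phi> * norm \<psi>"
proof (cases "cinner \<phi> \<psi> = 0")
  case False
  define c where "c = cnj (sgn (cinner \<phi> \<psi>))"
  have c: "cmod c = 1" using False by (simp add: c_def norm_sgn)
  have "c * cinner \<phi> \<psi> = complex_of_real (cmod (cinner \<phi> \<psi>))"
    using False unfolding c_def sgn_eq
    by (simp add: field_simps complex_norm_square[symmetric] power2_eq_square)
  then have "cmod (cinner \<phi> \<psi>) = inner \<phi> (c *\<^sub>C \<psi>)"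
    by (simp add: inner_l2_def cinner_scaleC_right)
  also have "\<dots> \<le> norm \<phi> * norm (c *\<^sub>C \<psi>)" by (rule norm_cauchy_schwarz)
  finally show ?thesis by (simp add: norm_scaleC c)
qed simp

lemma norm_L2_class:
  assumes "square_integrable f"
  shows "(norm (L2_class f))\<^sup>2 = (LINT x|lborel. (cmod (f x))\<^sup>2)"
proof -
  have "complex_of_real ((norm (L2_class f))\<^sup>2) = (LINT x|lborel. cnj (f x) * f x)"
    using cinner_self[of "L2_class f"] assms by (simp add: cinner_L2_class)
  also have "\<dots> = (LINT x|lborel. complex_of_real ((cmod (f x))\<^sup>2))"
    by (intro Bochner_Integration.integral_cong refl) (simp add: complex_norm_square mult.commute del: of_real_power)
  also have "\<dots> = complex_of_real (LINT x|lborel. (cmod (f x))\<^sup>2)"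
    by (rule integral_complex_of_real)
  finally show ?thesis by (simp only: of_real_eq_iff)
qed

lemma square_integrable_mult_bounded:
  assumes f: "square_integrable f" and m: "m \<in> borel_measurable borel" "\<And>x. cmod (m x) \<le> C"
  shows "square_integrable (\<lambda>x. m x * f x)"
proof -
  have [measurable]: "f \<in> borel_measurable borel" "m \<in> borel_measurable borel"
    using f m by (auto intro: square_integrable_measurable)
  have "integrable lborel (\<lambda>x. C\<^sup>2 * (cmod (f x))\<^sup>2)"
    using f by (simp add: square_integrable_def)
  then have "integrable lborel (\<lambda>x. (cmod (m x * f x))\<^sup>2)"
    by (rule Bochner_Integration.integrable_bound)
       (auto intro!: AE_I2 mult_right_mono power_mono m simp: norm_mult power_mult_distrib)
  then show ?thesis by (simp add: square_integrable_def)
qed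

lemma square_integrable_cong_AE:
  assumes "square_integrable f" "AE x in lborel. f x = g x" "g \<in> borel_measurable borel"
  shows "square_integrable g"
proof -
  have [measurable]: "f \<in> borel_measurable borel" "g \<in> borel_measurable borel"
    using assms by (auto intro: square_integrable_measurable)
  have "AE x in lborel. (cmod (f x))\<^sup>2 = (cmod (g x))\<^sup>2" using assms(2) by eventually_elim simp
  then have "integrable lborel (\<lambda>x. (cmod (g x))\<^sup>2)"
    using assms(1) by (subst integrable_cong_AE[symmetric]) (auto simp: square_integrable_def)
  then show ?thesis by (simp add: square_integrable_def)
qed

lemma square_integrable_bound:
  assumes "square_integrable f" "g \<in> borel_measurable borel" "AE x in lborel. cmod (g x) \<le> C * cmod (f x)"
  shows "square_integrable g"
proof -
  have [measurable]: "f \<in> borel_measurable borel" "g \<in> borel_measurable borel"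
    using assms by (auto intro: square_integrable_measurable)
  have "integrable lborel (\<lambda>x. C\<^sup>2 * (cmod (f x))\<^sup>2)"
    using assms by (simp add: square_integrable_def)
  then have "integrable lborel (\<lambda>x. (cmod (g x))\<^sup>2)"
  proof (rule Bochner_Integration.integrable_bound)
    show "AE x in lborel. norm ((cmod (g x))\<^sup>2) \<le> norm (C\<^sup>2 * (cmod (f x))\<^sup>2)"
      using assms(3)
    proof eventually_elim
      case (elim x)
      then have "(cmod (g x))\<^sup>2 \<le> (C * cmod (f x))\<^sup>2" by (intro power_mono) auto
      then show ?case by (simp add: power_mult_distrib)
    qed
  qed measurable
  then show ?thesis by (simp add: square_integrable_def)
qed

text \<open>Dominated convergence for the squared error, with majorant
  \<open>2 \<bar>g\<bar>^2 + 2 \<bar>f\<bar>^2\<close>.\<close>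

lemma L2_class_tendsto:
  assumes f: "square_integrable f" and s: "\<And>n. s n \<in> borel_measurable borel"
    and g: "square_integrable g"
    and lim: "AE x in lborel. (\<lambda>n. s n x) \<longlonglongrightarrow> f x"
    and bound: "\<And>n. AE x in lborel. cmod (s n x) \<le> cmod (g x)"
  shows "(\<lambda>n. L2_class (s n)) \<longlonglongrightarrow> L2_class f"
proof -
  have [measurable]: "f \<in> borel_measurable borel" "g \<in> borel_measurable borel"
      "\<And>n. s n \<in> borel_measurable borel"
    using assms by (auto intro: square_integrable_measurable)
  have s': "square_integrable (s n)" for n
    using square_integrable_bound[OF g s, where C = 1] bound by simp
  have "(\<lambda>n. LINT x|lborel. (cmod (s n x - f x))\<^sup>2) \<longlonglongrightarrow> (LINT x::real|lborel. (0::real))"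
  proof (rule integral_dominated_convergence[where f = "\<lambda>_. 0" and s = "\<lambda>n x. (cmod (s n x - f x))\<^sup>2"
        and w = "\<lambda>x. 2 * (cmod (g x))\<^sup>2 + 2 * (cmod (f x))\<^sup>2"])
    show "integrable lborel (\<lambda>x. 2 * (cmod (g x))\<^sup>2 + 2 * (cmod (f x))\<^sup>2)"
      using f g by (simp add: square_integrable_def)
    show "AE x in lborel. (\<lambda>n. (cmod (s n x - f x))\<^sup>2) \<longlonglongrightarrow> 0"
      using lim
    proof eventually_elim
      case (elim x)
      have "(\<lambda>n. (cmod (s n x - f x))\<^sup>2) \<longlonglongrightarrow> (cmod (f x - f x))\<^sup>2"
        by (intro tendsto_intros elim)
      then show ?case by simp
    qed
    show "AE x in lborel. norm ((cmod (s n x - f x))\<^sup>2) \<le> 2 * (cmod (g x))\<^sup>2 + 2 * (cmod (f x))\<^sup>2" for n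
      using bound[of n]
    proof eventually_elim
      case (elim x)
      have "(cmod (s n x - f x))\<^sup>2 \<le> (cmod (g x) + cmod (f x))\<^sup>2"
        using norm_triangle_ineq4[of "s n x" "f x"] elim by (intro power_mono) auto
      also have "\<dots> \<le> 2 * (cmod (g x))\<^sup>2 + 2 * (cmod (f x))\<^sup>2"
        using zero_le_power2[of "cmod (f x) - cmod (g x)"]
        by (simp add: power2_sum power2_diff algebra_simps)
      finally show ?case by simp
    qed
  qed measurable
  then have "(\<lambda>n. (norm (L2_class (s n) - L2_class f))\<^sup>2) \<longlonglongrightarrow> 0"
    using s' f by (simp add: L2_class_diff norm_L2_class square_integrable_diff)
  then have "(\<lambda>n. sqrt ((norm (L2_class (s n) - L2_class f))\<^sup>2)) \<longlonglongrightarrow> sqrt 0"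
    by (rule tendsto_real_sqrt)
  then show ?thesis
    by (simp add: tendsto_norm_zero_iff LIM_zero_iff)
qed

section \<open>Bounded complex-linear maps and multiplication operators\<close>

lemma bounded_clinearI:
  assumes "\<And>\<psi> \<xi>. A (\<psi> + \<xi>) = A \<psi> + A \<xi>" "\<And>c \<psi>. A (c *\<^sub>C \<psi>) = c *\<^sub>C A \<psi>"
    "\<And>\<psi>. norm (A \<psi>) \<le> K * norm \<psi>"
  shows "bounded_clinear A"
  unfolding bounded_clinear_def
  using assms by (auto intro!: bounded_linear_intro[where K = K] simp: scaleR_l2_def mult.commute)

lemma bounded_clinear_add: "bounded_clinear A \<Longrightarrow> A (\<psi> + \<xi>) = A \<psi> + A \<xi>"
  and bounded_clinear_diff: "bounded_clinear A \<Longrightarrow> A (\<psi> - \<xi>) = A \<psi> - A \<xi>"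
  and bounded_clinear_scaleC: "bounded_clinear A \<Longrightarrow> A (c *\<^sub>C \<psi>) = c *\<^sub>C A \<psi>"
  and bounded_clinear_zero: "bounded_clinear A \<Longrightarrow> A 0 = 0"
  and bounded_clinear_bounded_linear: "bounded_clinear A \<Longrightarrow> bounded_linear A"
  unfolding bounded_clinear_def
  by (auto simp: bounded_linear.linear linear_add linear_diff linear_0)

lemma bounded_clinear_compose:
  assumes "bounded_clinear A" "bounded_clinear B"
  shows "bounded_clinear (\<lambda>\<psi>. A (B \<psi>))"
  using assms bounded_linear_compose[of A B] by (auto simp: bounded_clinear_def)

lemma bounded_clinear_id: "bounded_clinear (\<lambda>\<psi>. \<psi>)"
  by (auto simp: bounded_clinear_def bounded_linear_ident)

text \<open>Complex polarization: the vectors \<open>\<phi> + \<psi>\<close> and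
  \<open>\<phi> + \<i> \<psi>\<close> give the sum and the difference of the two mixed terms, hence
  each of them. This is what makes operators specified by diagonal values unique.\<close>

lemma clinear_eq_if_diagonal_eq:
  assumes A: "bounded_clinear A" and B: "bounded_clinear B"
    and eq: "\<And>\<psi>. cinner \<psi> (A \<psi>) = cinner \<psi> (B \<psi>)"
  shows "A = B"
proof
  fix \<psi>
  show "A \<psi> = B \<psi>"
  proof (rule cinner_ext)
    fix \<phi>
    have 1: "cinner \<phi> (A \<psi>) + cinner \<psi> (A \<phi>) = cinner \<phi> (B \<psi>) + cinner \<psi> (B \<phi>)"
      using eq[of "\<phi> + \<psi>"] eq[of \<phi>] eq[of \<psi>]
      by (simp add: bounded_clinear_add[OF A] bounded_clinear_add[OF B] cinner_add_left
          cinner_add_right algebra_simps)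
    have "\<i> * cinner \<phi> (A \<psi>) - \<i> * cinner \<psi> (A \<phi>) = \<i> * cinner \<phi> (B \<psi>) - \<i> * cinner \<psi> (B \<phi>)"
      using eq[of "\<phi> + \<i> *\<^sub>C \<psi>"] eq[of \<phi>] eq[of \<psi>]
      by (simp add: bounded_clinear_add[OF A] bounded_clinear_add[OF B] cinner_add_left
          bounded_clinear_scaleC[OF A] bounded_clinear_scaleC[OF B] cinner_scaleC_left
          cinner_scaleC_right cinner_add_right algebra_simps)
    then have "cinner \<phi> (A \<psi>) - cinner \<psi> (A \<phi>) = cinner \<phi> (B \<psi>) - cinner \<psi> (B \<phi>)"
      by (simp flip: right_diff_distrib)
    from arg_cong2[where f = "(+)", OF 1 this]
    show "cinner \<phi> (A \<psi>) = cinner \<phi> (B \<psi>)" by simp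
  qed
qed

definition mult_op :: "(real \<Rightarrow> complex) \<Rightarrow> l2 \<Rightarrow> l2" where
  "mult_op m \<psi> = L2_class (\<lambda>x. m x * Rep_l2 \<psi> x)"

lemma mult_op_L2_class:
  assumes "square_integrable f" "m \<in> borel_measurable borel" "\<And>x. cmod (m x) \<le> C"
  shows "mult_op m (L2_class f) = L2_class (\<lambda>x. m x * f x)"
  unfolding mult_op_def
  using Rep_L2_class[OF assms(1)]
  by (subst L2_class_eq_iff) (auto intro!: square_integrable_mult_bounded assms square_integrable_Rep elim: eventually_mono)

lemma bounded_clinear_mult_op:
  assumes m: "m \<in> borel_measurable borel" "\<And>x. cmod (m x) \<le> C"
  shows "bounded_clinear (mult_op m)"
proof (rule bounded_clinearI[where K = C])
  have C: "C \<ge> 0" using m(2)[of 0] norm_ge_zero order_trans by blast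
  note [simp] = mult_op_L2_class[OF _ m] L2_class_add L2_class_scaleC square_integrable_add
    square_integrable_cmult square_integrable_mult_bounded[OF _ m]
  show "mult_op m (\<psi> + \<xi>) = mult_op m \<psi> + mult_op m \<xi>" for \<psi> \<xi>
    by (cases \<psi> rule: L2_cases, cases \<xi> rule: L2_cases) (simp add: distrib_left)
  show "mult_op m (c *\<^sub>C \<psi>) = c *\<^sub>C mult_op m \<psi>" for c \<psi>
    by (cases \<psi> rule: L2_cases) (simp add: mult.left_commute)
  show "norm (mult_op m \<psi>) \<le> C * norm \<psi>" for \<psi>
  proof (cases \<psi> rule: L2_cases)
    case (1 f)
    have "(norm (mult_op m \<psi>))\<^sup>2 = (LINT x|lborel. (cmod (m x * f x))\<^sup>2)"
      using 1 by (simp add: norm_L2_class)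
    also have "\<dots> \<le> (LINT x|lborel. C\<^sup>2 * (cmod (f x))\<^sup>2)"
      using 1 square_integrable_mult_bounded[OF 1(1) m]
      by (intro integral_mono)
         (auto simp: norm_mult power_mult_distrib square_integrable_def
          intro!: mult_right_mono power_mono m)
    also have "\<dots> = (C * norm \<psi>)\<^sup>2"
      using 1 by (simp add: norm_L2_class power_mult_distrib)
    finally show ?thesis
      by (rule power2_le_imp_le) (simp add: C)
  qed
qed

section \<open>Completeness\<close>

text \<open>The squared increments are weighted by \<open>2 ^ n\<close>, which their integrals of
  size \<open>(1/4) ^ n\<close> can afford. The weighted series is finite almost everywhere, so the
  increments there are at most a constant times \<open>sqrt (1/2) ^ n\<close>, a summable
  bound.\<close>

lemma L2_Cauchy_rep_AE_convergent:
  fixes f :: "nat \<Rightarrow> real \<Rightarrow> complex"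
  assumes f: "\<And>n. square_integrable (f n)"
    and le: "\<And>n. norm (L2_class (f (Suc n)) - L2_class (f n)) \<le> (1/2) ^ n"
  shows "AE x in lborel. convergent (\<lambda>n. f n x)"
proof -
  have [measurable]: "\<And>n. f n \<in> borel_measurable borel"
    using f by (auto intro: square_integrable_measurable)
  define d where "d n x = (cmod (f (Suc n) x - f n x))\<^sup>2" for n x
  have [measurable]: "\<And>n. d n \<in> borel_measurable borel" unfolding d_def by measurable
  have d_int: "integrable lborel (d n)" for n
    using square_integrable_diff[OF f f] by (simp add: d_def[abs_def] square_integrable_def)
  have d_nonneg: "0 \<le> d n x" for n x by (simp add: d_def)
  have d_le: "(LINT x|lborel. d n x) \<le> (1/4) ^ n" for n
  proof -
    have "(LINT x|lborel. d n x) = (norm (L2_class (f (Suc n)) - L2_class (f n)))\<^sup>2"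
      unfolding d_def by (simp add: L2_class_diff f norm_L2_class square_integrable_diff)
    also have "\<dots> \<le> ((1/2) ^ n)\<^sup>2" by (intro power_mono le) simp
    also have "\<dots> = (1/4) ^ n" by (simp add: power2_eq_square flip: power_mult_distrib)
    finally show ?thesis .
  qed
  have "(\<integral>\<^sup>+x. (\<Sum>n. ennreal (2 ^ n * d n x)) \<partial>lborel) = (\<Sum>n. \<integral>\<^sup>+x. ennreal (2 ^ n * d n x) \<partial>lborel)"
    by (rule nn_integral_suminf) simp
  also have "\<dots> = (\<Sum>n. ennreal (2 ^ n * (LINT x|lborel. d n x)))"
    by (subst nn_integral_eq_integral) (auto simp: d_int d_nonneg)
  also have "\<dots> \<le> (\<Sum>n. ennreal ((1/2) ^ n))"
  proof (intro suminf_le ennreal_leI)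
    fix n
    have "2 ^ n * (LINT x|lborel. d n x) \<le> 2 ^ n * (1/4) ^ n"
      by (intro mult_left_mono d_le) simp
    also have "\<dots> = (1/2 :: real) ^ n" by (simp flip: power_mult_distrib)
    finally show "2 ^ n * (LINT x|lborel. d n x) \<le> (1/2) ^ n" .
  qed auto
  also have "\<dots> = ennreal (\<Sum>n. (1/2) ^ n)"
    by (rule suminf_ennreal2) (auto intro: summable_geometric)
  also have "\<dots> < \<infinity>" by simp
  finally have "(\<integral>\<^sup>+x. (\<Sum>n. ennreal (2 ^ n * d n x)) \<partial>lborel) \<noteq> \<infinity>" by simp
  then have "AE x in lborel. (\<Sum>n. ennreal (2 ^ n * d n x)) \<noteq> \<infinity>"
    by (intro nn_integral_PInf_AE) auto
  then show ?thesis
  proof eventually_elim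
    case (elim x)
    have "summable (\<lambda>n. 2 ^ n * d n x)"
      by (rule summable_suminf_not_top) (use elim in \<open>auto simp: d_def\<close>)
    then have "(\<lambda>n. 2 ^ n * d n x) \<longlonglongrightarrow> 0" by (rule summable_LIMSEQ_zero)
    then obtain C where C: "\<And>n. 2 ^ n * d n x \<le> C"
      using convergent_imp_Bseq[of "\<lambda>n. 2 ^ n * d n x"] Bseq_def[of "\<lambda>n. 2 ^ n * d n x"]
      by (metis convergentI abs_ge_self order_trans real_norm_def)
    have "cmod (f (Suc n) x - f n x) \<le> sqrt C * (sqrt (1/2)) ^ n" for n
    proof -
      have "d n x \<le> C * (1/2) ^ n"
        using C[of n] by (simp add: field_simps)
      then have "sqrt (d n x) \<le> sqrt (C * (1/2) ^ n)" by simp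
      then show ?thesis
        by (simp add: d_def real_sqrt_mult real_sqrt_power)
    qed
    moreover have "summable (\<lambda>n. sqrt C * (sqrt (1/2)) ^ n)"
      by (intro summable_mult summable_geometric) simp
    ultimately have "summable (\<lambda>n. f (Suc n) x - f n x)"
      by (rule summable_comparison_test'[rotated, where N = 0])
    then have "convergent (\<lambda>n. f 0 x + (\<Sum>i<n. f (Suc i) x - f i x))"
      by (intro convergent_add convergent_const) (simp add: summable_iff_convergent)
    moreover have "f 0 x + (\<Sum>i<n. f (Suc i) x - f i x) = f n x" for n
      using sum_lessThan_telescope[of "\<lambda>i. f i x" n] by simp
    ultimately show ?case by simp
  qed
qed

text \<open>Riesz-Fischer: a rapidly Cauchy subsequence converges almost everywhere, and Fatou's
  lemma turns the Cauchy estimate into an estimate for the distance to the pointwise limit.\<close>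

instance l2 :: complete_space
proof
  fix X :: "nat \<Rightarrow> l2" assume X: "Cauchy X"
  have "\<exists>r. strict_mono r \<and> (\<forall>n. norm (X (r (Suc n)) - X (r n)) \<le> (1/2) ^ n)"
  proof -
    have "\<exists>N. \<forall>m\<ge>N. \<forall>n\<ge>N. norm (X m - X n) < (1/2) ^ k" for k :: nat
      using X by (rule CauchyD) simp
    then obtain N where N: "\<And>k m n. m \<ge> N k \<Longrightarrow> n \<ge> N k \<Longrightarrow> norm (X m - X n) < (1/2) ^ k"
      by metis
    \<comment> \<open>The sum puts \<open>r k\<close> above \<open>N k\<close>, and the summand
      \<open>k\<close> makes \<open>r\<close> strictly increasing.\<close>
    define r where "r k = (\<Sum>i\<le>k. N i) + k" for k
    have "strict_mono r" unfolding strict_mono_Suc_iff by (simp add: r_def)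
    moreover have "N k \<le> r k" for k
      unfolding r_def using member_le_sum[of k "{..k}" N] by auto
    then have "norm (X (r (Suc n)) - X (r n)) \<le> (1/2) ^ n" for n
      using N[where k = n] \<open>strict_mono r\<close> by (meson less_imp_le order_trans strict_mono_Suc_iff)
    ultimately show ?thesis by blast
  qed
  then obtain r where r: "strict_mono r" and le: "\<And>n. norm (X (r (Suc n)) - X (r n)) \<le> (1/2) ^ n"
    by blast
  define f where "f n = Rep_l2 (X (r n))" for n
  have f: "square_integrable (f n)" and fX: "L2_class (f n) = X (r n)" for n
    by (simp_all add: f_def square_integrable_Rep)
  then have [measurable]: "\<And>n. f n \<in> borel_measurable borel"
    by (auto intro: square_integrable_measurable)
  have norm_diff: "ennreal ((norm (X (r m) - L2_class h))\<^sup>2) = (\<integral>\<^sup>+x. ennreal ((cmod (f m x - h x))\<^sup>2) \<partial>lborel)"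
    if "square_integrable h" for h m
  proof -
    have *: "square_integrable (\<lambda>x. f m x - h x)" by (rule square_integrable_diff[OF f that])
    have "X (r m) - L2_class h = L2_class (\<lambda>x. f m x - h x)"
      by (metis L2_class_diff f fX that)
    then show ?thesis
      using * by (subst nn_integral_eq_integral) (auto simp: norm_L2_class square_integrable_def)
  qed
  have conv: "AE x in lborel. convergent (\<lambda>n. f n x)"
    by (rule L2_Cauchy_rep_AE_convergent[OF f]) (simp add: fX le)
  \<comment> \<open>Where the sequence diverges \<open>lim\<close> is an arbitrary value; this
    happens only on a null set.\<close>
  define g where "g x = lim (\<lambda>n. f n x)" for x
  have [measurable]: "g \<in> borel_measurable borel" unfolding g_def by measurable
  have fatou: "(\<integral>\<^sup>+x. ennreal ((cmod (f m x - g x))\<^sup>2) \<partial>lborel) \<le> ennreal (e\<^sup>2)"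
    if e: "0 < e" "\<And>n. n \<ge> m \<Longrightarrow> norm (X (r m) - X (r n)) \<le> e" for m e
  proof -
    have "(\<integral>\<^sup>+x. ennreal ((cmod (f m x - g x))\<^sup>2) \<partial>lborel)
        = (\<integral>\<^sup>+x. liminf (\<lambda>n. ennreal ((cmod (f m x - f n x))\<^sup>2)) \<partial>lborel)"
    proof (rule nn_integral_cong_AE)
      show "AE x in lborel. ennreal ((cmod (f m x - g x))\<^sup>2) = liminf (\<lambda>n. ennreal ((cmod (f m x - f n x))\<^sup>2))"
        using conv
      proof eventually_elim
        case (elim x)
        then have "(\<lambda>n. f n x) \<longlonglongrightarrow> g x" by (simp add: g_def convergent_LIMSEQ_iff)
        then have "(\<lambda>n. ennreal ((cmod (f m x - f n x))\<^sup>2)) \<longlonglongrightarrow> ennreal ((cmod (f m x - g x))\<^sup>2)"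
          by (intro tendsto_ennrealI tendsto_intros)
        then show ?case by (intro lim_imp_Liminf[symmetric]) auto
      qed
    qed
    also have "\<dots> \<le> liminf (\<lambda>n. \<integral>\<^sup>+x. ennreal ((cmod (f m x - f n x))\<^sup>2) \<partial>lborel)"
      by (rule nn_integral_liminf) simp
    also have "\<dots> \<le> ennreal (e\<^sup>2)"
    proof (rule Liminf_le)
      show "\<forall>\<^sub>F n in sequentially. (\<integral>\<^sup>+x. ennreal ((cmod (f m x - f n x))\<^sup>2) \<partial>lborel) \<le> ennreal (e\<^sup>2)"
      proof (rule eventually_sequentiallyI[of m])
        fix n assume "m \<le> n"
        have "(\<integral>\<^sup>+x. ennreal ((cmod (f m x - f n x))\<^sup>2) \<partial>lborel) = ennreal ((norm (X (r m) - X (r n)))\<^sup>2)"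
          using norm_diff[OF f, of m n] by (simp add: fX)
        also have "\<dots> \<le> ennreal (e\<^sup>2)"
          using e(2)[OF \<open>m \<le> n\<close>] by (intro ennreal_leI power_mono) auto
        finally show "(\<integral>\<^sup>+x. ennreal ((cmod (f m x - f n x))\<^sup>2) \<partial>lborel) \<le> ennreal (e\<^sup>2)" .
      qed
    qed simp
    finally show ?thesis .
  qed
  have diff: "square_integrable (\<lambda>x. f m x - g x)"
    if e: "0 < e" "\<And>n. n \<ge> m \<Longrightarrow> norm (X (r m) - X (r n)) \<le> e" for m e
    unfolding square_integrable_def
    using le_less_trans[OF fatou[OF that] ennreal_less_top] by (auto intro!: integrableI_nonneg)
  \<comment> \<open>A single index within distance 1 of its tail suffices: \<open>g\<close> differs
    from \<open>f m0\<close> by a square-integrable function.\<close>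
  obtain m0 where m0: "\<And>n. n \<ge> m0 \<Longrightarrow> norm (X (r m0) - X (r n)) \<le> 1"
    using CauchyD[OF Cauchy_subseq_Cauchy[OF X r], of 1] by (force simp: less_imp_le)
  have g: "square_integrable g"
    using square_integrable_diff[OF f diff[OF _ m0], of m0] by simp
  have "(\<lambda>n. X (r n)) \<longlonglongrightarrow> L2_class g"
  proof (rule LIMSEQ_I)
    fix e :: real assume "0 < e"
    then obtain M where M: "\<And>m n. m \<ge> M \<Longrightarrow> n \<ge> M \<Longrightarrow> norm (X (r m) - X (r n)) < e / 2"
      using CauchyD[OF Cauchy_subseq_Cauchy[OF X r], of "e/2"] by auto
    show "\<exists>no. \<forall>n\<ge>no. norm (X (r n) - L2_class g) < e"
    proof (intro exI allI impI)
      fix m assume m: "m \<ge> M"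
      have *: "n \<ge> m \<Longrightarrow> norm (X (r m) - X (r n)) \<le> e / 2" for n
        using M[of m n] m by simp
      have "ennreal ((norm (X (r m) - L2_class g))\<^sup>2) = (\<integral>\<^sup>+x. ennreal ((cmod (f m x - g x))\<^sup>2) \<partial>lborel)"
        by (rule norm_diff[OF g])
      also have "\<dots> \<le> ennreal ((e/2)\<^sup>2)"
        using \<open>0 < e\<close> by (intro fatou *) auto
      finally have "norm (X (r m) - L2_class g) \<le> e / 2"
        using \<open>0 < e\<close> by (simp add: ennreal_le_iff power2_le_iff_abs_le)
      then show "norm (X (r m) - L2_class g) < e" using \<open>0 < e\<close> by simp
    qed
  qed
  then show "convergent X"
    using Cauchy_converges_subseq[OF X r] by (auto simp: comp_def convergent_def)
qed

section \<open>Projection-valued measures\<close>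

lemma Int_stable_Ioc: "Int_stable (range (\<lambda>(a, b). {a<..b::real}))"
  unfolding Int_stable_def
proof clarify
  fix a b a' b' :: real
  have "{a<..b} \<inter> {a'<..b'} = (\<lambda>(a, b). {a<..b}) (max a a', min b b')" by auto
  then show "{a<..b} \<inter> {a'<..b'} \<in> range (\<lambda>(a, b). {a<..b})" by blast
qed

lemma sets_borel_Ioc: "sets borel = sigma_sets UNIV (range (\<lambda>(a, b). {a<..b::real}))"
  by (subst borel_sigma_sets_Ioc) simp

lemma UN_Ioc: "(\<Union>n. {- real n<..real n}) = UNIV"
proof -
  have "\<exists>n. - real n < x \<and> x \<le> real n" for x
    using reals_Archimedean2[of "\<bar>x\<bar>"] by (meson abs_less_iff less_imp_le minus_less_iff)
  then show ?thesis by force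
qed

lemma orthogonal_projectionD:
  assumes "orthogonal_projection P"
  shows "bounded_clinear P" "P (P \<psi>) = P \<psi>" "cinner (P \<phi>) \<psi> = cinner \<phi> (P \<psi>)"
  using assms by (auto simp: orthogonal_projection_def fun_eq_iff)

lemma cinner_orthogonal_projection:
  assumes "orthogonal_projection P"
  shows "cinner \<psi> (P \<psi>) = complex_of_real ((norm (P \<psi>))\<^sup>2)"
  by (metis assms cinner_self orthogonal_projectionD(2,3))

context
  fixes E assumes E: "projection_valued_measure E"
begin

lemma pvm_proj: "S \<in> sets borel \<Longrightarrow> orthogonal_projection (E S)"
  using E by (simp add: projection_valued_measure_def)

lemma pvm_Int: "S \<in> sets borel \<Longrightarrow> T \<in> sets borel \<Longrightarrow> E S (E T \<psi>) = E (S \<inter> T) \<psi>"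
  using E by (simp add: projection_valued_measure_def)

lemma pvm_empty: "E {} \<psi> = 0" and pvm_UNIV: "E UNIV \<psi> = \<psi>"
  using E by (simp_all add: projection_valued_measure_def)

lemma pvm_Un:
  assumes "S \<in> sets borel" "T \<in> sets borel" "S \<inter> T = {}"
  shows "E (S \<union> T) \<psi> = E S \<psi> + E T \<psi>"
proof -
  have "range (binaryset S T) \<subseteq> sets borel"
    using assms by (auto simp: range_binaryset_eq)
  moreover have disj: "disjoint_family (binaryset S T)"
    using assms by (auto simp: disjoint_family_on_def binaryset_def)
  ultimately have "(\<lambda>n. E (binaryset S T n) \<psi>) sums E (\<Union>n. binaryset S T n) \<psi>"
    using E disj unfolding projection_valued_measure_def by blast
  moreover have "(\<lambda>n. E (binaryset S T n) \<psi>) sums (E S \<psi> + E T \<psi>)"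
    by (rule binaryset_sums) (rule pvm_empty)
  ultimately show ?thesis
    by (metis UN_binaryset_eq sums_unique2)
qed

lemma pvm_compl: "S \<in> sets borel \<Longrightarrow> E (- S) \<psi> = \<psi> - E S \<psi>"
  using pvm_Un[of S "- S" \<psi>] by (simp add: pvm_UNIV borel_comp eq_diff_eq add.commute)

lemma sets_diagonal_measure [measurable_cong, simp]: "sets (diagonal_measure E \<psi>) = sets borel"
  by (simp add: diagonal_measure_def sigma_algebra.sets_measure_of_eq[OF sets.sigma_algebra_axioms[of borel, simplified]])

lemma space_diagonal_measure [simp]: "space (diagonal_measure E \<psi>) = UNIV"
  by (simp add: diagonal_measure_def space_measure_of_conv)

text \<open>For a projection the quadratic form is a squared norm, hence nonnegative; countable
  additivity comes from strong additivity of \<open>E\<close> and continuity of the inner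
  product.\<close>

lemma emeasure_diagonal_measure:
  assumes "S \<in> sets borel"
  shows "emeasure (diagonal_measure E \<psi>) S = ennreal ((norm (E S \<psi>))\<^sup>2)"
proof -
  have form: "Re (cinner \<psi> (E S \<psi>)) = (norm (E S \<psi>))\<^sup>2" if "S \<in> sets borel" for S
    using cinner_orthogonal_projection[OF pvm_proj[OF that]] by simp
  have "emeasure (diagonal_measure E \<psi>) S = ennreal (Re (cinner \<psi> (E S \<psi>)))"
  proof (rule emeasure_measure_of[OF diagonal_measure_def])
    show "positive (sets (diagonal_measure E \<psi>)) (\<lambda>S. ennreal (Re (cinner \<psi> (E S \<psi>))))"
      by (simp add: positive_def pvm_empty)
    show "countably_additive (sets (diagonal_measure E \<psi>)) (\<lambda>S. ennreal (Re (cinner \<psi> (E S \<psi>))))"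
    proof (rule countably_additiveI)
      fix A :: "nat \<Rightarrow> real set"
      assume A: "range A \<subseteq> sets (diagonal_measure E \<psi>)" "disjoint_family A"
      then have "(\<lambda>n. E (A n) \<psi>) sums E (\<Union>n. A n) \<psi>"
        using E by (simp add: projection_valued_measure_def)
      then have "(\<lambda>n. inner \<psi> (E (A n) \<psi>)) sums inner \<psi> (E (\<Union>n. A n) \<psi>)"
        by (rule bounded_linear.sums[OF bounded_linear_inner_right])
      moreover have "0 \<le> inner \<psi> (E (A n) \<psi>)" for n
        using form[of "A n"] A by (auto simp: inner_l2_def)
      ultimately show "(\<Sum>i. ennreal (Re (cinner \<psi> (E (A i) \<psi>)))) = ennreal (Re (cinner \<psi> (E (\<Union>i. A i) \<psi>)))"
        by (simp add: inner_l2_def[symmetric] suminf_ennreal2 sums_iff)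
    qed
  qed (use assms in auto)
  then show ?thesis by (simp add: form assms)
qed

lemma finite_diagonal_measure: "finite_measure (diagonal_measure E \<psi>)"
  by (rule finite_measureI) (simp add: emeasure_diagonal_measure)

lemma measure_diagonal_measure:
  "S \<in> sets borel \<Longrightarrow> measure (diagonal_measure E \<psi>) S = (norm (E S \<psi>))\<^sup>2"
  by (simp add: measure_def emeasure_diagonal_measure)

text \<open>Because the projections multiply under intersection, projecting a vector cuts its
  measure down to \<open>S\<close>. Questions about projected vectors become questions about
  restricted integrands.\<close>

lemma diagonal_measure_pvm:
  assumes S: "S \<in> sets borel"
  shows "diagonal_measure E (E S \<psi>) = density (diagonal_measure E \<psi>) (\<lambda>x. ennreal (indicator S x))"
proof (rule measure_eqI)
  fix A assume "A \<in> sets (diagonal_measure E (E S \<psi>))"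
  then have A: "A \<in> sets borel" by simp
  have "emeasure (density (diagonal_measure E \<psi>) (\<lambda>x. ennreal (indicator S x))) A
      = (\<integral>\<^sup>+ x. indicator (A \<inter> S) x \<partial>diagonal_measure E \<psi>)"
    using A S by (subst emeasure_density) (auto intro!: nn_integral_cong simp del: nn_integral_indicator simp: indicator_def)
  also have "\<dots> = ennreal ((norm (E (A \<inter> S) \<psi>))\<^sup>2)"
    using A S by (subst nn_integral_indicator) (auto simp: emeasure_diagonal_measure)
  finally show "emeasure (diagonal_measure E (E S \<psi>)) A
      = emeasure (density (diagonal_measure E \<psi>) (\<lambda>x. ennreal (indicator S x))) A"
    using A S by (simp add: emeasure_diagonal_measure pvm_Int)
qed simp

lemma diagonal_measure_bounded_integrable:
  assumes "f \<in> borel_measurable borel" "\<And>x. norm (f x :: 'b :: {banach, second_countable_topology}) \<le> C"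
  shows "integrable (diagonal_measure E \<psi>) f"
  using assms by (intro finite_measure.integrable_const_bound[OF finite_diagonal_measure]) auto

end

section \<open>The position operator\<close>

definition position_pvm :: "real set \<Rightarrow> l2 \<Rightarrow> l2" where
  "position_pvm S = mult_op (indicator S)"

lemma position_pvm_L2_class:
  "square_integrable f \<Longrightarrow> S \<in> sets borel \<Longrightarrow>
    position_pvm S (L2_class f) = L2_class (\<lambda>x. indicator S x * f x)"
  unfolding position_pvm_def by (rule mult_op_L2_class[where C = 1]) (auto simp: indicator_def)

lemma square_integrable_indicator_mult:
  "square_integrable f \<Longrightarrow> S \<in> sets borel \<Longrightarrow> square_integrable (\<lambda>x. indicator S x * f x)"
  by (rule square_integrable_mult_bounded[where C = 1]) (auto simp: indicator_def)

lemma orthogonal_projection_position_pvm: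
  assumes S: "S \<in> sets borel"
  shows "orthogonal_projection (position_pvm S)"
proof -
  have "position_pvm S (position_pvm S \<psi>) = position_pvm S \<psi>" for \<psi>
    by (cases \<psi> rule: L2_cases)
       (simp add: position_pvm_L2_class square_integrable_indicator_mult S flip: mult.assoc indicator_inter_arith)
  moreover have "cinner (position_pvm S \<phi>) \<psi> = cinner \<phi> (position_pvm S \<psi>)" for \<phi> \<psi>
    by (cases \<psi> rule: L2_cases, cases \<phi> rule: L2_cases)
       (simp add: position_pvm_L2_class square_integrable_indicator_mult S cinner_L2_class,
        intro Bochner_Integration.integral_cong, auto simp: indicator_def)
  moreover have "bounded_clinear (position_pvm S)"
    unfolding position_pvm_def by (rule bounded_clinear_mult_op[where C = 1]) (use S in \<open>auto simp: indicator_def\<close>)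
  ultimately show ?thesis by (auto simp: orthogonal_projection_def)
qed

lemma projection_valued_measure_position_pvm: "projection_valued_measure position_pvm"
  unfolding projection_valued_measure_def
proof (intro conjI ballI allI impI)
  show "orthogonal_projection (position_pvm S)" if "S \<in> sets borel" for S
    by (rule orthogonal_projection_position_pvm[OF that])
  show "position_pvm {} = (\<lambda>\<psi>. 0)" "position_pvm UNIV = id"
    by (auto simp: position_pvm_def mult_op_def L2_class_zero)
  show "position_pvm (S \<inter> T) = position_pvm S \<circ> position_pvm T" if "S \<in> sets borel" "T \<in> sets borel" for S T
  proof
    fix \<psi>
    show "position_pvm (S \<inter> T) \<psi> = (position_pvm S \<circ> position_pvm T) \<psi>"
      using that by (cases \<psi> rule: L2_cases)
       (simp add: position_pvm_L2_class square_integrable_indicator_mult indicator_inter_arith mult.assoc)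
  qed
  fix S :: "nat \<Rightarrow> real set" and \<psi> assume S: "range S \<subseteq> sets borel" "disjoint_family S"
  obtain f where f: "square_integrable f" "\<psi> = L2_class f" by (rule L2_cases)
  have [measurable]: "f \<in> borel_measurable borel" using f by (simp add: square_integrable_measurable)
  have [measurable]: "S n \<in> sets borel" for n using S by auto
  have sum: "(\<Sum>n<N. position_pvm (S n) \<psi>) = position_pvm (\<Union>n<N. S n) \<psi>" for N
  proof (induction N)
    case 0
    then show ?case by (simp add: position_pvm_def mult_op_def L2_class_zero)
  next
    case (Suc N)
    have "S n \<inter> S N = {}" if "n < N" for n
      using S(2) that by (auto simp: disjoint_family_on_def)
    then have disj: "(\<Union>n<N. S n) \<inter> S N = {}" by blast
    then have "indicator (\<Union>n<Suc N. S n) x = indicator (\<Union>n<N. S n) x + (indicator (S N) x :: complex)" for x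
      by (auto simp: indicator_def less_Suc_eq)
    then have "position_pvm (\<Union>n<Suc N. S n) \<psi> = position_pvm (\<Union>n<N. S n) \<psi> + position_pvm (S N) \<psi>"
      using f by (simp add: position_pvm_L2_class square_integrable_indicator_mult L2_class_add distrib_right del: UN_simps)
    then show ?case by (simp add: Suc)
  qed
  have "(\<lambda>N. L2_class (\<lambda>x. indicator (\<Union>n<N. S n) x * f x)) \<longlonglongrightarrow> L2_class (\<lambda>x. indicator (\<Union>n. S n) x * f x)"
  proof (rule L2_class_tendsto[where g = f])
    show "AE x in lborel. (\<lambda>N. indicator (\<Union>n<N. S n) x * f x) \<longlonglongrightarrow> indicator (\<Union>n. S n) x * f x"
    proof (intro AE_I2 tendsto_mult tendsto_const)
      fix x
      show "(\<lambda>N. indicator (\<Union>n<N. S n) x) \<longlonglongrightarrow> (indicator (\<Union>n. S n) x :: complex)"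
        by (rule LIMSEQ_indicator_UN)
    qed
    show "square_integrable (\<lambda>x. indicator (\<Union>n. S n) x * f x)"
      by (rule square_integrable_indicator_mult[OF f(1)]) measurable
  qed (auto simp: f indicator_def)
  then show "(\<lambda>n. position_pvm (S n) \<psi>) sums position_pvm (\<Union>n. S n) \<psi>"
    by (simp add: sums_def sum) (simp add: f position_pvm_L2_class)
qed

lemma norm_position_pvm:
  assumes "square_integrable f" "S \<in> sets borel"
  shows "(norm (position_pvm S (L2_class f)))\<^sup>2 = (LINT x|lborel. indicator S x * (cmod (f x))\<^sup>2)"
  using assms by (simp add: position_pvm_L2_class square_integrable_indicator_mult norm_L2_class)
     (auto intro!: Bochner_Integration.integral_cong simp: indicator_def)

lemma diagonal_measure_position_pvm:
  assumes f: "square_integrable f"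
  shows "diagonal_measure position_pvm (L2_class f) = density lborel (\<lambda>x. ennreal ((cmod (f x))\<^sup>2))"
proof (rule measure_eqI)
  have [measurable]: "f \<in> borel_measurable borel" using f by (simp add: square_integrable_measurable)
  note pvm = projection_valued_measure_position_pvm
  show "sets (diagonal_measure position_pvm (L2_class f)) = sets (density lborel (\<lambda>x. ennreal ((cmod (f x))\<^sup>2)))"
    by (simp add: sets_diagonal_measure[OF pvm])
  fix A assume "A \<in> sets (diagonal_measure position_pvm (L2_class f))"
  then have [measurable]: "A \<in> sets borel" by (simp add: sets_diagonal_measure[OF pvm])
  have "integrable lborel (\<lambda>x. indicator A x * (cmod (f x))\<^sup>2)"
    using f integrable_mult_indicator[of A lborel "\<lambda>x. (cmod (f x))\<^sup>2"] by (simp add: square_integrable_def)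
  then have "emeasure (diagonal_measure position_pvm (L2_class f)) A
      = (\<integral>\<^sup>+x. ennreal (indicator A x * (cmod (f x))\<^sup>2) \<partial>lborel)"
    by (simp add: emeasure_diagonal_measure[OF pvm] norm_position_pvm f nn_integral_eq_integral)
  also have "\<dots> = emeasure (density lborel (\<lambda>x. ennreal ((cmod (f x))\<^sup>2))) A"
    by (auto simp: emeasure_density indicator_def intro!: nn_integral_cong)
  finally show "emeasure (diagonal_measure position_pvm (L2_class f)) A
      = emeasure (density lborel (\<lambda>x. ennreal ((cmod (f x))\<^sup>2))) A" .
qed


section \<open>The graph of multiplication by the coordinate\<close>

lemma Rep_l2_add: "AE x in lborel. Rep_l2 (\<psi> + \<xi>) x = Rep_l2 \<psi> x + Rep_l2 \<xi> x"
  using Rep_L2_class[OF square_integrable_add[OF square_integrable_Rep square_integrable_Rep]]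
  by (simp flip: L2_class_add[OF square_integrable_Rep square_integrable_Rep])

lemma Rep_l2_scaleC: "AE x in lborel. Rep_l2 (c *\<^sub>C \<psi>) x = c * Rep_l2 \<psi> x"
  using Rep_L2_class[OF square_integrable_cmult[OF square_integrable_Rep]]
  by (simp flip: L2_class_scaleC[OF square_integrable_Rep])

lemma l2_eqI: "AE x in lborel. Rep_l2 \<psi> x = Rep_l2 \<xi> x \<Longrightarrow> \<psi> = \<xi>"
  by (metis L2_class_Rep L2_class_eq_iff square_integrable_Rep)

lemma measurable_Rep_l2 [measurable]: "Rep_l2 \<psi> \<in> borel_measurable borel"
  by (rule square_integrable_measurable[OF square_integrable_Rep])

text \<open>The definition asks for representatives related at every point. Starting from any
  representative of \<open>\<psi>\<close>, its product with \<open>x\<close> supplies one for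
  \<open>\<phi>\<close>, so almost everywhere is enough.\<close>

lemma position_op_iff:
  "(\<psi>, \<phi>) \<in> position_op \<longleftrightarrow> (AE x in lborel. Rep_l2 \<phi> x = of_real x * Rep_l2 \<psi> x)"
proof
  assume "(\<psi>, \<phi>) \<in> position_op"
  then obtain f g where *: "\<psi> = L2_class f" "\<phi> = L2_class g" "square_integrable f" "square_integrable g"
    "\<forall>x. g x = of_real x * f x"
    by (auto simp: position_op_def)
  show "AE x in lborel. Rep_l2 \<phi> x = of_real x * Rep_l2 \<psi> x"
    using Rep_L2_class[OF *(3)] Rep_L2_class[OF *(4)] by eventually_elim (use * in simp)
next
  assume *: "AE x in lborel. Rep_l2 \<phi> x = of_real x * Rep_l2 \<psi> x"
  have si: "square_integrable (\<lambda>x. of_real x * Rep_l2 \<psi> x)"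
    by (rule square_integrable_cong_AE[OF square_integrable_Rep *]) measurable
  then have "\<phi> = L2_class (\<lambda>x. of_real x * Rep_l2 \<psi> x)"
    using * by (metis L2_class_Rep L2_class_eq_iff square_integrable_Rep)
  then show "(\<psi>, \<phi>) \<in> position_op"
    using si by (force simp: position_op_def square_integrable_Rep intro: L2_class_Rep[symmetric])
qed

lemma Domain_position_op:
  "Domain position_op = {\<psi>. square_integrable (\<lambda>x. of_real x * Rep_l2 \<psi> x)}"
proof (intro set_eqI iffI)
  fix \<psi> assume "\<psi> \<in> Domain position_op"
  then obtain \<phi> where "(\<psi>, \<phi>) \<in> position_op" by blast
  then show "\<psi> \<in> {\<psi>. square_integrable (\<lambda>x. of_real x * Rep_l2 \<psi> x)}"
    by (auto simp: position_op_iff intro!: square_integrable_cong_AE[OF square_integrable_Rep])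
next
  fix \<psi> assume "\<psi> \<in> {\<psi>. square_integrable (\<lambda>x. of_real x * Rep_l2 \<psi> x)}"
  then have "(\<psi>, L2_class (\<lambda>x. of_real x * Rep_l2 \<psi> x)) \<in> position_op"
    by (auto simp: position_op_iff intro: Rep_L2_class)
  then show "\<psi> \<in> Domain position_op" by blast
qed

lemma linear_graph_position_op: "linear_graph position_op"
  unfolding linear_graph_def
proof (intro conjI allI impI)
  show "single_valued position_op"
  proof (rule single_valuedI)
    fix \<psi> \<phi> \<phi>' assume "(\<psi>, \<phi>) \<in> position_op" "(\<psi>, \<phi>') \<in> position_op"
    then have "AE x in lborel. Rep_l2 \<phi> x = Rep_l2 \<phi>' x"
      unfolding position_op_iff by eventually_elim simp
    then show "\<phi> = \<phi>'" by (rule l2_eqI)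
  qed
  show "(0, 0) \<in> position_op"
    using Rep_l2_scaleC[of 0 0] unfolding position_op_iff by eventually_elim simp
  fix \<psi> \<phi> \<psi>' \<phi>' assume *: "(\<psi>, \<phi>) \<in> position_op" "(\<psi>', \<phi>') \<in> position_op"
  show "(\<psi> + \<psi>', \<phi> + \<phi>') \<in> position_op"
    using * Rep_l2_add[of \<psi> \<psi>'] Rep_l2_add[of \<phi> \<phi>'] unfolding position_op_iff
    by eventually_elim (simp add: distrib_left)
next
  fix c \<psi> \<phi> assume *: "(\<psi>, \<phi>) \<in> position_op"
  show "(c *\<^sub>C \<psi>, c *\<^sub>C \<phi>) \<in> position_op"
    using * Rep_l2_scaleC[of c \<psi>] Rep_l2_scaleC[of c \<phi>] unfolding position_op_iff
    by eventually_elim (simp add: mult.left_commute)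
qed

lemma spectral_resolution_position_pvm: "spectral_resolution position_pvm position_op"
  unfolding spectral_resolution_def
proof (intro conjI projection_valued_measure_position_pvm linear_graph_position_op)
  have diag: "diagonal_measure position_pvm \<psi> = density lborel (\<lambda>x. ennreal ((cmod (Rep_l2 \<psi> x))\<^sup>2))" for \<psi>
    using diagonal_measure_position_pvm[OF square_integrable_Rep, of \<psi>] by simp
  have "integrable (diagonal_measure position_pvm \<psi>) (\<lambda>x. x\<^sup>2)
      \<longleftrightarrow> square_integrable (\<lambda>x. of_real x * Rep_l2 \<psi> x)" for \<psi>
    unfolding diag square_integrable_def
    by (subst integrable_density) (auto simp: norm_mult power_mult_distrib mult.commute)
  then show "Domain position_op = {\<psi>. integrable (diagonal_measure position_pvm \<psi>) (\<lambda>x. x\<^sup>2)}"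
    by (simp add: Domain_position_op)
  show "\<forall>(\<psi>, \<phi>)\<in>position_op. cinner \<psi> \<phi> = complex_of_real (LINT x|diagonal_measure position_pvm \<psi>. x)"
  proof safe
    fix \<psi> \<phi> assume *: "(\<psi>, \<phi>) \<in> position_op"
    have "cinner \<psi> \<phi> = (LINT x|lborel. cnj (Rep_l2 \<psi> x) * Rep_l2 \<phi> x)"
      using cinner_L2_class[OF square_integrable_Rep square_integrable_Rep, of \<psi> \<phi>] by simp
    also have "\<dots> = (LINT x|lborel. complex_of_real ((cmod (Rep_l2 \<psi> x))\<^sup>2 *\<^sub>R x))"
    proof (rule integral_cong_AE)
      show "AE x in lborel. cnj (Rep_l2 \<psi> x) * Rep_l2 \<phi> x = complex_of_real ((cmod (Rep_l2 \<psi> x))\<^sup>2 *\<^sub>R x)"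
        using * unfolding position_op_iff
        by eventually_elim (simp add: complex_norm_square mult_ac del: of_real_power)
    qed measurable
    also have "\<dots> = complex_of_real (LINT x|diagonal_measure position_pvm \<psi>. x)"
      unfolding diag integral_complex_of_real by (subst integral_density) auto
    finally show "cinner \<psi> \<phi> = complex_of_real (LINT x|diagonal_measure position_pvm \<psi>. x)" .
  qed
qed

section \<open>Uniqueness of the spectral resolution of position\<close>

text \<open>A symmetric operator is bounded by its quadratic form: polarize at \<open>x\<close> and
  at the multiple \<open>y\<close> of \<open>A x\<close> that has the length of \<open>x\<close>,
  then use the parallelogram law. It is stated relative to a subspace because it will be applied to
  an operator that is meaningful only on its domain.\<close>

lemma symmetric_form_norm_bound:
  fixes A :: "'a::real_inner \<Rightarrow> 'a"
  assumes V: "subspace V" and A: "\<And>x. x \<in> V \<Longrightarrow> A x \<in> V"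
    and add: "\<And>x y. x \<in> V \<Longrightarrow> y \<in> V \<Longrightarrow> A (x + y) = A x + A y"
    and diff: "\<And>x y. x \<in> V \<Longrightarrow> y \<in> V \<Longrightarrow> A (x - y) = A x - A y"
    and sym: "\<And>x y. x \<in> V \<Longrightarrow> y \<in> V \<Longrightarrow> inner (A x) y = inner x (A y)"
    and form: "\<And>x. x \<in> V \<Longrightarrow> \<bar>inner x (A x)\<bar> \<le> r * (norm x)\<^sup>2"
    and "0 \<le> r" and x: "x \<in> V"
  shows "norm (A x) \<le> r * norm x"
proof (cases "A x = 0 \<or> x = 0")
  case True
  then show ?thesis
  proof
    assume "x = 0"
    then have "A x = 0" using diff[OF x x] by simp
    then show ?thesis using \<open>0 \<le> r\<close> by simp
  qed (use \<open>0 \<le> r\<close> in simp)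
next
  case False
  define k where "k = norm x / norm (A x)"
  define y where "y = k *\<^sub>R A x"
  have k: "k > 0" using False by (simp add: k_def)
  have y: "y \<in> V" unfolding y_def by (intro subspace_scale V A x)
  have norm_y: "norm y = norm x" using False k by (simp add: y_def k_def)
  have "4 * inner (A x) y = inner (x + y) (A (x + y)) - inner (x - y) (A (x - y))"
    using sym[OF x y] by (simp add: add[OF x y] diff[OF x y] algebra_simps inner_commute)
  also have "\<dots> \<le> r * (norm (x + y))\<^sup>2 + r * (norm (x - y))\<^sup>2"
    using form[OF subspace_add[OF V x y]] form[OF subspace_diff[OF V x y]] by linarith
  also have "\<dots> = 2 * r * ((norm x)\<^sup>2 + (norm y)\<^sup>2)"
    by (simp add: power2_norm_eq_inner algebra_simps inner_commute)
  finally have "inner (A x) y \<le> r * (norm x)\<^sup>2" by (simp add: norm_y)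
  also have "inner (A x) y = norm x * norm (A x)"
    using False by (simp add: y_def k_def power2_norm_eq_inner[symmetric] power2_eq_square)
  finally have "norm x * norm (A x) \<le> norm x * (r * norm x)"
    by (simp add: power2_eq_square mult_ac)
  then show ?thesis using False by simp
qed

text \<open>Let \<open>I\<close> be the mass of \<open>f\<close> at distance at least
  \<open>s\<close> from \<open>m\<close>, where \<open>s > r\<close>. The moments force
  \<open>s ^ (2 * n) * I \<le> r ^ (2 * n) * C^2\<close> for every \<open>n\<close>, and letting
  \<open>n\<close> grow gives \<open>I = 0\<close>.\<close>

lemma support_from_moment_bounds:
  fixes f :: "real \<Rightarrow> complex"
  assumes f: "square_integrable f" and "0 \<le> r"
    and si: "\<And>n. square_integrable (\<lambda>x. of_real (x - m) ^ n * f x)"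
    and le: "\<And>n. norm (L2_class (\<lambda>x. of_real (x - m) ^ n * f x)) \<le> r ^ n * C"
  shows "AE x in lborel. \<bar>x - m\<bar> \<le> r \<or> f x = 0"
proof -
  have [measurable]: "f \<in> borel_measurable borel" using f by (rule square_integrable_measurable)
  have null: "AE x in lborel. \<not> \<bar>x - m\<bar> \<ge> s \<or> f x = 0" if s: "s > r" for s
  proof -
    define I where "I = (LINT x|lborel. indicator {x. \<bar>x - m\<bar> \<ge> s} x * (cmod (f x))\<^sup>2)"
    have int: "integrable lborel (\<lambda>x. indicator {x. \<bar>x - m\<bar> \<ge> s} x * (cmod (f x))\<^sup>2)"
      using f integrable_mult_indicator[of "{x. \<bar>x - m\<bar> \<ge> s}" lborel "\<lambda>x. (cmod (f x))\<^sup>2"]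
      by (simp add: square_integrable_def)
    have "s ^ (2 * n) * I \<le> r ^ (2 * n) * C\<^sup>2" for n
    proof -
      have "s ^ (2 * n) * I \<le> (LINT x|lborel. (cmod (of_real (x - m) ^ n * f x))\<^sup>2)"
        unfolding I_def integral_mult_right_zero[symmetric]
      proof (rule integral_mono)
        fix x :: real
        have "s ^ (2 * n) \<le> \<bar>x - m\<bar> ^ (2 * n)" if "\<bar>x - m\<bar> \<ge> s"
          using that s \<open>0 \<le> r\<close> by (intro power_mono) auto
        then show "s ^ (2 * n) * (indicator {x. \<bar>x - m\<bar> \<ge> s} x * (cmod (f x))\<^sup>2)
            \<le> (cmod (of_real (x - m) ^ n * f x))\<^sup>2"
          by (auto simp: indicator_def norm_mult norm_power power_mult_distrib power_mult
              simp del: of_real_diff intro!: mult_right_mono simp flip: power_mult)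
             (simp add: mult.commute)
      qed (use int si in \<open>auto simp: square_integrable_def\<close>)
      also have "\<dots> = (norm (L2_class (\<lambda>x. of_real (x - m) ^ n * f x)))\<^sup>2"
        by (rule norm_L2_class[OF si, symmetric])
      also have "\<dots> \<le> (r ^ n * C)\<^sup>2" by (intro power_mono le) simp
      finally show ?thesis by (simp add: power_mult_distrib mult.commute flip: power_mult)
    qed
    then have "(s\<^sup>2) ^ n * I \<le> (r\<^sup>2) ^ n * C\<^sup>2" for n
      by (simp only: power_mult)
    then have I_le: "I \<le> ((r / s)\<^sup>2) ^ n * C\<^sup>2" for n
      using s \<open>0 \<le> r\<close> by (simp add: field_simps power_divide)
    have "(\<lambda>n. ((r / s)\<^sup>2) ^ n * C\<^sup>2) \<longlonglongrightarrow> 0 * C\<^sup>2"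
      using s \<open>0 \<le> r\<close> by (intro tendsto_mult tendsto_const LIMSEQ_power_zero) (simp add: power_divide power_strict_mono)
    then have "I \<le> 0 * C\<^sup>2"
      by (rule LIMSEQ_le_const) (use I_le in auto)
    moreover have "I \<ge> 0" unfolding I_def by (intro integral_nonneg_AE) auto
    ultimately have "I = 0" by simp
    then have "AE x in lborel. indicator {x. \<bar>x - m\<bar> \<ge> s} x * (cmod (f x))\<^sup>2 = 0"
      unfolding I_def using int by (subst (asm) integral_nonneg_eq_0_iff_AE) auto
    then show ?thesis by eventually_elim (auto simp: indicator_def)
  qed
  \<comment> \<open>Only countably many null sets may be united, so \<open>s\<close> runs through a
    sequence decreasing to \<open>r\<close>.\<close>
  have "AE x in lborel. \<forall>k. \<not> \<bar>x - m\<bar> \<ge> r + 1 / real (Suc k) \<or> f x = 0"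
    unfolding AE_all_countable by (intro allI null) simp
  then show ?thesis
  proof eventually_elim
    case (elim x)
    show ?case
    proof (rule ccontr)
      assume *: "\<not> ?case"
      then obtain k where "1 / real (Suc k) < \<bar>x - m\<bar> - r"
        using nat_approx_posE[of "\<bar>x - m\<bar> - r"] by auto
      with elim[rule_format, of k] * show False by auto
    qed
  qed
qed

lemma Rep_position_pvm:
  assumes "S \<in> sets borel"
  shows "AE x in lborel. Rep_l2 (position_pvm S \<xi>) x = indicator S x * Rep_l2 \<xi> x"
  using Rep_L2_class[OF square_integrable_indicator_mult[OF square_integrable_Rep assms], of \<xi>]
    position_pvm_L2_class[OF square_integrable_Rep assms, of \<xi>] by simp

section \<open>Position as a map on its domain\<close>

text \<open>A total function in place of the graph. Outside the domain it is the class of a function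
  that is not square-integrable, a value without meaning; every use is guarded by domain
  membership.\<close>

definition position_map :: "l2 \<Rightarrow> l2" where
  "position_map \<psi> = L2_class (\<lambda>x. of_real x * Rep_l2 \<psi> x)"

lemma position_op_position_map:
  "\<psi> \<in> Domain position_op \<Longrightarrow> (\<psi>, position_map \<psi>) \<in> position_op"
  by (auto simp: Domain_position_op position_op_iff position_map_def intro: Rep_L2_class)

lemma position_map_eqI: "(\<psi>, \<phi>) \<in> position_op \<Longrightarrow> position_map \<psi> = \<phi>"
  using linear_graph_position_op position_op_position_map[of \<psi>]
  unfolding linear_graph_def single_valued_def by (meson DomainI)

lemma Domain_position_op_add:
  assumes "\<psi> \<in> Domain position_op" "\<phi> \<in> Domain position_op"
  shows "\<psi> + \<phi> \<in> Domain position_op" "position_map (\<psi> + \<phi>) = position_map \<psi> + position_map \<phi>"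
proof -
  have "(\<psi> + \<phi>, position_map \<psi> + position_map \<phi>) \<in> position_op"
    using assms[THEN position_op_position_map] linear_graph_position_op by (simp add: linear_graph_def)
  then show "\<psi> + \<phi> \<in> Domain position_op" "position_map (\<psi> + \<phi>) = position_map \<psi> + position_map \<phi>"
    by (auto intro: position_map_eqI)
qed

lemma Domain_position_op_scaleC:
  assumes "\<psi> \<in> Domain position_op"
  shows "c *\<^sub>C \<psi> \<in> Domain position_op" "position_map (c *\<^sub>C \<psi>) = c *\<^sub>C position_map \<psi>"
proof -
  have "(c *\<^sub>C \<psi>, c *\<^sub>C position_map \<psi>) \<in> position_op"
    using assms[THEN position_op_position_map] linear_graph_position_op by (simp add: linear_graph_def)
  then show "c *\<^sub>C \<psi> \<in> Domain position_op" "position_map (c *\<^sub>C \<psi>) = c *\<^sub>C position_map \<psi>"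
    by (auto intro: position_map_eqI)
qed

lemma Domain_position_op_diff:
  assumes "\<psi> \<in> Domain position_op" "\<phi> \<in> Domain position_op"
  shows "\<psi> - \<phi> \<in> Domain position_op" "position_map (\<psi> - \<phi>) = position_map \<psi> - position_map \<phi>"
  unfolding minus_l2_def uminus_l2_def using assms
  by (simp_all add: Domain_position_op_add Domain_position_op_scaleC)

lemma cinner_position_map:
  assumes "\<psi> \<in> Domain position_op" "\<phi> \<in> Domain position_op"
  shows "cinner (position_map \<psi>) \<phi> = cinner \<psi> (position_map \<phi>)"
proof -
  have si: "square_integrable (\<lambda>x. of_real x * Rep_l2 \<psi> x)"
    "square_integrable (\<lambda>x. of_real x * Rep_l2 \<phi> x)"
    using assms by (auto simp: Domain_position_op)
  show ?thesis
    using cinner_L2_class[OF si(1) square_integrable_Rep[of \<phi>]]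
      cinner_L2_class[OF square_integrable_Rep[of \<psi>] si(2)]
    by (simp add: position_map_def mult_ac)
qed

text \<open>For a representative \<open>f\<close> of \<open>\<zeta>\<close>, the function
  \<open>f / (1 + x^2)\<close> lies in the domain, and orthogonality to it says that the integral of
  \<open>\<bar>f\<bar>^2 / (1 + x^2)\<close> vanishes.\<close>

lemma Domain_position_op_dense:
  assumes "\<And>\<phi>. \<phi> \<in> Domain position_op \<Longrightarrow> cinner \<phi> \<zeta> = 0"
  shows "\<zeta> = 0"
proof -
  define f where "f = Rep_l2 \<zeta>"
  define m where "m x = complex_of_real (1 / (1 + x\<^sup>2))" for x :: real
  have [measurable]: "f \<in> borel_measurable borel" "m \<in> borel_measurable borel"
    by (auto simp: f_def m_def[abs_def])
  have f: "square_integrable f" "L2_class f = \<zeta>" by (simp_all add: f_def square_integrable_Rep)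
  have pos: "0 < 1 + x\<^sup>2" for x :: real
    using zero_le_power2[of x] by linarith
  have m: "cmod (m x) \<le> 1" for x
    using pos[of x] by (simp add: m_def divide_le_eq del: of_real_add of_real_divide)
  have xm: "cmod (of_real x * m x) \<le> 1" for x
  proof -
    have "\<bar>x\<bar> \<le> 1 + x\<^sup>2"
      using zero_le_power2[of "\<bar>x\<bar> - 1"] by (simp add: power2_diff)
    then show ?thesis
      using pos[of x] by (simp add: m_def norm_mult divide_le_eq del: of_real_add of_real_divide)
  qed
  have g: "square_integrable (\<lambda>x. m x * f x)"
    by (rule square_integrable_mult_bounded[OF f(1) _ m]) measurable
  have xg: "square_integrable (\<lambda>x. of_real x * m x * f x)"
    by (rule square_integrable_mult_bounded[OF f(1) _ xm]) measurable
  have "(L2_class (\<lambda>x. m x * f x), L2_class (\<lambda>x. of_real x * m x * f x)) \<in> position_op"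
    unfolding position_op_def using g xg by (fastforce simp: mult.assoc)
  then have "0 = cinner (L2_class (\<lambda>x. m x * f x)) \<zeta>"
    using assms by (auto simp: Domain_iff)
  also have "\<dots> = (LINT x|lborel. cnj (m x * f x) * f x)"
    using cinner_L2_class[OF g f(1)] f(2) by simp
  also have "\<dots> = (LINT x|lborel. complex_of_real ((cmod (f x))\<^sup>2 / (1 + x\<^sup>2)))"
    by (intro Bochner_Integration.integral_cong refl)
       (simp add: m_def complex_norm_square mult_ac del: of_real_power)
  finally have "(LINT x|lborel. (cmod (f x))\<^sup>2 / (1 + x\<^sup>2)) = 0"
    unfolding integral_complex_of_real by simp
  moreover have "integrable lborel (\<lambda>x. (cmod (f x))\<^sup>2 / (1 + x\<^sup>2))"
  proof (rule Bochner_Integration.integrable_bound)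
    show "integrable lborel (\<lambda>x. (cmod (f x))\<^sup>2)" using f by (simp add: square_integrable_def)
    show "AE x in lborel. norm ((cmod (f x))\<^sup>2 / (1 + x\<^sup>2)) \<le> norm ((cmod (f x))\<^sup>2)"
      using pos by (auto simp: divide_le_eq mult_le_cancel_left1 intro!: AE_I2)
  qed measurable
  ultimately have "AE x in lborel. (cmod (f x))\<^sup>2 / (1 + x\<^sup>2) = 0"
    using pos by (subst (asm) integral_nonneg_eq_0_iff_AE) (auto intro!: AE_I2 divide_nonneg_pos)
  then have "AE x in lborel. f x = 0"
    by eventually_elim (metis divide_eq_0_iff less_irrefl norm_eq_zero pos power_eq_0_iff)
  then have "L2_class f = L2_class (\<lambda>x. 0)"
    by (subst L2_class_eq_iff) (use f square_integrable_zero in auto)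
  then show ?thesis using f by (simp add: L2_class_zero)
qed


section \<open>Reduction of the position operator by an arbitrary resolution\<close>

context
  fixes E assumes E_res: "spectral_resolution E position_op"
begin

lemma resolution_pvm: "projection_valued_measure E"
  using E_res by (simp add: spectral_resolution_def)

lemma resolution_proj: "S \<in> sets borel \<Longrightarrow> bounded_clinear (E S)"
  and resolution_selfadj: "S \<in> sets borel \<Longrightarrow> cinner (E S \<phi>) \<psi> = cinner \<phi> (E S \<psi>)"
  using orthogonal_projectionD[OF pvm_proj[OF resolution_pvm]] by auto

lemma Domain_resolution:
  "\<psi> \<in> Domain position_op \<longleftrightarrow> integrable (diagonal_measure E \<psi>) (\<lambda>x. x\<^sup>2)"
  using E_res by (simp add: spectral_resolution_def)

lemma cinner_resolution:
  "\<psi> \<in> Domain position_op \<Longrightarrow>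
    cinner \<psi> (position_map \<psi>) = complex_of_real (LINT x|diagonal_measure E \<psi>. x)"
  using E_res position_op_position_map[of \<psi>] by (force simp: spectral_resolution_def)

lemma Domain_resolution_pvm:
  assumes S: "S \<in> sets borel" and \<psi>: "\<psi> \<in> Domain position_op"
  shows "E S \<psi> \<in> Domain position_op"
  unfolding Domain_resolution diagonal_measure_pvm[OF resolution_pvm S]
  using \<psi>[unfolded Domain_resolution] integrable_mult_indicator[of S "diagonal_measure E \<psi>" "\<lambda>x. x\<^sup>2"] S
  by (subst integrable_density) (auto simp: resolution_pvm)

text \<open>The second moment of a finite measure carried by a bounded set is finite. So the range
  of such a projection consists of domain vectors, on which the operator can be iterated.\<close>

lemma Domain_resolution_bounded:
  assumes S: "S \<in> sets borel" "S \<subseteq> {a..b}"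
  shows "E S \<psi> \<in> Domain position_op"
proof -
  have "integrable (diagonal_measure E \<psi>) (\<lambda>x. indicator S x *\<^sub>R x\<^sup>2)"
  proof (rule diagonal_measure_bounded_integrable[OF resolution_pvm])
    fix x :: real
    have "x\<^sup>2 \<le> (max \<bar>a\<bar> \<bar>b\<bar>)\<^sup>2" if "x \<in> S"
    proof -
      have "a \<le> x" "x \<le> b" using that S(2) by auto
      then have "\<bar>x\<bar> \<le> max \<bar>a\<bar> \<bar>b\<bar>" by linarith
      then show ?thesis by (subst power2_abs[symmetric], intro power_mono) auto
    qed
    then show "norm (indicator S x *\<^sub>R x\<^sup>2) \<le> (max \<bar>a\<bar> \<bar>b\<bar>)\<^sup>2"
      by (auto simp: indicator_def)
  qed (use S in measurable)
  then show ?thesis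
    unfolding Domain_resolution diagonal_measure_pvm[OF resolution_pvm S(1)]
    using S by (subst integrable_density) (auto simp: resolution_pvm)
qed

lemma integrable_ident_resolution:
  assumes "\<psi> \<in> Domain position_op"
  shows "integrable (diagonal_measure E \<psi>) (\<lambda>x. x)"
proof (rule Bochner_Integration.integrable_bound)
  show "integrable (diagonal_measure E \<psi>) (\<lambda>x. 1 + x\<^sup>2)"
    using assms[unfolded Domain_resolution] diagonal_measure_bounded_integrable[OF resolution_pvm, of "\<lambda>_. 1::real" 1]
    by (intro Bochner_Integration.integrable_add) auto
  have "\<bar>x\<bar> \<le> \<bar>1 + x\<^sup>2\<bar>" for x :: real
    using zero_le_power2[of "\<bar>x\<bar> - 1"] by (simp add: power2_diff)
  then show "AE x in diagonal_measure E \<psi>. norm x \<le> norm (1 + x\<^sup>2)" by simp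
qed (simp add: resolution_pvm)

text \<open>The first moment splits over \<open>S\<close> and its complement, and each restricted
  moment is the form at a projected vector.\<close>

lemma resolution_form_split:
  assumes S: "S \<in> sets borel" and \<psi>: "\<psi> \<in> Domain position_op"
  shows "cinner \<psi> (position_map \<psi>) =
    cinner (E S \<psi>) (position_map (E S \<psi>)) + cinner (E (- S) \<psi>) (position_map (E (- S) \<psi>))"
proof -
  have S': "- S \<in> sets borel" using S by (simp add: borel_comp)
  have eq: "(LINT x|diagonal_measure E (E T \<psi>). x) = (LINT x|diagonal_measure E \<psi>. indicator T x *\<^sub>R x)"
    if "T \<in> sets borel" for T
    unfolding diagonal_measure_pvm[OF resolution_pvm that] using that
    by (subst integral_density) (auto simp: resolution_pvm)
  have int: "integrable (diagonal_measure E \<psi>) (\<lambda>x. indicator T x *\<^sub>R x)" if "T \<in> sets borel" for T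
    using integrable_mult_indicator[OF _ integrable_ident_resolution[OF \<psi>], of T] that by (simp add: resolution_pvm)
  have "(LINT x|diagonal_measure E \<psi>. x)
      = (LINT x|diagonal_measure E \<psi>. indicator S x *\<^sub>R x + indicator (- S) x *\<^sub>R x)"
    by (intro Bochner_Integration.integral_cong) (auto simp: indicator_def)
  also have "\<dots> = (LINT x|diagonal_measure E (E S \<psi>). x) + (LINT x|diagonal_measure E (E (- S) \<psi>). x)"
    unfolding eq[OF S] eq[OF S'] by (intro Bochner_Integration.integral_add int S S')
  finally show ?thesis
    using S S' \<psi> by (simp add: cinner_resolution Domain_resolution_pvm)
qed

text \<open>Only the quadratic form of the operator is known to split along \<open>E S\<close> and \<open>E (- S)\<close>;
  varying the phase of one summand makes the cross terms vanish, so \<open>E S\<close> reduces the operator.\<close>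

lemma resolution_form_orthogonal:
  assumes S: "S \<in> sets borel" and \<phi>: "\<phi> \<in> Domain position_op" and \<psi>: "\<psi> \<in> Domain position_op"
  shows "cinner (E S \<phi>) (position_map (E (- S) \<psi>)) = 0"
proof -
  have S': "- S \<in> sets borel" using S by (simp add: borel_comp)
  define \<alpha> \<beta> where "\<alpha> = E S \<phi>" and "\<beta> = E (- S) \<psi>"
  have dom: "\<alpha> \<in> Domain position_op" "\<beta> \<in> Domain position_op"
    by (auto simp: \<alpha>_def \<beta>_def intro!: Domain_resolution_pvm S S' \<phi> \<psi>)
  have [simp]: "E S \<alpha> = \<alpha>" "E (- S) \<alpha> = 0" "E S \<beta> = 0" "E (- S) \<beta> = \<beta>"
    by (simp_all add: \<alpha>_def \<beta>_def pvm_Int[OF resolution_pvm] S S' pvm_empty[OF resolution_pvm])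
  note lin = bounded_clinear_add[OF resolution_proj] bounded_clinear_scaleC[OF resolution_proj]
  have *: "cinner \<alpha> (c *\<^sub>C position_map \<beta>) + cinner (c *\<^sub>C \<beta>) (position_map \<alpha>) = 0" for c
  proof -
    have c: "c *\<^sub>C \<beta> \<in> Domain position_op" "\<alpha> + c *\<^sub>C \<beta> \<in> Domain position_op"
      by (auto intro: dom Domain_position_op_add Domain_position_op_scaleC)
    have E: "E S (\<alpha> + c *\<^sub>C \<beta>) = \<alpha>" "E (- S) (\<alpha> + c *\<^sub>C \<beta>) = c *\<^sub>C \<beta>"
      by (simp_all add: lin S S')
    have "cinner (\<alpha> + c *\<^sub>C \<beta>) (position_map (\<alpha> + c *\<^sub>C \<beta>)) =
      cinner \<alpha> (position_map \<alpha>) + cinner (c *\<^sub>C \<beta>) (position_map (c *\<^sub>C \<beta>))"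
      using resolution_form_split[OF S c(2)] by (simp only: E)
    then show ?thesis
      by (simp add: Domain_position_op_add dom c Domain_position_op_scaleC cinner_add_left cinner_add_right add.commute)
  qed
  have "\<i> * cinner \<alpha> (position_map \<beta>) - \<i> * cinner \<beta> (position_map \<alpha>) = 0"
    using *[of \<i>] by (simp add: cinner_scaleC_left cinner_scaleC_right)
  then have "cinner \<alpha> (position_map \<beta>) = cinner \<beta> (position_map \<alpha>)" by simp
  with *[of 1] show ?thesis by (simp add: \<alpha>_def \<beta>_def)
qed

text \<open>Paired with a domain vector \<open>\<phi>\<close>, both sides reduce to the block
  between \<open>E S \<phi>\<close> and \<open>E S \<psi>\<close>, since the mixed blocks vanish.
  Density of the domain removes the test vector.\<close>

lemma resolution_commutes:
  assumes S: "S \<in> sets borel" and \<psi>: "\<psi> \<in> Domain position_op"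
  shows "position_map (E S \<psi>) = E S (position_map \<psi>)"
proof -
  have S': "- S \<in> sets borel" using S by (simp add: borel_comp)
  note dom = Domain_resolution_pvm
  have split: "\<xi> = E S \<xi> + E (- S) \<xi>" for \<xi>
    by (simp add: pvm_compl[OF resolution_pvm S])
  have "cinner \<phi> (position_map (E S \<psi>) - E S (position_map \<psi>)) = 0" if \<phi>: "\<phi> \<in> Domain position_op" for \<phi>
  proof -
    have "cinner \<phi> (E S (position_map \<psi>)) = cinner (E S \<phi>) (position_map (E S \<psi> + E (- S) \<psi>))"
      using split[of \<psi>] by (simp add: resolution_selfadj S)
    also have "\<dots> = cinner (E S \<phi>) (position_map (E S \<psi>))"
      by (simp add: Domain_position_op_add dom S S' \<psi> cinner_add_right resolution_form_orthogonal \<phi>)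
    also have "\<dots> = cinner (E S \<phi> + E (- S) \<phi>) (position_map (E S \<psi>))"
      using resolution_form_orthogonal[OF S' \<phi> \<psi>] by (simp add: cinner_add_left)
    also have "\<dots> = cinner \<phi> (position_map (E S \<psi>))" by (simp flip: split)
    finally show ?thesis by (simp add: cinner_diff_right)
  qed
  then have "position_map (E S \<psi>) - E S (position_map \<psi>) = 0"
    by (rule Domain_position_op_dense)
  then show ?thesis by simp
qed

text \<open>The diagonal measure of such a vector is carried by the interval, where the distance to
  the midpoint is at most half the length.\<close>

lemma resolution_form_bound:
  assumes "a < b" and \<psi>: "\<psi> \<in> Domain position_op" "E {a<..b} \<psi> = \<psi>"
  shows "\<bar>inner \<psi> (position_map \<psi> - ((a + b) / 2) *\<^sub>R \<psi>)\<bar> \<le> (b - a) / 2 * (norm \<psi>)\<^sup>2"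
proof -
  interpret finite_measure "diagonal_measure E \<psi>" by (rule finite_diagonal_measure[OF resolution_pvm])
  define m r where "m = (a + b) / 2" and "r = (b - a) / 2"
  have mass: "measure (diagonal_measure E \<psi>) UNIV = (norm \<psi>)\<^sup>2"
    by (simp add: measure_diagonal_measure[OF resolution_pvm] pvm_UNIV[OF resolution_pvm])
  have int: "integrable (diagonal_measure E \<psi>) (\<lambda>x. x)" by (rule integrable_ident_resolution[OF \<psi>(1)])
  have "inner \<psi> (position_map \<psi> - m *\<^sub>R \<psi>) = (LINT x|diagonal_measure E \<psi>. x) - m * (norm \<psi>)\<^sup>2"
    using cinner_resolution[OF \<psi>(1)] by (simp add: inner_diff_right power2_norm_eq_inner) (simp add: inner_l2_def)
  also have "\<dots> = (LINT x|diagonal_measure E \<psi>. x - m)"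
    using int by (simp add: mass resolution_pvm)
  finally have eq: "inner \<psi> (position_map \<psi> - m *\<^sub>R \<psi>) = (LINT x|diagonal_measure E \<psi>. x - m)" .
  have "emeasure (diagonal_measure E \<psi>) (- {a<..b}) = ennreal ((norm (E (- {a<..b}) \<psi>))\<^sup>2)"
    by (rule emeasure_diagonal_measure[OF resolution_pvm]) (simp add: borel_comp)
  also have "\<dots> = 0" using pvm_compl[OF resolution_pvm, of "{a<..b}" \<psi>] \<psi> by simp
  finally have "AE x in diagonal_measure E \<psi>. x \<in> {a<..b}"
    by (intro AE_I[where N = "- {a<..b}"]) (auto simp: resolution_pvm borel_comp)
  then have le: "AE x in diagonal_measure E \<psi>. \<bar>x - m\<bar> \<le> r"
    by eventually_elim (auto simp: m_def r_def abs_le_iff field_simps)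
  have "\<bar>LINT x|diagonal_measure E \<psi>. x - m\<bar> \<le> (LINT x|diagonal_measure E \<psi>. \<bar>x - m\<bar>)"
    using integral_norm_bound[of "diagonal_measure E \<psi>" "\<lambda>x. x - m"] by simp
  also have "\<dots> \<le> (LINT x|diagonal_measure E \<psi>. r)"
    using int le by (intro integral_mono_AE) auto
  also have "\<dots> = r * (norm \<psi>)\<^sup>2" by (simp add: mass resolution_pvm)
  finally show ?thesis using eq by (simp add: m_def r_def)
qed

text \<open>The range \<open>V\<close> of the interval projection lies in the domain and is
  invariant under \<open>B\<close>, position minus the midpoint; commutation gives the invariance.
  The induction therefore carries membership in \<open>V\<close> along with the moment bound, so
  that \<open>B_norm\<close> can be applied to each successive power.\<close>

lemma resolution_support:
  assumes "a < b" and \<psi>: "E {a<..b} \<psi> = \<psi>"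
  shows "AE x in lborel. x \<in> {a..b} \<or> Rep_l2 \<psi> x = 0"
proof -
  define m r where "m = (a + b) / 2" and "r = (b - a) / 2"
  define V where "V = {\<xi>. E {a<..b} \<xi> = \<xi>}"
  define B where "B \<xi> = position_map \<xi> - m *\<^sub>R \<xi>" for \<xi>
  define f where "f = Rep_l2 \<psi>"
  have meas: "{a<..b} \<in> sets borel" by simp
  have V_dom: "\<xi> \<in> Domain position_op" if "\<xi> \<in> V" for \<xi>
    using Domain_resolution_bounded[OF meas, of a b \<xi>] that by (simp add: V_def greaterThanAtMost_subseteq_atLeastAtMost_iff)
  note lin = bounded_clinear_add[OF resolution_proj[OF meas]] bounded_clinear_scaleC[OF resolution_proj[OF meas]]
    bounded_clinear_zero[OF resolution_proj[OF meas]] bounded_clinear_diff[OF resolution_proj[OF meas]]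
  have V: "subspace V"
    by (auto simp: subspace_def V_def lin scaleR_l2_def)
  have B_V: "B \<xi> \<in> V" if "\<xi> \<in> V" for \<xi>
    using that resolution_commutes[OF meas V_dom[OF that]] by (simp add: V_def B_def lin scaleR_l2_def)
  have B_norm: "norm (B \<xi>) \<le> r * norm \<xi>" if "\<xi> \<in> V" for \<xi>
  proof (rule symmetric_form_norm_bound[OF V B_V])
    show "B (\<xi> + \<eta>) = B \<xi> + B \<eta>" "B (\<xi> - \<eta>) = B \<xi> - B \<eta>" if "\<xi> \<in> V" "\<eta> \<in> V" for \<xi> \<eta>
      using V_dom[OF that(1)] V_dom[OF that(2)]
      by (simp_all add: B_def Domain_position_op_add Domain_position_op_diff algebra_simps)
    show "inner (B \<xi>) \<eta> = inner \<xi> (B \<eta>)" if "\<xi> \<in> V" "\<eta> \<in> V" for \<xi> \<eta>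
      using cinner_position_map[OF V_dom[OF that(1)] V_dom[OF that(2)]]
      by (simp add: B_def inner_diff_left inner_diff_right) (simp add: inner_l2_def)
    show "\<bar>inner \<xi> (B \<xi>)\<bar> \<le> r * (norm \<xi>)\<^sup>2" if "\<xi> \<in> V" for \<xi>
      using resolution_form_bound[OF \<open>a < b\<close> V_dom[OF that]] that by (simp add: B_def V_def m_def r_def)
  qed (use \<open>a < b\<close> that in \<open>auto simp: r_def\<close>)
  have f: "square_integrable f" and f\<psi>: "L2_class f = \<psi>" by (simp_all add: f_def square_integrable_Rep)
  have *: "square_integrable (\<lambda>x. of_real (x - m) ^ n * f x) \<and>
      L2_class (\<lambda>x. of_real (x - m) ^ n * f x) \<in> V \<and>
      norm (L2_class (\<lambda>x. of_real (x - m) ^ n * f x)) \<le> r ^ n * norm \<psi>" for n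
  proof (induction n)
    case 0
    then show ?case using f f\<psi> \<psi> by (simp add: V_def)
  next
    case (Suc n)
    define g where "g x = of_real (x - m) ^ n * f x" for x
    have g: "square_integrable g" "L2_class g \<in> V" "norm (L2_class g) \<le> r ^ n * norm \<psi>"
      using Suc by (auto simp: g_def[abs_def])
    have [measurable]: "f \<in> borel_measurable borel" "g \<in> borel_measurable borel"
      using f g by (auto intro: square_integrable_measurable)
    from V_dom[OF g(2)] have "square_integrable (\<lambda>x. of_real x * Rep_l2 (L2_class g) x)"
      by (simp add: Domain_position_op)
    then have xg: "square_integrable (\<lambda>x. of_real x * g x)"
      by (rule square_integrable_cong_AE) (use Rep_L2_class[OF g(1)] in \<open>auto elim: eventually_mono\<close>)
    have si: "square_integrable (\<lambda>x. complex_of_real (x - m) * g x)"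
      using square_integrable_diff[OF xg square_integrable_cmult[OF g(1)], of m] by (simp add: algebra_simps)
    have "(L2_class g, L2_class (\<lambda>x. of_real x * g x)) \<in> position_op"
      unfolding position_op_def using g xg by fastforce
    then have "B (L2_class g) = L2_class (\<lambda>x. of_real x * g x) - complex_of_real m *\<^sub>C L2_class g"
      by (simp add: B_def position_map_eqI scaleR_l2_def)
    also have "\<dots> = L2_class (\<lambda>x. complex_of_real (x - m) * g x)"
      using g xg by (simp add: L2_class_scaleC L2_class_diff square_integrable_cmult algebra_simps)
    finally have B: "B (L2_class g) = L2_class (\<lambda>x. complex_of_real (x - m) * g x)" .
    have "norm (B (L2_class g)) \<le> r * (r ^ n * norm \<psi>)"
      using \<open>a < b\<close> by (intro order_trans[OF B_norm[OF g(2)]] mult_left_mono g(3)) (simp add: r_def)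
    moreover have "B (L2_class g) \<in> V" by (rule B_V[OF g(2)])
    ultimately show ?case
      using si by (simp add: B g_def mult.assoc)
  qed
  have "AE x in lborel. \<bar>x - m\<bar> \<le> r \<or> f x = 0"
    by (rule support_from_moment_bounds[OF f, where C = "norm \<psi>"]) (use * \<open>a < b\<close> in \<open>auto simp: r_def\<close>)
  then show ?thesis
  proof eventually_elim
    case (elim x)
    then show ?case by (auto simp: f_def m_def r_def abs_le_iff field_simps)
  qed
qed


section \<open>Identification with the indicator resolution\<close>

text \<open>The squared error is the diagonal measure of the complement of the interval, and these
  complements decrease to the empty set.\<close>

lemma resolution_truncation_tendsto:
  "(\<lambda>n. E {- real n<..real n} \<psi>) \<longlonglongrightarrow> \<psi>"
proof -
  interpret finite_measure "diagonal_measure E \<psi>" by (rule finite_diagonal_measure[OF resolution_pvm])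
  have eq: "(norm (\<psi> - E {- real n<..real n} \<psi>))\<^sup>2 = measure (diagonal_measure E \<psi>) (- {- real n<..real n})" for n
    by (simp add: measure_diagonal_measure[OF resolution_pvm] borel_comp pvm_compl[OF resolution_pvm])
  have "(\<lambda>n. measure (diagonal_measure E \<psi>) (- {- real n<..real n}))
      \<longlonglongrightarrow> measure (diagonal_measure E \<psi>) (\<Inter>n. - {- real n<..real n})"
    by (rule finite_Lim_measure_decseq) (auto simp: decseq_def resolution_pvm borel_comp)
  also have "(\<Inter>n. - {- real n<..real n}) = {}"
    using UN_Ioc by blast
  finally have "(\<lambda>n. (norm (\<psi> - E {- real n<..real n} \<psi>))\<^sup>2) \<longlonglongrightarrow> 0"
    by (simp add: eq)
  then have "(\<lambda>n. sqrt ((norm (\<psi> - E {- real n<..real n} \<psi>))\<^sup>2)) \<longlonglongrightarrow> sqrt 0"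
    by (rule tendsto_real_sqrt)
  then have "(\<lambda>n. \<psi> - E {- real n<..real n} \<psi>) \<longlonglongrightarrow> 0"
    by (simp add: tendsto_norm_zero_iff)
  then have "(\<lambda>n. \<psi> - (\<psi> - E {- real n<..real n} \<psi>)) \<longlonglongrightarrow> \<psi> - 0"
    by (intro tendsto_intros)
  then show ?thesis by simp
qed

text \<open>Support alone gives that the range of \<open>E {a<..b}\<close> lies in that of
  \<open>?P\<close>. For equality, cut a large interval at \<open>a\<close> and \<open>b\<close>:
  \<open>?P\<close> fixes the middle piece and kills the outer ones, so it sends every large
  truncation of \<open>\<psi>\<close> to \<open>E {a<..b} \<psi>\<close>; the truncations tend to
  \<open>\<psi>\<close>.\<close>

lemma resolution_interval:
  assumes "a < b"
  shows "E {a<..b} \<psi> = position_pvm {a<..b} \<psi>"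
proof -
  let ?P = "position_pvm {a<..b}"
  have P: "bounded_clinear ?P"
    using orthogonal_projectionD(1)[OF orthogonal_projection_position_pvm] by simp
  note supp = resolution_support[OF _ pvm_Int[OF resolution_pvm, of "{c<..d}" "{c<..d}" for c d, simplified]]
  \<comment> \<open>Supports are known only inside closed intervals; neighbouring ones share an
    endpoint, which is a null set.\<close>
  have null: "AE x in lborel. x \<noteq> c" for c :: real by (rule AE_lborel_singleton)
  have in_part: "?P (E {a<..b} \<psi>) = E {a<..b} \<psi>"
  proof (rule l2_eqI)
    show "AE x in lborel. Rep_l2 (?P (E {a<..b} \<psi>)) x = Rep_l2 (E {a<..b} \<psi>) x"
      using supp[OF \<open>a < b\<close>, of \<psi>] null[of a] Rep_position_pvm[of "{a<..b}" "E {a<..b} \<psi>", simplified]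
      by eventually_elim (auto simp: indicator_def)
  qed
  have out_part: "?P (E {c<..d} \<psi>) = 0" if "c < d" "d \<le> a \<or> b \<le> c" for c d
  proof -
    \<comment> \<open>The chosen representative of \<open>0\<close> is known to vanish only almost
      everywhere; writing \<open>0\<close> as \<open>0 *\<^sub>C \<psi>\<close> makes that fact
      available.\<close>
    have "AE x in lborel. Rep_l2 (?P (E {c<..d} \<psi>)) x = Rep_l2 (0 *\<^sub>C \<psi>) x"
      using supp[OF \<open>c < d\<close>, of \<psi>] null[of b] Rep_l2_scaleC[of 0 \<psi>]
        Rep_position_pvm[of "{a<..b}" "E {c<..d} \<psi>", simplified]
      by eventually_elim (use that in \<open>auto simp: indicator_def\<close>)
    then have "?P (E {c<..d} \<psi>) = 0 *\<^sub>C \<psi>" by (rule l2_eqI)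
    also have "\<dots> = 0" using scaleR_zero_left[of \<psi>] by (simp add: scaleR_l2_def del: scaleR_zero_left)
    finally show ?thesis .
  qed
  have "\<forall>\<^sub>F n in sequentially. ?P (E {- real n<..real n} \<psi>) = E {a<..b} \<psi>"
  proof -
    obtain N where N: "max \<bar>a\<bar> \<bar>b\<bar> < real N" using reals_Archimedean2 by blast
    show ?thesis
    proof (rule eventually_sequentiallyI[of N])
      fix n assume "N \<le> n"
      with N have n: "- real n < a" "b < real n" by auto
      have "{- real n<..real n} = ({- real n<..a} \<union> {a<..b}) \<union> {b<..real n}"
        using n \<open>a < b\<close> by auto
      then have "E {- real n<..real n} \<psi> = E ({- real n<..a} \<union> {a<..b}) \<psi> + E {b<..real n} \<psi>"
        using \<open>a < b\<close> by (simp only:) (rule pvm_Un[OF resolution_pvm], auto)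
      also have "E ({- real n<..a} \<union> {a<..b}) \<psi> = E {- real n<..a} \<psi> + E {a<..b} \<psi>"
        by (rule pvm_Un[OF resolution_pvm]) auto
      finally show "?P (E {- real n<..real n} \<psi>) = E {a<..b} \<psi>"
        using n by (simp add: bounded_clinear_add[OF P] in_part out_part)
    qed
  qed
  then have "(\<lambda>n. ?P (E {- real n<..real n} \<psi>)) \<longlonglongrightarrow> E {a<..b} \<psi>"
    by (rule tendsto_eventually)
  moreover have "(\<lambda>n. ?P (E {- real n<..real n} \<psi>)) \<longlonglongrightarrow> ?P \<psi>"
    by (rule bounded_linear.tendsto[OF bounded_clinear_bounded_linear[OF P] resolution_truncation_tendsto])
  ultimately show ?thesis by (rule LIMSEQ_unique)
qed

text \<open>Finite measures that agree on half-open intervals agree on Borel sets. Uniqueness is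
  needed only at the level of diagonal measures, since \<open>spectral_integral\<close> sees a
  resolution only through them.\<close>

lemma diagonal_measure_position_resolution:
  "diagonal_measure E \<psi> = diagonal_measure position_pvm \<psi>"
proof -
  let ?G = "range (\<lambda>(a, b). {a<..b::real})"
  show ?thesis
  proof (rule measure_eqI_generator_eq[where E = ?G and \<Omega> = UNIV and A = "\<lambda>n. {- real n<..real n}"])
    note pvm' = projection_valued_measure_position_pvm
    show "Int_stable ?G" by (rule Int_stable_Ioc)
    show "sets (diagonal_measure E \<psi>) = sigma_sets UNIV ?G"
      and "sets (diagonal_measure position_pvm \<psi>) = sigma_sets UNIV ?G"
      by (simp_all add: sets_diagonal_measure[OF resolution_pvm] sets_diagonal_measure[OF pvm'] sets_borel_Ioc)
    show "emeasure (diagonal_measure E \<psi>) X = emeasure (diagonal_measure position_pvm \<psi>) X" if XG: "X \<in> ?G" for X :: "real set"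
    proof -
      obtain a b where X: "X = {a<..b}" using XG by auto
      show ?thesis
        using resolution_interval[of a b \<psi>]
        by (cases "a < b") (auto simp: X emeasure_diagonal_measure[OF resolution_pvm] emeasure_diagonal_measure[OF pvm'])
    qed
    show "range (\<lambda>n. {- real n<..real n}) \<subseteq> ?G" by auto
    show "(\<Union>n. {- real n<..real n}) = UNIV" by (rule UN_Ioc)
    show "emeasure (diagonal_measure E \<psi>) {- real n<..real n} \<noteq> \<infinity>" for n
      by (simp add: emeasure_diagonal_measure[OF resolution_pvm])
  qed simp
qed

end

section \<open>Functional calculus up to unitary equivalence\<close>

definition unitary_pair :: "(l2 \<Rightarrow> l2) \<Rightarrow> (l2 \<Rightarrow> l2) \<Rightarrow> bool" where
  "unitary_pair U V \<longleftrightarrow> bounded_clinear U \<and> bounded_clinear V \<and>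
     (\<forall>\<psi>. V (U \<psi>) = \<psi>) \<and> (\<forall>\<psi>. U (V \<psi>) = \<psi>) \<and> (\<forall>\<phi> \<psi>. cinner (U \<phi>) \<psi> = cinner \<phi> (V \<psi>))"

lemma unitary_pair_sym: "unitary_pair U V \<Longrightarrow> unitary_pair V U"
  unfolding unitary_pair_def by (metis cinner_cnj)

context
  fixes U V assumes UV: "unitary_pair U V"
begin

lemma unitary_pair_clinear: "bounded_clinear U" "bounded_clinear V"
  and unitary_pair_inverse [simp]: "V (U \<psi>) = \<psi>" "U (V \<psi>) = \<psi>"
  and unitary_pair_adjoint: "cinner (U \<phi>) \<psi> = cinner \<phi> (V \<psi>)" "cinner \<psi> (U \<phi>) = cinner (V \<psi>) \<phi>"
  using UV unitary_pair_sym[OF UV] by (auto simp: unitary_pair_def)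

lemma diagonal_measure_unitary:
  "diagonal_measure (\<lambda>S \<psi>. U (E S (V \<psi>))) \<psi> = diagonal_measure E (V \<psi>)"
  unfolding diagonal_measure_def by (simp add: unitary_pair_adjoint)

lemma projection_valued_measure_unitary:
  assumes E: "projection_valued_measure E"
  shows "projection_valued_measure (\<lambda>S \<psi>. U (E S (V \<psi>)))"
  unfolding projection_valued_measure_def
proof (intro conjI ballI allI impI)
  fix S :: "real set" assume S: "S \<in> sets borel"
  note P = orthogonal_projectionD[OF pvm_proj[OF E S]]
  show "orthogonal_projection (\<lambda>\<psi>. U (E S (V \<psi>)))"
    unfolding orthogonal_projection_def
    using bounded_clinear_compose[OF unitary_pair_clinear(1) bounded_clinear_compose[OF P(1) unitary_pair_clinear(2)]]
    by (auto simp: P unitary_pair_adjoint)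
next
  fix S :: "nat \<Rightarrow> real set" and \<psi> assume "range S \<subseteq> sets borel" "disjoint_family S"
  then have "(\<lambda>n. E (S n) (V \<psi>)) sums E (\<Union>n. S n) (V \<psi>)"
    using E by (simp add: projection_valued_measure_def)
  then show "(\<lambda>n. U (E (S n) (V \<psi>))) sums U (E (\<Union>n. S n) (V \<psi>))"
    by (rule bounded_linear.sums[OF bounded_clinear_bounded_linear[OF unitary_pair_clinear(1)]])
qed (auto simp: pvm_Int[OF E] pvm_empty[OF E] pvm_UNIV[OF E] bounded_clinear_zero[OF unitary_pair_clinear(1)])

lemma linear_graph_unitary:
  assumes T: "linear_graph T"
  shows "linear_graph (map_prod U U ` T)"
  unfolding linear_graph_def
proof (intro conjI allI impI)
  have "\<phi> = \<phi>'" if "(\<psi>, \<phi>) \<in> T" "(\<psi>', \<phi>') \<in> T" "U \<psi> = U \<psi>'" for \<psi> \<psi>' \<phi> \<phi>'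
    using that T unitary_pair_inverse(1) unfolding linear_graph_def single_valued_def by metis
  then show "single_valued (map_prod U U ` T)"
    by (force simp: single_valued_def)
  show "(0, 0) \<in> map_prod U U ` T"
    using T bounded_clinear_zero[OF unitary_pair_clinear(1)] by (force simp: linear_graph_def)
  fix \<psi> \<phi> \<psi>' \<phi>' assume "(\<psi>, \<phi>) \<in> map_prod U U ` T" "(\<psi>', \<phi>') \<in> map_prod U U ` T"
  then obtain a b c d where *: "(a, b) \<in> T" "(c, d) \<in> T" "\<psi> = U a" "\<phi> = U b" "\<psi>' = U c" "\<phi>' = U d"
    by auto
  then have "(a + c, b + d) \<in> T" using T by (simp add: linear_graph_def)
  then have "map_prod U U (a + c, b + d) \<in> map_prod U U ` T" by (rule imageI)
  then show "(\<psi> + \<psi>', \<phi> + \<phi>') \<in> map_prod U U ` T"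
    by (simp add: * bounded_clinear_add[OF unitary_pair_clinear(1)])
next
  fix c \<psi> \<phi> assume "(\<psi>, \<phi>) \<in> map_prod U U ` T"
  then obtain a b where *: "(a, b) \<in> T" "\<psi> = U a" "\<phi> = U b" by auto
  then have "(c *\<^sub>C a, c *\<^sub>C b) \<in> T" using T by (simp add: linear_graph_def)
  then have "map_prod U U (c *\<^sub>C a, c *\<^sub>C b) \<in> map_prod U U ` T" by (rule imageI)
  then show "(c *\<^sub>C \<psi>, c *\<^sub>C \<phi>) \<in> map_prod U U ` T"
    by (simp add: * bounded_clinear_scaleC[OF unitary_pair_clinear(1)])
qed

lemma spectral_resolution_unitary:
  assumes E: "spectral_resolution E T"
  shows "spectral_resolution (\<lambda>S \<psi>. U (E S (V \<psi>))) (map_prod U U ` T)"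
  unfolding spectral_resolution_def diagonal_measure_unitary
proof (intro conjI)
  show "projection_valued_measure (\<lambda>S \<psi>. U (E S (V \<psi>)))" "linear_graph (map_prod U U ` T)"
    using E by (simp_all add: spectral_resolution_def projection_valued_measure_unitary linear_graph_unitary)
  have "Domain (map_prod U U ` T) = {\<psi>. V \<psi> \<in> Domain T}"
  proof (intro set_eqI iffI)
    fix \<psi> assume "\<psi> \<in> {\<psi>. V \<psi> \<in> Domain T}"
    then obtain \<phi> where "(V \<psi>, \<phi>) \<in> T" by auto
    then have "map_prod U U (V \<psi>, \<phi>) \<in> map_prod U U ` T" by (rule imageI)
    then show "\<psi> \<in> Domain (map_prod U U ` T)" by auto
  qed auto
  then show "Domain (map_prod U U ` T) = {\<psi>. integrable (diagonal_measure E (V \<psi>)) (\<lambda>x. x\<^sup>2)}"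
    using E by (auto simp: spectral_resolution_def)
  show "\<forall>(\<psi>, \<phi>)\<in>map_prod U U ` T. cinner \<psi> \<phi> = complex_of_real (LINT x|diagonal_measure E (V \<psi>). x)"
  proof -
    have "cinner a b = complex_of_real (LINT x|diagonal_measure E a. x)" if "(a, b) \<in> T" for a b
      using E that unfolding spectral_resolution_def by blast
    then show ?thesis by (auto simp: unitary_pair_adjoint)
  qed
qed

end

section \<open>Evaluating the functional calculus\<close>

text \<open>Uniqueness of the diagonal measures makes the choice hidden in
  \<open>spectral_measure\<close> harmless, and polarization makes the operator described by
  \<open>spectral_integral\<close> unique.\<close>

lemma fun_calc_eqI:
  assumes E: "spectral_resolution E T"
    and uniq: "\<And>E' \<psi>. spectral_resolution E' T \<Longrightarrow> diagonal_measure E' \<psi> = diagonal_measure E \<psi>"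
    and B: "bounded_clinear B" "\<And>\<psi>. cinner \<psi> (B \<psi>) = (LINT x|diagonal_measure E \<psi>. f x)"
  shows "fun_calc f T = B"
proof -
  have "spectral_resolution (spectral_measure T) T"
    unfolding spectral_measure_def by (rule someI[where P = "\<lambda>E. spectral_resolution E T", OF E])
  then have diag: "diagonal_measure (spectral_measure T) = diagonal_measure E"
    using uniq by blast
  show ?thesis
    unfolding fun_calc_def spectral_integral_def diag
  proof (rule the_equality)
    fix B' assume B': "bounded_clinear B' \<and> (\<forall>\<psi>. cinner \<psi> (B' \<psi>) = (LINT x|diagonal_measure E \<psi>. f x))"
    show "B' = B"
      by (rule clinear_eq_if_diagonal_eq) (use B B' in auto)
  qed (use B in auto)
qed

lemma bcontfun_measurable: "f \<in> bcontfun \<Longrightarrow> (f :: real \<Rightarrow> complex) \<in> borel_measurable borel"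
  by (simp add: bcontfun_def borel_measurable_continuous_onI)

lemma bcontfun_bound:
  assumes "f \<in> bcontfun"
  obtains C where "\<And>x. norm (f x) \<le> C"
  using assms by (auto simp: bcontfun_def bounded_iff)

lemma cinner_mult_op:
  assumes f: "f \<in> bcontfun" and g: "square_integrable g"
  shows "cinner (L2_class g) (mult_op f (L2_class g)) = (LINT x|lborel. f x * complex_of_real ((cmod (g x))\<^sup>2))"
proof -
  obtain C where C: "\<And>x. norm (f x) \<le> C" using bcontfun_bound[OF f] by blast
  note fm = bcontfun_measurable[OF f]
  show ?thesis
    unfolding mult_op_L2_class[OF g fm C] cinner_L2_class[OF g square_integrable_mult_bounded[OF g fm C]]
    by (intro Bochner_Integration.integral_cong refl) (simp add: complex_norm_square mult_ac del: of_real_power)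
qed

text \<open>An arbitrary resolution of the transported operator is conjugated back to one of
  \<open>position_op\<close>, where uniqueness is known.\<close>

lemma fun_calc_unitary_position:
  assumes UV: "unitary_pair U V" and f: "f \<in> bcontfun"
  shows "fun_calc f (map_prod U U ` position_op) = (\<lambda>\<psi>. U (mult_op f (V \<psi>)))"
proof (rule fun_calc_eqI[OF spectral_resolution_unitary[OF UV spectral_resolution_position_pvm]])
  have VU: "unitary_pair V U" by (rule unitary_pair_sym[OF UV])
  fix E' \<psi> assume E': "spectral_resolution E' (map_prod U U ` position_op)"
  have "map_prod V V ` map_prod U U ` position_op = position_op"
    by (force simp: image_image map_prod_def case_prod_beta unitary_pair_inverse[OF UV])
  then have "spectral_resolution (\<lambda>S \<psi>. V (E' S (U \<psi>))) position_op"
    using spectral_resolution_unitary[OF VU E'] by simp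
  from diagonal_measure_position_resolution[OF this, of "V \<psi>"]
  show "diagonal_measure E' \<psi> = diagonal_measure (\<lambda>S \<psi>. U (position_pvm S (V \<psi>))) \<psi>"
    by (simp add: diagonal_measure_unitary[OF UV] diagonal_measure_unitary[OF VU] unitary_pair_inverse[OF UV])
next
  obtain C where C: "\<And>x. norm (f x) \<le> C" using bcontfun_bound[OF f] by blast
  note [measurable] = bcontfun_measurable[OF f]
  show "bounded_clinear (\<lambda>\<psi>. U (mult_op f (V \<psi>)))"
    by (rule bounded_clinear_compose[OF unitary_pair_clinear(1)[OF UV]
          bounded_clinear_compose[OF bounded_clinear_mult_op unitary_pair_clinear(2)[OF UV]]])
       (measurable, rule C)
  fix \<psi>
  have diag: "diagonal_measure position_pvm (V \<psi>) = density lborel (\<lambda>x. ennreal ((cmod (Rep_l2 (V \<psi>) x))\<^sup>2))"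
    using diagonal_measure_position_pvm[OF square_integrable_Rep, of "V \<psi>"] by simp
  show "cinner \<psi> (U (mult_op f (V \<psi>))) =
      (LINT x|diagonal_measure (\<lambda>S \<psi>. U (position_pvm S (V \<psi>))) \<psi>. f x)"
    using cinner_mult_op[OF f square_integrable_Rep, of "V \<psi>"]
    unfolding diagonal_measure_unitary[OF UV] diag
    by (subst integral_density) (auto simp: unitary_pair_adjoint[OF UV] scaleR_conv_of_real mult.commute)
qed

lemma fun_calc_position:
  assumes f: "f \<in> bcontfun"
  shows "fun_calc f position_op = mult_op f"
proof -
  have "unitary_pair (\<lambda>\<psi>. \<psi>) (\<lambda>\<psi>. \<psi>)" by (simp add: unitary_pair_def bounded_clinear_id)
  from fun_calc_unitary_position[OF this f] show ?thesis
    by (simp add: map_prod_def case_prod_beta)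
qed

section \<open>Step functions\<close>

text \<open>The sign encodes orientation: integrating against it gives the integral from 0 to
  \<open>t\<close> for either sign of \<open>t\<close>, and for \<open>a \<le> b\<close> the
  difference at \<open>b\<close> and \<open>a\<close> is the indicator of \<open>{a<..b}\<close>
  wherever 0 lies.\<close>

definition signed_indicator :: "real \<Rightarrow> real \<Rightarrow> complex" where
  "signed_indicator t x = (if 0 < x \<and> x \<le> t then 1 else if t < x \<and> x \<le> 0 then -1 else 0)"

lemma signed_indicator_eq: "signed_indicator t x = indicator {0<..t} x - indicator {t<..0} x"
  by (auto simp: signed_indicator_def indicator_def)

lemma measurable_signed_indicator [measurable]: "signed_indicator t \<in> borel_measurable borel"
  unfolding signed_indicator_eq[abs_def] by measurable

lemma cnj_signed_indicator [simp]: "cnj (signed_indicator t x) = signed_indicator t x"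
  by (simp add: signed_indicator_def)

lemma norm_signed_indicator_diff:
  "(cmod (signed_indicator s x - signed_indicator t x))\<^sup>2 = indicator {min s t<..max s t} x"
  by (auto simp: signed_indicator_def indicator_def)

lemma signed_indicator_zero [simp]: "signed_indicator 0 x = 0"
  by (auto simp: signed_indicator_def)

lemma square_integrable_signed_indicator: "square_integrable (signed_indicator t)"
  using norm_signed_indicator_diff[of t _ 0] by (simp add: square_integrable_def)

lemma integrable_signed_indicator: "integrable lborel (signed_indicator t)"
proof (rule Bochner_Integration.integrable_bound)
  show "integrable lborel (\<lambda>x. indicator {min t 0<..max t 0} x :: real)" by simp
qed (auto simp: signed_indicator_def indicator_def)

lemma square_integrable_indicator:
  assumes "S \<in> sets borel" "S \<subseteq> {a..b}"
  shows "square_integrable (indicator S)"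
proof -
  have "emeasure lborel S \<le> emeasure lborel {a..b}"
    using assms by (intro emeasure_mono) auto
  then have "emeasure lborel S < \<infinity>"
    by (rule le_less_trans) (simp add: emeasure_lborel_Icc_eq)
  moreover have "(cmod (indicator S x))\<^sup>2 = indicator S x" for x
    by (simp add: indicator_def)
  ultimately show ?thesis using assms(1) by (simp add: square_integrable_def)
qed

definition step :: "real \<Rightarrow> l2" where
  "step t = L2_class (signed_indicator t)"

lemma step_diff:
  assumes "a \<le> b"
  shows "step b - step a = L2_class (indicator {a<..b})"
proof -
  have "signed_indicator b x - signed_indicator a x = indicator {a<..b} x" for x
    using assms by (auto simp: signed_indicator_def indicator_def)
  then show ?thesis
    by (simp add: step_def L2_class_diff square_integrable_signed_indicator indicator_def[abs_def])
qed

lemma norm_step_diff: "(norm (step s - step t))\<^sup>2 = \<bar>s - t\<bar>"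
  by (simp add: step_def L2_class_diff square_integrable_signed_indicator norm_L2_class
      square_integrable_diff norm_signed_indicator_diff)

lemma bounded_linear_scaleC: "bounded_linear (\<lambda>\<psi>. c *\<^sub>C \<psi>)"
  by (rule bounded_linear_intro[where K = "cmod c"])
     (simp_all add: scaleC_add_right scaleR_l2_def norm_scaleC mult.commute)

lemma L2_class_sum:
  assumes "finite A" "\<And>i. i \<in> A \<Longrightarrow> square_integrable (f i)"
  shows "square_integrable (\<lambda>x. \<Sum>i\<in>A. f i x) \<and> L2_class (\<lambda>x. \<Sum>i\<in>A. f i x) = (\<Sum>i\<in>A. L2_class (f i))"
  using assms
  by (induction A rule: finite_induct)
     (auto simp: square_integrable_zero L2_class_zero square_integrable_add simp flip: L2_class_add)

text \<open>A Dynkin system argument on bounded Borel sets, followed by simple functions.\<close>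

lemma step_total:
  assumes closed: "closed W" and sub: "subspace W" and gen: "\<And>c t. c *\<^sub>C step t \<in> W"
  shows "W = UNIV"
proof -
  have interval: "c *\<^sub>C L2_class (indicator {a<..b}) \<in> W" for a b c
  proof (cases "a \<le> b")
    case True
    then show ?thesis
      by (simp add: scaleC_diff_right subspace_diff sub gen flip: step_diff)
  next
    case False
    then show ?thesis by (simp add: subspace_0 sub indicator_def[abs_def] L2_class_zero)
  qed
  \<comment> \<open>Cutting to a bounded interval keeps all sets of finite measure, so complements
    remain within square-integrable indicators.\<close>
  define I where "I n = {- real n<..real n}" for n
  have borel: "c *\<^sub>C L2_class (indicator (S \<inter> I n)) \<in> W" if S: "S \<in> sets borel" for S c n
  proof -
    let ?G = "range (\<lambda>(a, b). {a<..b::real})"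
    have si: "square_integrable (indicator (A \<inter> I n))" if "A \<in> sets borel" for A
      by (rule square_integrable_indicator[of _ "- real n" "real n"]) (use that in \<open>auto simp: I_def\<close>)
    have "S \<in> sigma_sets UNIV ?G" using S by (simp only: sets_borel_Ioc)
    from Int_stable_Ioc subset_UNIV[of ?G, folded Pow_UNIV] this
    have "\<forall>c. c *\<^sub>C L2_class (indicator (S \<inter> I n)) \<in> W"
    proof (induction S rule: sigma_sets_induct_disjoint)
      case (basic A)
      then obtain a b where "A = {a<..b}" by auto
      then have "A \<inter> I n = {max a (- real n)<..min b (real n)}" by (auto simp: I_def)
      then show ?case by (simp add: interval)
    next
      case empty
      then show ?case by (simp add: subspace_0 sub L2_class_zero)
    next
      case (compl A)
      then have A: "A \<in> sets borel" by (simp add: sets_borel_Ioc)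
      have "indicator ((UNIV - A) \<inter> I n) x = indicator (I n) x - (indicator (A \<inter> I n) x :: complex)" for x
        by (auto simp: indicator_def)
      then have "L2_class (indicator ((UNIV - A) \<inter> I n)) = L2_class (indicator (I n)) - L2_class (indicator (A \<inter> I n))"
        using si[OF A] si[of UNIV] by (simp add: L2_class_diff indicator_def[abs_def])
      then show ?case
        using compl interval[of _ "- real n" "real n"] by (simp add: scaleC_diff_right subspace_diff sub I_def)
    next
      case (union A)
      then have A: "range A \<subseteq> sets borel" by (simp add: sets_borel_Ioc)
      \<comment> \<open>Intersection with \<open>B\<close> is a position projection; its countable
        additivity makes disjoint unions converge in norm, and \<open>W\<close> is closed.\<close>
      have restrict: "position_pvm B (L2_class (indicator (I n))) = L2_class (indicator (B \<inter> I n))"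
        if "B \<in> sets borel" for B
        using si[of UNIV] that by (simp add: position_pvm_L2_class indicator_inter_arith[abs_def])
      have "(\<lambda>i. position_pvm (A i) (L2_class (indicator (I n)))) sums position_pvm (\<Union>i. A i) (L2_class (indicator (I n)))"
        using projection_valued_measure_position_pvm A union(1) by (simp add: projection_valued_measure_def)
      then have "(\<lambda>i. L2_class (indicator (A i \<inter> I n))) sums L2_class (indicator ((\<Union>i. A i) \<inter> I n))"
        using A by (subst (asm) (1 2) restrict) auto
      then have sums: "(\<lambda>i. c *\<^sub>C L2_class (indicator (A i \<inter> I n))) sums (c *\<^sub>C L2_class (indicator ((\<Union>i. A i) \<inter> I n)))" for c
        by (rule bounded_linear.sums[OF bounded_linear_scaleC])
      show ?case
      proof
        fix c
        show "c *\<^sub>C L2_class (indicator ((\<Union>i. A i) \<inter> I n)) \<in> W"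
          by (rule closed_sequentially[OF closed _ sums[unfolded sums_def]])
             (use union in \<open>auto intro: subspace_sum sub\<close>)
      qed
    qed
    then show ?thesis by blast
  qed
  have "\<psi> \<in> W" for \<psi>
  proof (cases \<psi> rule: L2_cases)
    case (1 f)
    have [measurable]: "f \<in> borel_measurable borel" using 1 by (simp add: square_integrable_measurable)
    obtain F where F: "\<And>i. simple_function borel (F i)" "\<And>x. (\<lambda>i. F i x) \<longlonglongrightarrow> f x"
      "\<And>i x. dist (F i x) 0 \<le> 2 * dist (f x) 0"
      using borel_measurable_implies_sequence_metric[of f borel 0] by auto
    have [measurable]: "F i \<in> borel_measurable borel" for i
      using F(1) by (rule borel_measurable_simple_function)
    have [measurable]: "I n \<in> sets borel" for n by (simp add: I_def)
    have W: "L2_class (\<lambda>x. indicator (I i) x * F i x) \<in> W" for i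
    proof -
      have fin: "finite (range (F i))" using F(1)[of i] by (simp add: simple_function_def)
      have meas: "F i -` {y} \<in> sets borel" for y
        using measurable_sets[of "F i" borel borel "{y}"] by simp
      have si: "square_integrable (indicator (F i -` {y} \<inter> I i))" for y
        by (rule square_integrable_indicator[of _ "- real i" "real i"]) (use meas in \<open>auto simp: I_def\<close>)
      have "indicator (I i) x * F i x = (\<Sum>y\<in>range (F i). y * indicator (F i -` {y} \<inter> I i) x)" for x
      proof -
        have "(\<Sum>y\<in>range (F i). y * indicator (F i -` {y} \<inter> I i) x) = (\<Sum>y\<in>{F i x}. y * indicator (F i -` {y} \<inter> I i) x)"
          by (rule sum.mono_neutral_right) (auto simp: fin)
        then show ?thesis by (simp add: indicator_def)
      qed
      then have "L2_class (\<lambda>x. indicator (I i) x * F i x)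
          = (\<Sum>y\<in>range (F i). L2_class (\<lambda>x. y * indicator (F i -` {y} \<inter> I i) x))"
        using L2_class_sum[OF fin, of "\<lambda>y x. y * indicator (F i -` {y} \<inter> I i) x"]
        by (simp add: square_integrable_cmult[OF si])
      also have "\<dots> = (\<Sum>y\<in>range (F i). y *\<^sub>C L2_class (indicator (F i -` {y} \<inter> I i)))"
        by (simp add: L2_class_scaleC[OF si])
      also have "\<dots> \<in> W"
        by (intro subspace_sum sub borel meas)
      finally show ?thesis .
    qed
    have "(\<lambda>i. L2_class (\<lambda>x. indicator (I i) x * F i x)) \<longlonglongrightarrow> L2_class f"
    proof (rule L2_class_tendsto[OF 1(1), where g = "\<lambda>x. 2 * f x"])
      show "square_integrable (\<lambda>x. 2 * f x)" by (rule square_integrable_cmult[OF 1(1)])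
      show "AE x in lborel. (\<lambda>i. indicator (I i) x * F i x) \<longlonglongrightarrow> f x"
      proof (rule AE_I2)
        fix x
        obtain N where N: "\<bar>x\<bar> < real N" using reals_Archimedean2 by blast
        have "\<forall>\<^sub>F i in sequentially. F i x = indicator (I i) x * F i x"
          by (rule eventually_sequentiallyI[of N]) (use N in \<open>auto simp: I_def indicator_def\<close>)
        from Lim_transform_eventually[OF F(2) this]
        show "(\<lambda>i. indicator (I i) x * F i x) \<longlonglongrightarrow> f x" .
      qed
      show "AE x in lborel. cmod (indicator (I i) x * F i x) \<le> cmod (2 * f x)" for i
        using F(3)[of i] by (auto simp: indicator_def norm_mult)
    qed measurable
    then show ?thesis
      using closed_sequentially[OF closed W] 1 by simp
  qed
  then show ?thesis by blast
qed

text \<open>The graph of \<open>F\<close> is the closure of the span of the pairs \<open>(c u\<^sub>i, c v\<^sub>i)\<close>.\<close>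

lemma isometric_extension:
  fixes u v :: "'i \<Rightarrow> l2"
  assumes gram: "\<And>i j. cinner (u i) (u j) = cinner (v i) (v j)"
    and total: "\<And>W. closed W \<Longrightarrow> subspace W \<Longrightarrow> (\<And>c i. c *\<^sub>C u i \<in> W) \<Longrightarrow> W = UNIV"
  obtains F where "bounded_clinear F" "\<And>i. F (u i) = v i" "\<And>\<psi>. norm (F \<psi>) = norm \<psi>"
proof -
  define G where "G = {(c *\<^sub>C u i, c *\<^sub>C v i) | c i. True}"
  define K where "K = closure (span G)"
  \<comment> \<open>Preservation of the inner product is linear in each argument, so it passes from
    generators to the span one argument at a time; the resulting norm equality passes to the
    closure.\<close>
  have inner_gen: "inner (fst z) (fst w) = inner (snd z) (snd w)" if "z \<in> G" "w \<in> G" for z w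
    using that by (auto simp: G_def inner_l2_def cinner_scaleC_left cinner_scaleC_right gram)
  have inner_gen': "inner (fst z) (fst w) = inner (snd z) (snd w)" if "z \<in> G" "w \<in> span G" for z w
    using that(2)
    by (induction rule: span_induct) (auto simp: subspace_def inner_add_right inner_gen[OF that(1)])
  have "inner (fst z) (fst w) = inner (snd z) (snd w)" if "z \<in> span G" "w \<in> span G" for z w
    using that(1)
    by (induction rule: span_induct) (auto simp: subspace_def inner_add_left inner_gen'[OF _ that(2)])
  then have "span G \<subseteq> {z. norm (fst z) = norm (snd z)}"
    by (auto simp: norm_eq_sqrt_inner)
  moreover have "closed {z :: l2 \<times> l2. norm (fst z) = norm (snd z)}"
    by (intro closed_Collect_eq continuous_intros)
  ultimately have norm_K: "norm (fst z) = norm (snd z)" if "z \<in> K" for z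
    using that closure_minimal unfolding K_def by blast
  have K_seq: "z \<in> K \<longleftrightarrow> (\<exists>s. (\<forall>n. s n \<in> span G) \<and> s \<longlonglongrightarrow> z)" for z
    by (simp add: K_def closure_sequential)
  have sub_K: "subspace K"
    unfolding subspace_def
  proof (intro conjI ballI allI)
    show "0 \<in> K" unfolding K_def using closure_subset span_zero by blast
    show "x + y \<in> K" if "x \<in> K" "y \<in> K" for x y
      using that unfolding K_seq by (metis (no_types, lifting) span_add tendsto_add)
    show "c *\<^sub>R x \<in> K" if "x \<in> K" for c x
      using that unfolding K_seq by (metis (no_types, lifting) span_scale tendsto_scaleR tendsto_const)
  qed
  have scale_span: "(c *\<^sub>C fst z, c *\<^sub>C snd z) \<in> span G" if "z \<in> span G" for c z
    using that
  proof (induction rule: span_induct)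
    case base
    show ?case
      unfolding subspace_def
      using span_add[of "(c *\<^sub>C fst _, c *\<^sub>C snd _)" G] span_scale[of "(c *\<^sub>C fst _, c *\<^sub>C snd _)" G]
      by (auto simp: scaleC_add_right span_zero zero_prod_def[symmetric] scaleR_l2_def mult.commute)
  next
    case (step z)
    then have "(c *\<^sub>C fst z, c *\<^sub>C snd z) \<in> G" by (force simp: G_def)
    then show ?case by (rule span_base)
  qed
  have scale_K: "(c *\<^sub>C a, c *\<^sub>C b) \<in> K" if ab: "(a, b) \<in> K" for a b c
  proof -
    obtain s where s: "\<And>n. s n \<in> span G" "s \<longlonglongrightarrow> (a, b)" using ab by (auto simp: K_seq)
    have "(\<lambda>n. c *\<^sub>C fst (s n)) \<longlonglongrightarrow> c *\<^sub>C a" "(\<lambda>n. c *\<^sub>C snd (s n)) \<longlonglongrightarrow> c *\<^sub>C b"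
      using s(2) by (auto intro!: bounded_linear.tendsto[OF bounded_linear_scaleC] dest: tendsto_fst tendsto_snd)
    then have "(\<lambda>n. (c *\<^sub>C fst (s n), c *\<^sub>C snd (s n))) \<longlonglongrightarrow> (c *\<^sub>C a, c *\<^sub>C b)"
      by (rule tendsto_Pair)
    then show ?thesis
      unfolding K_seq by (intro exI[of _ "\<lambda>n. (c *\<^sub>C fst (s n), c *\<^sub>C snd (s n))"]) (simp add: scale_span s(1))
  qed
  have gen_K: "(c *\<^sub>C u i, c *\<^sub>C v i) \<in> K" for c i
    unfolding K_def using closure_subset span_base[of "(c *\<^sub>C u i, c *\<^sub>C v i)" G] by (force simp: G_def)
  have "fst ` K = UNIV"
  proof (rule total)
    show "subspace (fst ` K)"
      by (rule linear_subspace_image[OF linear_fst sub_K])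
    show "c *\<^sub>C u i \<in> fst ` K" for c i using gen_K by force
    \<comment> \<open>A convergent sequence of first components has, by isometry, a Cauchy sequence
      of second components; completeness supplies the partner of the limit.\<close>
    show "closed (fst ` K)"
      unfolding closed_sequential_limits
    proof (intro allI impI, elim conjE)
      fix a l assume a: "\<forall>n. a n \<in> fst ` K" "a \<longlonglongrightarrow> l"
      then have "\<forall>n. \<exists>b. (a n, b) \<in> K" by force
      then obtain b where b: "\<And>n. (a n, b n) \<in> K" by metis
      have "(a n - a m, b n - b m) \<in> K" for n m
        using subspace_diff[OF sub_K b b] by simp
      then have "norm (a n - a m) = norm (b n - b m)" for n m
        using norm_K by fastforce
      moreover have "Cauchy a" using a(2) LIMSEQ_imp_Cauchy by blast
      ultimately have "Cauchy b" by (simp add: Cauchy_iff)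
      then obtain b' where "b \<longlonglongrightarrow> b'" using Cauchy_convergent convergent_def by blast
      then have lim: "(\<lambda>n. (a n, b n)) \<longlonglongrightarrow> (l, b')" by (rule tendsto_Pair[OF a(2)])
      have "closed K" by (simp add: K_def)
      then have "(l, b') \<in> K"
        by (rule closed_sequentially[where f = "\<lambda>n. (a n, b n)"]) (simp_all only: b lim)
      then show "l \<in> fst ` K" by force
    qed
  qed
  then have "\<exists>b. (a, b) \<in> K" for a
    by (metis (no_types, opaque_lifting) UNIV_I fst_conv imageE surj_pair)
  then obtain F where F: "\<And>a. (a, F a) \<in> K" by metis
  \<comment> \<open>Two partners of the same vector differ by the second component of a pair whose
    first component is 0, and the two norms agree.\<close>
  have uniq: "F a = b" if "(a, b) \<in> K" for a b
    using norm_K[OF subspace_diff[OF sub_K F[of a] that]] by simp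
  show thesis
  proof
    show norm_F: "norm (F \<psi>) = norm \<psi>" for \<psi> using norm_K[OF F[of \<psi>]] by simp
    show "F (u i) = v i" for i using uniq[of "u i" "v i"] gen_K[of 1 i] by simp
    show "bounded_clinear F"
    proof (rule bounded_clinearI[where K = 1])
      show "F (\<psi> + \<xi>) = F \<psi> + F \<xi>" for \<psi> \<xi>
        using uniq subspace_add[OF sub_K F F, of \<psi> \<xi>] by simp
      show "F (c *\<^sub>C \<psi>) = c *\<^sub>C F \<psi>" for c \<psi>
        using uniq scale_K[OF F] by blast
    qed (simp add: norm_F)
  qed
qed

section \<open>The Fourier transform\<close>

text \<open>Not normalized: \<open>\<sigma> = 1\<close> is the transform, \<open>\<sigma> = - 1\<close> its inverse up to a constant.\<close>

definition fourier :: "real \<Rightarrow> (real \<Rightarrow> complex) \<Rightarrow> real \<Rightarrow> complex" where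
  "fourier \<sigma> f k = (LINT x|lborel. cis (- (\<sigma> * k * x)) * f x)"

lemma measurable_cis [measurable]: "cis \<in> borel_measurable borel"
  by (intro borel_measurable_continuous_onI continuous_intros)

lemma measurable_fourier [measurable]:
  assumes [measurable]: "f \<in> borel_measurable borel"
  shows "fourier \<sigma> f \<in> borel_measurable borel"
  unfolding fourier_def[abs_def] by measurable

lemma cnj_fourier: "cnj (fourier \<sigma> f k) = fourier (- \<sigma>) (\<lambda>x. cnj (f x)) k"
  by (simp add: fourier_def cis_cnj flip: Bochner_Integration.integral_cnj)

lemma fourier_bound:
  assumes "integrable lborel f"
  shows "cmod (fourier \<sigma> f k) \<le> (LINT x|lborel. cmod (f x))"
  unfolding fourier_def
  using integral_norm_bound[of lborel "\<lambda>x. cis (- (\<sigma> * k * x)) * f x"] by (simp add: norm_mult)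

lemma has_vector_derivative_cis: "((\<lambda>x. cis (c * x)) has_vector_derivative (\<i> * of_real c * cis (c * x))) (at x within A)"
proof -
  have "((\<lambda>z. exp (\<i> * of_real c * z)) has_field_derivative \<i> * of_real c * exp (\<i> * of_real c * of_real x)) (at (of_real x))"
    by (auto intro!: derivative_eq_intros)
  from has_vector_derivative_real_field[OF this] show ?thesis
    by (simp add: cis_conv_exp mult.assoc)
qed

lemma integral_mult_signed_indicator:
  fixes f F :: "real \<Rightarrow> complex"
  assumes F: "\<And>x. (F has_vector_derivative f x) (at x)" and f: "continuous_on UNIV f"
  shows "(LINT x|lborel. f x * signed_indicator t x) = F t - F 0"
proof -
  have [measurable]: "f \<in> borel_measurable borel" using f by (rule borel_measurable_continuous_onI)
  have FTC: "(LINT x|lborel. indicator {a..b} x *\<^sub>R f x) = F b - F a" if "a \<le> b" for a b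
    using that by (intro integral_FTC_Icc)
       (auto intro: has_vector_derivative_at_within F continuous_on_subset[OF f])
  have null: "AE x in lborel. x \<noteq> c" for c :: real by (rule AE_lborel_singleton)
  show ?thesis
  proof (cases "0 \<le> t")
    case True
    have "(LINT x|lborel. f x * signed_indicator t x) = (LINT x|lborel. indicator {0..t} x *\<^sub>R f x)"
    proof (rule integral_cong_AE)
      show "AE x in lborel. f x * signed_indicator t x = indicator {0..t} x *\<^sub>R f x"
        using null[of 0] by eventually_elim (use True in \<open>auto simp: signed_indicator_def indicator_def\<close>)
    qed measurable
    then show ?thesis using FTC[OF True] by simp
  next
    case False
    have "(LINT x|lborel. f x * signed_indicator t x) = (LINT x|lborel. - (indicator {t..0} x *\<^sub>R f x))"
    proof (rule integral_cong_AE)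
      show "AE x in lborel. f x * signed_indicator t x = - (indicator {t..0} x *\<^sub>R f x)"
        using null[of t] by eventually_elim (use False in \<open>auto simp: signed_indicator_def indicator_def\<close>)
    qed measurable
    then show ?thesis using FTC[of t 0] False by simp
  qed
qed

lemma fourier_signed_indicator:
  assumes "\<sigma> * k \<noteq> 0"
  shows "fourier \<sigma> (signed_indicator t) k = (1 - cis (- (\<sigma> * k * t))) / (\<i> * complex_of_real (\<sigma> * k))"
proof -
  define c where "c = - (\<sigma> * k)"
  have c: "c \<noteq> 0" using assms by (simp add: c_def)
  have "((\<lambda>x. cis (c * x) / (\<i> * complex_of_real c)) has_vector_derivative cis (c * x)) (at x)" for x
    using has_vector_derivative_mult_left[OF has_vector_derivative_cis[of c x UNIV], of "1 / (\<i> * complex_of_real c)"] c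
    by simp
  moreover have "continuous_on UNIV (\<lambda>x. cis (c * x))"
    by (intro continuous_intros)
  ultimately have "(LINT x|lborel. cis (c * x) * signed_indicator t x)
      = cis (c * t) / (\<i> * complex_of_real c) - cis (c * 0) / (\<i> * complex_of_real c)"
    by (rule integral_mult_signed_indicator)
  then show ?thesis
    using c unfolding fourier_def c_def by (simp add: divide_simps)
qed

section \<open>Energies of transformed step functions\<close>

lemma cmod_cis_diff: "(cmod (cis a - cis b))\<^sup>2 = 2 * (1 - cos (a - b))"
proof -
  have "(cmod (cis a - cis b))\<^sup>2 = (cos a - cos b)\<^sup>2 + (sin a - sin b)\<^sup>2"
    by (simp add: cmod_power2)
  also have "\<dots> = ((cos a)\<^sup>2 + (sin a)\<^sup>2) + ((cos b)\<^sup>2 + (sin b)\<^sup>2) - 2 * (cos a * cos b + sin a * sin b)"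
    by (simp add: power2_diff algebra_simps)
  finally show ?thesis by (simp add: cos_diff)
qed

lemma cmod_fourier_signed_indicator_diff:
  assumes "\<sigma> \<in> {1, -1}" "k \<noteq> 0"
  shows "(cmod (fourier \<sigma> (signed_indicator s) k - fourier \<sigma> (signed_indicator t) k))\<^sup>2
    = 2 * ((1 - cos ((s - t) * k)) / k\<^sup>2)"
proof -
  have *: "\<sigma> * k \<noteq> 0" using assms by auto
  have "fourier \<sigma> (signed_indicator s) k - fourier \<sigma> (signed_indicator t) k
      = (cis (- (\<sigma> * k * t)) - cis (- (\<sigma> * k * s))) / (\<i> * complex_of_real (\<sigma> * k))"
    unfolding fourier_signed_indicator[OF *] by (simp add: diff_divide_distrib)
  then have "(cmod (fourier \<sigma> (signed_indicator s) k - fourier \<sigma> (signed_indicator t) k))\<^sup>2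
      = 2 * (1 - cos (\<sigma> * ((s - t) * k))) / (\<sigma> * k)\<^sup>2"
    by (simp add: norm_divide norm_mult power_divide cmod_cis_diff algebra_simps flip: abs_mult)
  also have "cos (\<sigma> * ((s - t) * k)) = cos ((s - t) * k)" using assms(1) by (auto simp del: mult_minus_left simp: mult_minus1)
  finally show ?thesis using assms(1) by (auto simp: power_mult_distrib)
qed

text \<open>The value of this integral is \<open>pi\<close>, but only its positivity matters: it scales the energies of
  all transformed step functions by the same factor.\<close>

definition sinc_energy :: real where
  "sinc_energy = (LINT k|lborel. (1 - cos k) / k\<^sup>2)"

lemma one_minus_cos_le: "1 - cos x \<le> x\<^sup>2 / 2" for x :: real
  using cos_double_sin[of "x/2"]
    abs_sin_x_le_abs_x[of "x/2"] power_mono[of "\<bar>sin (x/2)\<bar>" "\<bar>x/2\<bar>" 2]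
  by (simp add: power_divide)

text \<open>The numerator is at most \<open>k^2 / 2\<close> and at most 2. Multiplied by
  \<open>1 + k^2\<close> it stays below \<open>k^2 / 2 + 2 * k^2\<close>, hence below
  \<open>4 * k^2\<close>.\<close>

lemma integrable_one_minus_cos: "integrable lborel (\<lambda>k :: real. (1 - cos k) / k\<^sup>2)"
proof (rule Bochner_Integration.integrable_bound)
  show "integrable lborel (\<lambda>k :: real. 4 * inverse (1 + k\<^sup>2))"
    using integrable_inverse_1_plus_square by (simp add: set_integrable_def)
  show "AE k in lborel. norm ((1 - cos k) / (k :: real)\<^sup>2) \<le> norm (4 * inverse (1 + k\<^sup>2))"
  proof (rule AE_I2)
    fix k :: real
    show "norm ((1 - cos k) / k\<^sup>2) \<le> norm (4 * inverse (1 + k\<^sup>2))"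
    proof (cases "k = 0")
      case False
      note one_minus_cos_le[of k]
      moreover have "1 - cos k \<le> 2" "0 \<le> 1 - cos k"
        using cos_ge_minus_one[of k] cos_le_one[of k] by linarith+
      ultimately have cos: "1 - cos k \<le> k\<^sup>2 / 2" "1 - cos k \<le> 2" "0 \<le> 1 - cos k" .
      have "(1 - cos k) * (1 + k\<^sup>2) \<le> 4 * k\<^sup>2"
      proof -
        have "(1 - cos k) * k\<^sup>2 \<le> 2 * k\<^sup>2" by (rule mult_right_mono[OF cos(2)]) simp
        moreover have "(1 - cos k) * (1 + k\<^sup>2) = (1 - cos k) + (1 - cos k) * k\<^sup>2"
          by (simp add: distrib_left)
        ultimately show ?thesis using cos(1) zero_le_power2[of k] by linarith
      qed
      moreover have "0 < 1 + k\<^sup>2" using zero_le_power2[of k] by linarith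
      ultimately show ?thesis
        using False cos(3) by (simp add: field_simps)
    qed simp
  qed
qed measurable

text \<open>The integrand is nonnegative and does not vanish on \<open>{0<..<1}\<close>, since
  cosine is below 1 there.\<close>

lemma sinc_energy_pos: "sinc_energy > 0"
proof -
  have "sinc_energy \<noteq> 0"
  proof
    assume "sinc_energy = 0"
    then have "AE k in lborel. (1 - cos k) / (k :: real)\<^sup>2 = 0"
      unfolding sinc_energy_def using integrable_one_minus_cos
      by (subst (asm) integral_nonneg_eq_0_iff_AE) auto
    then have "AE k in lborel. k \<notin> {0<..<1::real}"
    proof eventually_elim
      case (elim k)
      show ?case
      proof
        assume k: "k \<in> {0<..<1}"
        then have "cos k < cos 0" by (intro cos_monotone_0_pi) (use pi_ge_two in auto)
        with k elim show False by simp
      qed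
    qed
    then have "emeasure lborel {0<..<1::real} = 0"
      by (subst (asm) AE_iff_measurable[where N = "{0<..<1::real}"]) auto
    then show False by simp
  qed
  moreover have "sinc_energy \<ge> 0"
    unfolding sinc_energy_def by (intro integral_nonneg_AE) auto
  ultimately show ?thesis by simp
qed

text \<open>Substituting \<open>t * k\<close> for \<open>k\<close> makes the energy proportional to
  \<open>\<bar>t\<bar>\<close>, in step with \<open>norm_step_diff\<close>; this proportionality is
  the isometry on step functions.\<close>

lemma one_minus_cos_scaled:
  shows "integrable lborel (\<lambda>k :: real. (1 - cos (t * k)) / k\<^sup>2)"
    and "(LINT k|lborel. (1 - cos (t * k)) / k\<^sup>2) = \<bar>t\<bar> * sinc_energy"
proof -
  \<comment> \<open>The summand 0 gives the argument the affine form expected by the substitution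
    rules.\<close>
  have eq: "(1 - cos (t * k)) / k\<^sup>2 = t\<^sup>2 * ((1 - cos (0 + t * k)) / (0 + t * k)\<^sup>2)" for k
    by (cases "t = 0") (auto simp: power_mult_distrib)
  show "integrable lborel (\<lambda>k :: real. (1 - cos (t * k)) / k\<^sup>2)"
  proof (cases "t = 0")
    case False
    show ?thesis
      unfolding eq by (intro integrable_mult_right lborel_integrable_real_affine integrable_one_minus_cos False)
  qed simp
  show "(LINT k|lborel. (1 - cos (t * k)) / k\<^sup>2) = \<bar>t\<bar> * sinc_energy"
  proof (cases "t = 0")
    case False
    have "sinc_energy = \<bar>t\<bar> * (LINT k|lborel. (1 - cos (0 + t * k)) / (0 + t * k)\<^sup>2)"
      unfolding sinc_energy_def using lborel_integral_real_affine[OF False, of "\<lambda>k. (1 - cos k) / k\<^sup>2" 0] by simp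
    from arg_cong[OF this, of "\<lambda>y. \<bar>t\<bar> * y"]
    have "\<bar>t\<bar> * sinc_energy = t\<^sup>2 * (LINT k|lborel. (1 - cos (0 + t * k)) / (0 + t * k)\<^sup>2)"
      by (simp only: mult.assoc[symmetric] abs_mult_self_eq power2_eq_square)
    then show ?thesis by (simp only: eq integral_mult_right_zero)
  qed simp
qed

text \<open>Chosen so that two transformed steps lie at squared distance
  \<open>\<bar>s - t\<bar>\<close>. With \<open>sinc_energy\<close> equal to \<open>pi\<close> it is
  the usual \<open>1 / sqrt (2 * pi)\<close>.\<close>

definition fourier_norm :: real where
  "fourier_norm = 1 / sqrt (2 * sinc_energy)"

lemma fourier_norm_pos: "fourier_norm > 0"
  using sinc_energy_pos by (simp add: fourier_norm_def)

lemma fourier_norm_square: "fourier_norm\<^sup>2 * (2 * sinc_energy) = 1"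
  using sinc_energy_pos by (simp add: fourier_norm_def power_divide)

definition fourier_step :: "real \<Rightarrow> real \<Rightarrow> real \<Rightarrow> complex" where
  "fourier_step \<sigma> t k = of_real fourier_norm * fourier \<sigma> (signed_indicator t) k"

lemma measurable_fourier_step [measurable]: "fourier_step \<sigma> t \<in> borel_measurable borel"
  unfolding fourier_step_def[abs_def] by measurable

lemma fourier_step_zero: "fourier_step \<sigma> 0 k = 0"
  by (simp add: fourier_step_def fourier_def)

lemma fourier_step_energy:
  assumes "\<sigma> \<in> {1, -1}"
  shows "integrable lborel (\<lambda>k. (cmod (fourier_step \<sigma> s k - fourier_step \<sigma> t k))\<^sup>2)"
    and "(LINT k|lborel. (cmod (fourier_step \<sigma> s k - fourier_step \<sigma> t k))\<^sup>2) = \<bar>s - t\<bar>"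
proof -
  have AE: "AE k in lborel. fourier_norm\<^sup>2 * (2 * ((1 - cos ((s - t) * k)) / k\<^sup>2)) =
      (cmod (fourier_step \<sigma> s k - fourier_step \<sigma> t k))\<^sup>2"
    using AE_lborel_singleton[of 0]
  proof eventually_elim
    case (elim k)
    show ?case
      using cmod_fourier_signed_indicator_diff[OF assms elim, of s t]
      by (simp add: fourier_step_def norm_mult power_mult_distrib flip: right_diff_distrib)
  qed
  have int: "integrable lborel (\<lambda>k. fourier_norm\<^sup>2 * (2 * ((1 - cos ((s - t) * k)) / k\<^sup>2)))"
    by (intro integrable_mult_right one_minus_cos_scaled)
  show "integrable lborel (\<lambda>k. (cmod (fourier_step \<sigma> s k - fourier_step \<sigma> t k))\<^sup>2)"
    by (rule integrable_cong_AE_imp[OF int]) (use AE in \<open>auto elim: eventually_mono\<close>)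
  have "(LINT k|lborel. (cmod (fourier_step \<sigma> s k - fourier_step \<sigma> t k))\<^sup>2)
      = (LINT k|lborel. fourier_norm\<^sup>2 * (2 * ((1 - cos ((s - t) * k)) / k\<^sup>2)))"
    by (rule integral_cong_AE) (use AE in \<open>auto elim: eventually_mono\<close>)
  also have "\<dots> = fourier_norm\<^sup>2 * (2 * sinc_energy) * \<bar>s - t\<bar>"
    by (simp only: integral_mult_right_zero one_minus_cos_scaled) simp
  finally show "(LINT k|lborel. (cmod (fourier_step \<sigma> s k - fourier_step \<sigma> t k))\<^sup>2) = \<bar>s - t\<bar>"
    by (simp only: fourier_norm_square) simp
qed

lemma square_integrable_fourier_step:
  assumes "\<sigma> \<in> {1, -1}"
  shows "square_integrable (fourier_step \<sigma> t)"
  using fourier_step_energy(1)[OF assms, of t 0] by (simp add: square_integrable_def fourier_step_zero)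

text \<open>Distances, including those to the zero step, determine the real part by polarization.
  Both imaginary parts vanish: the steps are real, and the transform of a real function is
  conjugated by \<open>k \<mapsto> - k\<close>, so the integral on the transformed side equals its
  own conjugate.\<close>

lemma cinner_fourier_step:
  assumes "\<sigma> \<in> {1, -1}"
  shows "cinner (step s) (step t) = cinner (L2_class (fourier_step \<sigma> s)) (L2_class (fourier_step \<sigma> t))"
proof -
  let ?v = "\<lambda>t. L2_class (fourier_step \<sigma> t)"
  have polar: "inner a b = ((norm a)\<^sup>2 + (norm b)\<^sup>2 - (norm (a - b))\<^sup>2) / 2" for a b :: l2
    by (simp add: power2_norm_eq_inner inner_diff_left inner_diff_right inner_commute)
  note si = square_integrable_fourier_step[OF assms]
  have v: "(norm (?v s - ?v t))\<^sup>2 = \<bar>s - t\<bar>" for s t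
    by (simp add: L2_class_diff si norm_L2_class square_integrable_diff fourier_step_energy(2)[OF assms])
  have zero: "?v 0 = 0" "step 0 = 0"
    using fourier_step_zero[of \<sigma>, abs_def] signed_indicator_zero[abs_def]
    by (simp_all add: step_def L2_class_zero)
  have "inner (?v s) (?v t) = inner (step s) (step t)"
    using v[of s 0] v[of t 0] norm_step_diff[of s 0] norm_step_diff[of t 0]
    unfolding polar by (simp add: zero v norm_step_diff)
  moreover have "Im (cinner (step s) (step t)) = 0"
  proof -
    have "cnj (cinner (step s) (step t)) = cinner (step s) (step t)"
      by (simp add: step_def cinner_L2_class square_integrable_signed_indicator flip: Bochner_Integration.integral_cnj)
    then show ?thesis by (simp add: complex_eq_iff)
  qed
  moreover have "Im (cinner (?v s) (?v t)) = 0"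
  proof -
    define g where "g k = cnj (fourier_step \<sigma> s k) * fourier_step \<sigma> t k" for k
    have refl: "g (0 + (-1) * k) = cnj (g k)" for k
      by (simp add: g_def fourier_step_def cnj_fourier) (simp add: fourier_def)
    have "cinner (?v s) (?v t) = (LINT k|lborel. g k)"
      by (simp add: cinner_L2_class si g_def)
    also have "\<dots> = (LINT k|lborel. g (0 + (-1) * k))"
      using lborel_integral_real_affine[of "-1" g 0] by simp
    also have "\<dots> = cnj (LINT k|lborel. g k)"
      by (simp only: refl Bochner_Integration.integral_cnj)
    also have "(LINT k|lborel. g k) = cinner (?v s) (?v t)"
      by (simp add: cinner_L2_class si g_def)
    finally show ?thesis by (simp add: complex_eq_iff)
  qed
  ultimately show ?thesis by (simp add: complex_eq_iff inner_l2_def)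
qed

lemma bounded_linear_cinner_right: "bounded_linear (\<lambda>\<psi>. cinner \<phi> \<psi>)"
  by (rule bounded_linear_intro[where K = "norm \<phi>"])
     (use cmod_cinner_le[of \<phi>] in \<open>simp_all add: cinner_add_right scaleR_l2_def cinner_scaleC_right scaleR_conv_of_real mult.commute\<close>)

text \<open>The set of agreement is a closed subspace. The functionals are only real-linear, hence
  agreement is required at all complex multiples of steps.\<close>

lemma functional_eq_on_steps:
  fixes f g :: "l2 \<Rightarrow> complex"
  assumes f: "bounded_linear f" and g: "bounded_linear g"
    and eq: "\<And>c t. f (c *\<^sub>C step t) = g (c *\<^sub>C step t)"
  shows "f \<psi> = g \<psi>"
proof -
  interpret f: bounded_linear f by fact
  interpret g: bounded_linear g by fact
  have "{\<psi>. f \<psi> = g \<psi>} = UNIV"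
  proof (rule step_total)
    show "closed {\<psi>. f \<psi> = g \<psi>}"
      by (intro closed_Collect_eq f.continuous_on g.continuous_on continuous_on_id)
    show "subspace {\<psi>. f \<psi> = g \<psi>}"
      by (auto simp: subspace_def f.add g.add f.scaleR g.scaleR f.zero g.zero)
  qed (simp add: eq)
  then show ?thesis by auto
qed

lemma cinner_step_ext:
  assumes "\<And>t. cinner \<phi> (step t) = cinner \<psi> (step t)"
  shows "\<phi> = \<psi>"
proof (rule cinner_ext)
  fix \<xi>
  have "cinner \<phi> \<xi> = cinner \<psi> \<xi>"
    by (rule functional_eq_on_steps[OF bounded_linear_cinner_right bounded_linear_cinner_right])
       (simp add: cinner_scaleC_right assms)
  then show "cinner \<xi> \<phi> = cinner \<xi> \<psi>" by (metis cinner_cnj)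
qed

text \<open>Fubini's theorem with a kernel symmetric in \<open>k\<close> and \<open>x\<close>. It
  supplies both the adjoint of the transform and its integral formula.\<close>

lemma fourier_mult:
  assumes f: "integrable lborel f" and g: "integrable lborel g"
  shows "(LINT k|lborel. fourier \<sigma> f k * g k) = (LINT x|lborel. f x * fourier \<sigma> g x)"
proof -
  have [measurable]: "f \<in> borel_measurable borel" "g \<in> borel_measurable borel"
    using f g by auto
  have "integrable (lborel \<Otimes>\<^sub>M lborel) (\<lambda>(x, k). cis (- (\<sigma> * k * x)) * f x * g k)"
  proof (rule lborel_pair.Fubini_integrable)
    show "integrable lborel (\<lambda>x. LINT k|lborel. norm (case (x, k) of (x, k) \<Rightarrow> cis (- (\<sigma> * k * x)) * f x * g k))"
      using f by (simp add: norm_mult)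
    show "AE x in lborel. integrable lborel (\<lambda>k. case (x, k) of (x, k) \<Rightarrow> cis (- (\<sigma> * k * x)) * f x * g k)"
    proof (rule AE_I2)
      fix x
      have "integrable lborel (\<lambda>k. f x * g k)" using g by simp
      then have "integrable lborel (\<lambda>k. cis (- (\<sigma> * k * x)) * f x * g k)"
        by (rule Bochner_Integration.integrable_bound) (auto simp: norm_mult)
      then show "integrable lborel (\<lambda>k. case (x, k) of (x, k) \<Rightarrow> cis (- (\<sigma> * k * x)) * f x * g k)" by simp
    qed
  qed (unfold case_prod_beta, measurable)
  from lborel_pair.Fubini_integral[OF this]
  have "(LINT k|lborel. LINT x|lborel. cis (- (\<sigma> * k * x)) * f x * g k)
      = (LINT x|lborel. LINT k|lborel. cis (- (\<sigma> * k * x)) * f x * g k)" .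
  moreover have "(LINT x|lborel. cis (- (\<sigma> * k * x)) * f x * g k) = fourier \<sigma> f k * g k" for k
    by (simp add: fourier_def)
  moreover have "(LINT k|lborel. cis (- (\<sigma> * k * x)) * f x * g k) = f x * fourier \<sigma> g x" for x
    by (simp add: fourier_def mult_ac flip: integral_mult_right_zero)
  ultimately show ?thesis by (simp only:)
qed

section \<open>The unitary Fourier transform\<close>

definition L2_fourier :: "real \<Rightarrow> l2 \<Rightarrow> l2" where
  "L2_fourier \<sigma> = (SOME F. bounded_clinear F \<and> (\<forall>t. F (step t) = L2_class (fourier_step \<sigma> t)) \<and>
     (\<forall>\<psi>. norm (F \<psi>) = norm \<psi>))"

lemma
  assumes "\<sigma> \<in> {1, -1}"
  shows bounded_clinear_L2_fourier: "bounded_clinear (L2_fourier \<sigma>)"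
    and L2_fourier_step: "L2_fourier \<sigma> (step t) = L2_class (fourier_step \<sigma> t)"
    and norm_L2_fourier: "norm (L2_fourier \<sigma> \<psi>) = norm \<psi>"
proof -
  let ?P = "\<lambda>F. bounded_clinear F \<and> (\<forall>t. F (step t) = L2_class (fourier_step \<sigma> t)) \<and> (\<forall>\<psi>. norm (F \<psi>) = norm \<psi>)"
  obtain F where "bounded_clinear F" "\<And>t. F (step t) = L2_class (fourier_step \<sigma> t)" "\<And>\<psi>. norm (F \<psi>) = norm \<psi>"
    using isometric_extension[of step "\<lambda>t. L2_class (fourier_step \<sigma> t)"] cinner_fourier_step[OF assms] step_total
    by blast
  then have "?P F" by blast
  then have "?P (L2_fourier \<sigma>)" unfolding L2_fourier_def by (rule someI[where P = ?P])
  then show "bounded_clinear (L2_fourier \<sigma>)" "L2_fourier \<sigma> (step t) = L2_class (fourier_step \<sigma> t)"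
    "norm (L2_fourier \<sigma> \<psi>) = norm \<psi>" by auto
qed

text \<open>On two steps this is the kernel symmetry, conjugation having changed the sign of
  \<open>\<sigma>\<close>. Totality of the steps then extends it to one argument after the
  other.\<close>

lemma L2_fourier_adjoint:
  assumes \<sigma>: "\<sigma> \<in> {1, -1}"
  shows "cinner (L2_fourier \<sigma> \<phi>) \<psi> = cinner \<phi> (L2_fourier (- \<sigma>) \<psi>)"
proof -
  have \<sigma>': "- \<sigma> \<in> {1, -1}" using \<sigma> by auto
  note lin = bounded_clinear_L2_fourier[OF \<sigma>] bounded_clinear_L2_fourier[OF \<sigma>']
  have "cinner (L2_fourier \<sigma> (step s)) (step t) = cinner (step s) (L2_fourier (- \<sigma>) (step t))" for s t
  proof -
    have "cinner (L2_fourier \<sigma> (step s)) (step t)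
        = (LINT k|lborel. of_real fourier_norm * (fourier (- \<sigma>) (signed_indicator s) k * signed_indicator t k))"
      unfolding L2_fourier_step[OF \<sigma>] unfolding step_def
      by (simp add: cinner_L2_class square_integrable_fourier_step[OF \<sigma>]
          square_integrable_signed_indicator fourier_step_def cnj_fourier mult.assoc)
    also have "\<dots> = (LINT x|lborel. of_real fourier_norm * (signed_indicator s x * fourier (- \<sigma>) (signed_indicator t) x))"
      by (simp add: fourier_mult[OF integrable_signed_indicator integrable_signed_indicator])
    also have "\<dots> = cinner (step s) (L2_fourier (- \<sigma>) (step t))"
      unfolding L2_fourier_step[OF \<sigma>'] unfolding step_def
      by (simp add: cinner_L2_class square_integrable_fourier_step[OF \<sigma>']
          square_integrable_signed_indicator fourier_step_def mult.left_commute)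
    finally show ?thesis .
  qed
  then have "cnj (cinner (L2_fourier \<sigma> (step s)) (step t)) = cnj (cinner (step s) (L2_fourier (- \<sigma>) (step t)))" for s t
    by simp
  then have steps: "cinner (step t) (L2_fourier \<sigma> (step s)) = cinner (L2_fourier (- \<sigma>) (step t)) (step s)" for s t
    by (simp add: cinner_cnj)
  have "cinner (step t) (L2_fourier \<sigma> \<phi>) = cinner (L2_fourier (- \<sigma>) (step t)) \<phi>" for t
  proof (rule functional_eq_on_steps)
    show "bounded_linear (\<lambda>\<phi>. cinner (step t) (L2_fourier \<sigma> \<phi>))"
      by (rule bounded_linear_compose[OF bounded_linear_cinner_right bounded_clinear_bounded_linear[OF lin(1)]])
    show "bounded_linear (cinner (L2_fourier (- \<sigma>) (step t)))" by (rule bounded_linear_cinner_right)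
  qed (simp add: bounded_clinear_scaleC[OF lin(1)] cinner_scaleC_right steps)
  then have "cnj (cinner (step t) (L2_fourier \<sigma> \<phi>)) = cnj (cinner (L2_fourier (- \<sigma>) (step t)) \<phi>)" for t
    by simp
  then have steps': "cinner (L2_fourier \<sigma> \<phi>) (step t) = cinner \<phi> (L2_fourier (- \<sigma>) (step t))" for t
    by (simp add: cinner_cnj)
  show ?thesis
  proof (rule functional_eq_on_steps[where f = "cinner (L2_fourier \<sigma> \<phi>)"])
    show "bounded_linear (\<lambda>\<psi>. cinner \<phi> (L2_fourier (- \<sigma>) \<psi>))"
      by (rule bounded_linear_compose[OF bounded_linear_cinner_right bounded_clinear_bounded_linear[OF lin(2)]])
  qed (simp_all add: bounded_linear_cinner_right bounded_clinear_scaleC[OF lin(2)] cinner_scaleC_right steps')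
qed

text \<open>The adjoint of an isometry is a left inverse. Since the adjoint is itself an isometry of
  the same family, exchanging the signs gives the other side, and the transform is unitary.\<close>

lemma L2_fourier_inverse:
  assumes \<sigma>: "\<sigma> \<in> {1, -1}"
  shows "L2_fourier (- \<sigma>) (L2_fourier \<sigma> \<psi>) = \<psi>"
proof -
  have \<sigma>': "- \<sigma> \<in> {1, -1}" using \<sigma> by auto
  have "(\<lambda>\<psi>. L2_fourier (- \<sigma>) (L2_fourier \<sigma> \<psi>)) = (\<lambda>\<psi>. \<psi>)"
  proof (rule clinear_eq_if_diagonal_eq)
    show "cinner \<psi> (L2_fourier (- \<sigma>) (L2_fourier \<sigma> \<psi>)) = cinner \<psi> \<psi>" for \<psi>
      by (simp add: cinner_self norm_L2_fourier[OF \<sigma>] flip: L2_fourier_adjoint[OF \<sigma>])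
  qed (rule bounded_clinear_compose[OF bounded_clinear_L2_fourier[OF \<sigma>'] bounded_clinear_L2_fourier[OF \<sigma>]],
      rule bounded_clinear_id)
  then show ?thesis by meson
qed

lemma unitary_pair_L2_fourier: "\<sigma> \<in> {1, -1} \<Longrightarrow> unitary_pair (L2_fourier \<sigma>) (L2_fourier (- \<sigma>))"
  using L2_fourier_inverse[of \<sigma>] L2_fourier_inverse[of "- \<sigma>"] bounded_clinear_L2_fourier[of \<sigma>]
    bounded_clinear_L2_fourier[of "- \<sigma>"] L2_fourier_adjoint[of \<sigma>]
  unfolding unitary_pair_def by auto

text \<open>The integral formula defines a function \<open>h\<close> that is at first only known to
  be bounded, so it is compared with the abstract transform on each \<open>I n\<close> separately,
  by testing against steps. The comparison then yields square-integrability of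
  \<open>h\<close>.\<close>

lemma L2_fourier_L2_class:
  assumes \<sigma>: "\<sigma> \<in> {1, -1}" and si: "square_integrable f" and int: "integrable lborel f"
  shows "square_integrable (\<lambda>k. of_real fourier_norm * fourier \<sigma> f k)"
    and "L2_fourier \<sigma> (L2_class f) = L2_class (\<lambda>k. of_real fourier_norm * fourier \<sigma> f k)"
proof -
  have \<sigma>': "- \<sigma> \<in> {1, -1}" using \<sigma> by auto
  have [measurable]: "f \<in> borel_measurable borel" using si by (rule square_integrable_measurable)
  define h where "h k = of_real fourier_norm * fourier \<sigma> f k" for k
  have [measurable]: "h \<in> borel_measurable borel" unfolding h_def[abs_def] by measurable
  define \<phi> where "\<phi> = L2_fourier \<sigma> (L2_class f)"
  define I where "I n = {- real n<..real n}" for n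
  have [measurable]: "I n \<in> sets borel" for n by (simp add: I_def)
  \<comment> \<open>A step cut to \<open>I n\<close> is again a step, with its endpoint clamped to
    that interval.\<close>
  define clamp where "clamp n t = max (- real n) (min (real n) t)" for n t
  have restrict: "indicator (I n) x * signed_indicator t x = signed_indicator (clamp n t) x" for n t x
    by (auto simp: I_def clamp_def signed_indicator_def indicator_def)
  have h_bound: "cmod (h k) \<le> fourier_norm * (LINT x|lborel. cmod (f x))" for k
    using fourier_bound[OF int, of \<sigma> k] fourier_norm_pos by (simp add: h_def norm_mult)
  have h_si: "square_integrable (\<lambda>k. indicator (I n) k * h k)" for n
  proof -
    have "square_integrable (indicator (I n))"
      by (rule square_integrable_indicator[of _ "- real n" "real n"]) (auto simp: I_def)
    from square_integrable_mult_bounded[OF this _ h_bound] show ?thesis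
      by (simp add: mult.commute)
  qed
  have "AE k in lborel. indicator (I n) k * Rep_l2 \<phi> k = indicator (I n) k * h k" for n
  proof -
    have "position_pvm (I n) \<phi> = L2_class (\<lambda>k. indicator (I n) k * h k)"
    proof (rule cinner_step_ext)
      fix t
      have "cinner (position_pvm (I n) \<phi>) (step t) = cinner \<phi> (position_pvm (I n) (step t))"
        by (rule orthogonal_projectionD(3)[OF orthogonal_projection_position_pvm]) measurable
      also have "position_pvm (I n) (step t) = step (clamp n t)"
        by (simp add: step_def position_pvm_L2_class square_integrable_signed_indicator restrict)
      also have "cinner \<phi> (step (clamp n t)) = cinner (L2_class f) (L2_class (fourier_step (- \<sigma>) (clamp n t)))"
        by (simp add: \<phi>_def L2_fourier_adjoint[OF \<sigma>] L2_fourier_step[OF \<sigma>'])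
      also have "\<dots> = (LINT x|lborel. of_real fourier_norm * (cnj (f x) * fourier (- \<sigma>) (signed_indicator (clamp n t)) x))"
        by (simp add: cinner_L2_class si square_integrable_fourier_step[OF \<sigma>'] fourier_step_def mult.left_commute)
      also have "\<dots> = (LINT k|lborel. of_real fourier_norm * (fourier (- \<sigma>) (\<lambda>x. cnj (f x)) k * signed_indicator (clamp n t) k))"
        using int by (simp add: fourier_mult[OF _ integrable_signed_indicator])
      also have "\<dots> = (LINT k|lborel. cnj (indicator (I n) k * h k) * signed_indicator t k)"
        by (intro Bochner_Integration.integral_cong refl)
           (simp add: h_def cnj_fourier flip: restrict, simp add: indicator_def)
      also have "\<dots> = cinner (L2_class (\<lambda>k. indicator (I n) k * h k)) (step t)"
        by (simp add: step_def cinner_L2_class h_si square_integrable_signed_indicator)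
      finally show "cinner (position_pvm (I n) \<phi>) (step t) = cinner (L2_class (\<lambda>k. indicator (I n) k * h k)) (step t)" .
    qed
    then have "AE k in lborel. Rep_l2 (position_pvm (I n) \<phi>) k = indicator (I n) k * h k"
      using Rep_L2_class[OF h_si[of n]] by simp
    moreover have "AE k in lborel. Rep_l2 (position_pvm (I n) \<phi>) k = indicator (I n) k * Rep_l2 \<phi> k"
      by (rule Rep_position_pvm) measurable
    ultimately show ?thesis by eventually_elim simp
  qed
  then have "AE k in lborel. \<forall>n. indicator (I n) k * Rep_l2 \<phi> k = indicator (I n) k * h k"
    unfolding AE_all_countable by blast
  then have AE: "AE k in lborel. Rep_l2 \<phi> k = h k"
  proof eventually_elim
    case (elim k)
    obtain n where "\<bar>k\<bar> < real n" using reals_Archimedean2 by blast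
    with elim[rule_format, of n] show ?case by (auto simp: I_def indicator_def split: if_splits)
  qed
  then have h: "square_integrable h"
    by (intro square_integrable_cong_AE[OF square_integrable_Rep]) auto
  then show "square_integrable (\<lambda>k. of_real fourier_norm * fourier \<sigma> f k)"
    by (simp add: h_def[abs_def])
  have "\<phi> = L2_class h" using AE h by (metis L2_class_Rep L2_class_eq_iff square_integrable_Rep)
  then show "L2_fourier \<sigma> (L2_class f) = L2_class (\<lambda>k. of_real fourier_norm * fourier \<sigma> f k)"
    by (simp add: h_def[abs_def] \<phi>_def)
qed

section \<open>The momentum operator\<close>

text \<open>With \<open>w = 1 + x^2\<close>, the bound
  \<open>\<bar>p\<bar> \<le> w * \<bar>p\<bar>^2 + 1 / w\<close> holds pointwise by completing a
  square, and each term on the right is integrable.\<close>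

lemma integrable_if_position_integrable:
  assumes p: "square_integrable p" and xp: "square_integrable (\<lambda>x. of_real x * p x)"
  shows "integrable lborel p"
proof (rule Bochner_Integration.integrable_bound)
  have [measurable]: "p \<in> borel_measurable borel" using p by (rule square_integrable_measurable)
  show "integrable lborel (\<lambda>x. (cmod (p x))\<^sup>2 + (cmod (of_real x * p x))\<^sup>2 + inverse (1 + x\<^sup>2))"
    using p xp integrable_inverse_1_plus_square
    by (intro Bochner_Integration.integrable_add) (auto simp: square_integrable_def set_integrable_def)
  show "p \<in> borel_measurable lborel" by measurable
  show "AE x in lborel. norm (p x) \<le> norm ((cmod (p x))\<^sup>2 + (cmod (of_real x * p x))\<^sup>2 + inverse (1 + x\<^sup>2))"
  proof (rule AE_I2)
    fix x :: real
    define w where "w = 1 + x\<^sup>2"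
    have w: "w > 0" using zero_le_power2[of x] unfolding w_def by linarith
    have "2 * (w * cmod (p x)) \<le> (w * cmod (p x))\<^sup>2 + 1"
      using zero_le_power2[of "w * cmod (p x) - 1"] by (simp add: power2_diff)
    moreover have "0 \<le> w * cmod (p x)" using w by simp
    ultimately have "w * cmod (p x) \<le> (w * cmod (p x))\<^sup>2 + 1" by linarith
    also have "\<dots> = w * (w * (cmod (p x))\<^sup>2 + inverse w)"
      using w by (simp add: distrib_left power2_eq_square mult_ac)
    finally have "w * cmod (p x) \<le> w * (w * (cmod (p x))\<^sup>2 + inverse w)" .
    then have "cmod (p x) \<le> w * (cmod (p x))\<^sup>2 + inverse w"
      using w by (simp only: mult_le_cancel_left_pos)
    also have "\<dots> = (cmod (p x))\<^sup>2 + (cmod (of_real x * p x))\<^sup>2 + inverse (1 + x\<^sup>2)"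
      by (simp add: w_def norm_mult power_mult_distrib algebra_simps)
    finally show "norm (p x) \<le> norm ((cmod (p x))\<^sup>2 + (cmod (of_real x * p x))\<^sup>2 + inverse (1 + x\<^sup>2))"
      by simp
  qed
qed

text \<open>The absolutely continuous solutions of \<open>w' = - w\<close> are the multiples of \<open>exp (- x)\<close>,
  which are not square-integrable.\<close>

lemma square_integrable_decay_zero:
  assumes w: "square_integrable w"
    and eq: "\<And>a b. a \<le> b \<Longrightarrow> w b - w a = (LINT x:{a..b}|lborel. - w x)"
  shows "w x = 0"
proof -
  have [measurable]: "w \<in> borel_measurable borel" using w by (rule square_integrable_measurable)
  have set_int: "set_integrable lborel {a..b} (\<lambda>x. - w x)" for a b
    unfolding set_integrable_def
  proof (rule Bochner_Integration.integrable_bound)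
    show "integrable lborel (\<lambda>x. indicator {a..b} x + (cmod (w x))\<^sup>2)"
      using w by (intro Bochner_Integration.integrable_add) (auto simp: square_integrable_def emeasure_lborel_Icc_eq)
    show "AE x in lborel. norm (indicator {a..b} x *\<^sub>R - w x) \<le> norm (indicator {a..b} x + (cmod (w x))\<^sup>2)"
    proof (rule AE_I2)
      fix x
      have "cmod (w x) \<le> 1 + (cmod (w x))\<^sup>2"
        using zero_le_power2[of "cmod (w x) - 1"] by (simp add: power2_diff) (use norm_ge_zero[of "w x"] in linarith)
      then show "norm (indicator {a..b} x *\<^sub>R - w x) \<le> norm (indicator {a..b} x + (cmod (w x))\<^sup>2)"
        by (auto simp: indicator_def)
    qed
  qed measurable
  have exp_form: "w x = w 0 * exp (- of_real x)" for x
  proof -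
    define R where "R = \<bar>x\<bar> + 1"
    \<comment> \<open>A bootstrap: the integral equation makes \<open>w\<close> continuous, so its
      integrand is continuous and \<open>w\<close> is differentiable.\<close>
    have wu: "w u = w (- R) + integral {- R..u} (\<lambda>x. - w x)" if "u \<in> {- R..R}" for u
      using eq[of "- R" u] that set_borel_integral_eq_integral(2)[OF set_int, of "- R" u] by (simp add: algebra_simps)
    have "continuous_on {- R..R} (\<lambda>u. w (- R) + integral {- R..u} (\<lambda>x. - w x))"
      by (intro continuous_intros indefinite_integral_continuous_1 set_borel_integral_eq_integral(1) set_int)
    then have cont: "continuous_on {- R..R} w"
      by (rule continuous_on_eq) (rule wu[symmetric])
    have deriv: "(w has_vector_derivative - w u) (at u within {- R..R})" if u: "u \<in> {- R..R}" for u
    proof (rule has_vector_derivative_transform[OF u])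
      show "w u = w (- R) + integral {- R..u} (\<lambda>x. - w x)" if "u \<in> {- R..R}" for u by (rule wu[OF that])
      have "((\<lambda>u. integral {- R..u} (\<lambda>x. - w x)) has_vector_derivative - w u) (at u within {- R..R})"
        by (rule integral_has_vector_derivative[OF _ u]) (intro continuous_intros cont)
      from has_vector_derivative_add[OF has_vector_derivative_const this]
      show "((\<lambda>u. w (- R) + integral {- R..u} (\<lambda>x. - w x)) has_vector_derivative - w u) (at u within {- R..R})"
        by simp
    qed
    have exp_deriv: "((\<lambda>u. exp (complex_of_real u)) has_vector_derivative exp (of_real u)) (at u within A)" for u A
      by (rule has_vector_derivative_real_field) (auto intro!: derivative_eq_intros)
    have "((\<lambda>u. w u * exp (of_real u)) has_vector_derivative 0) (at u within {- R..R})" if u: "u \<in> {- R..R}" for u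
      using has_vector_derivative_mult[OF deriv[OF u] exp_deriv[of u "{- R..R}"]] by simp
    then obtain c where c: "\<And>u. u \<in> {- R..R} \<Longrightarrow> w u * exp (of_real u) = c"
      using has_vector_derivative_zero_constant[of "{- R..R}" "\<lambda>u. w u * exp (of_real u)"] by auto
    have "x \<in> {- R..R}" "0 \<in> {- R..R}" by (auto simp: R_def)
    from c[OF this(1)] c[OF this(2)] have "w x * exp (of_real x) = w 0" by simp
    then show ?thesis by (simp add: exp_minus field_simps)
  qed
  have "w 0 = 0"
  proof (rule ccontr)
    assume "w 0 \<noteq> 0"
    define M where "M = (LINT x|lborel. (cmod (w x))\<^sup>2)"
    \<comment> \<open>On the negative half-line the modulus of \<open>w\<close> is at least that at
      0.\<close>
    have bound: "R * (cmod (w 0))\<^sup>2 \<le> M" if "0 \<le> R" for R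
    proof -
      have "(LINT x|lborel. indicator {- R..0} x * (cmod (w 0))\<^sup>2) \<le> M"
        unfolding M_def
      proof (rule integral_mono)
        show "integrable lborel (\<lambda>x. (cmod (w x))\<^sup>2)" using w by (simp add: square_integrable_def)
        fix x
        have "(cmod (w 0))\<^sup>2 \<le> (cmod (w x))\<^sup>2" if "x \<le> 0"
          unfolding exp_form[of x] using that
          by (auto simp: norm_mult intro!: power_mono mult_le_cancel_left1[THEN iffD2])
        then show "indicator {- R..0} x * (cmod (w 0))\<^sup>2 \<le> (cmod (w x))\<^sup>2"
          by (auto simp: indicator_def)
      qed (simp add: emeasure_lborel_Icc_eq)
      then show ?thesis using that by simp
    qed
    have "0 \<le> M" using bound[of 0] by simp
    then have "(M + 1) \<le> M"
      using bound[of "(M + 1) / (cmod (w 0))\<^sup>2"] \<open>w 0 \<noteq> 0\<close> by simp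
    then show False by simp
  qed
  then show ?thesis using exp_form[of x] by simp
qed

text \<open>The integral of the transform of \<open>\<xi>\<close> over an interval is its pairing
  with \<open>step b - step a\<close>, which the adjoint moves to the other side. There the factor
  \<open>k\<close> from position cancels the denominator in the transformed steps and leaves the
  difference of exponentials that defines \<open>f b - f a\<close>.\<close>

lemma momentum_op_L2_fourier:
  assumes "(\<phi>, \<xi>) \<in> position_op"
  shows "(L2_fourier (- 1) \<phi>, L2_fourier (- 1) \<xi>) \<in> momentum_op"
proof -
  obtain p q where pq: "\<phi> = L2_class p" "\<xi> = L2_class q" "square_integrable p" "square_integrable q"
    and q: "\<And>x. q x = of_real x * p x"
    using assms by (auto simp: position_op_def)
  have xp: "square_integrable (\<lambda>x. of_real x * p x)" using pq(4) by (simp add: q[abs_def])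
  have p_int: "integrable lborel p" by (rule integrable_if_position_integrable[OF pq(3) xp])
  have [measurable]: "p \<in> borel_measurable borel" "q \<in> borel_measurable borel"
    using pq by (auto intro: square_integrable_measurable)
  define f where "f x = of_real fourier_norm * fourier (- 1) p x" for x
  have f: "square_integrable f" "L2_fourier (- 1) \<phi> = L2_class f"
    using L2_fourier_L2_class[of "- 1", OF _ pq(3) p_int] by (auto simp: f_def[abs_def] pq(1))
  define g where "g = Rep_l2 (L2_fourier (- 1) \<xi>)"
  have g: "square_integrable g" "L2_fourier (- 1) \<xi> = L2_class g" by (auto simp: g_def square_integrable_Rep)
  then have [measurable]: "g \<in> borel_measurable borel" by (auto intro: square_integrable_measurable)
  have "f b - f a = (LINT x:{a..b}|lborel. \<i> * g x)" if "a \<le> b" for a b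
  proof -
    have "(LINT x:{a..b}|lborel. \<i> * g x) = (LINT x|lborel. \<i> * (cnj (indicator {a<..b} x) * g x))"
      unfolding set_lebesgue_integral_def
    proof (rule integral_cong_AE)
      show "AE x in lborel. indicator {a..b} x *\<^sub>R (\<i> * g x) = \<i> * (cnj (indicator {a<..b} x) * g x)"
        \<comment> \<open>The momentum operator is defined with closed intervals, steps with
          half-open ones; they differ in the null set \<open>{a}\<close>.\<close>
        using AE_lborel_singleton[of a] by eventually_elim (auto simp: indicator_def)
    qed measurable
    also have "\<dots> = \<i> * cinner (step b - step a) (L2_fourier (- 1) \<xi>)"
      using that g square_integrable_indicator[of "{a<..b}" a b]
      by (simp add: step_diff cinner_L2_class greaterThanAtMost_subseteq_atLeastAtMost_iff)
    also have "cinner (step b - step a) (L2_fourier (- 1) \<xi>) = cinner (L2_fourier 1 (step b - step a)) \<xi>"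
      by (simp add: L2_fourier_adjoint)
    also have "L2_fourier 1 (step b - step a) = L2_class (\<lambda>k. fourier_step 1 b k - fourier_step 1 a k)"
      by (simp add: bounded_clinear_diff[OF bounded_clinear_L2_fourier] L2_fourier_step L2_class_diff square_integrable_fourier_step)
    also have "cinner \<dots> \<xi> = (LINT k|lborel. cnj (fourier_step 1 b k - fourier_step 1 a k) * q k)"
      by (simp add: pq cinner_L2_class square_integrable_diff square_integrable_fourier_step)
    also have "\<i> * \<dots> = (LINT k|lborel. \<i> * (cnj (fourier_step 1 b k - fourier_step 1 a k) * q k))"
      by simp
    also have "\<dots> = (LINT k|lborel. of_real fourier_norm * (cis (k * b) * p k) - of_real fourier_norm * (cis (k * a) * p k))"
    proof (rule integral_cong_AE)
      show "AE k in lborel. \<i> * (cnj (fourier_step 1 b k - fourier_step 1 a k) * q k)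
          = of_real fourier_norm * (cis (k * b) * p k) - of_real fourier_norm * (cis (k * a) * p k)"
        using AE_lborel_singleton[of 0]
      proof eventually_elim
        case (elim k)
        then show ?case
          by (simp add: fourier_step_def fourier_signed_indicator q cis_cnj field_simps)
      qed
    qed measurable
    also have "\<dots> = f b - f a"
    proof -
      have int: "integrable lborel (\<lambda>k. cis (k * t) * p k)" for t
        by (rule Bochner_Integration.integrable_bound[OF p_int]) (auto simp: norm_mult)
      have "f t = of_real fourier_norm * (LINT k|lborel. cis (k * t) * p k)" for t
        by (simp add: f_def fourier_def mult.commute[of t])
      then show ?thesis
        by (subst Bochner_Integration.integral_diff) (simp_all add: int)
    qed
    finally show ?thesis by simp
  qed
  then show ?thesis using f g unfolding momentum_op_def by blast
qed

text \<open>The momentum operator extends the transported position operator \<open>T\<close>. Since \<open>T - \<i>\<close> is onto and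
  the momentum operator minus \<open>\<i>\<close> is injective, the two agree.\<close>

lemma momentum_op_eq: "momentum_op = map_prod (L2_fourier (- 1)) (L2_fourier (- 1)) ` position_op"
proof (intro set_eqI iffI)
  fix z assume "z \<in> map_prod (L2_fourier (- 1)) (L2_fourier (- 1)) ` position_op"
  then show "z \<in> momentum_op" using momentum_op_L2_fourier by auto
next
  let ?G = "L2_fourier (- 1)"
  note G = bounded_clinear_L2_fourier[of "- 1", simplified]
  fix z assume "z \<in> momentum_op"
  then obtain f g where z: "z = (L2_class f, L2_class g)" and f: "square_integrable f" and g: "square_integrable g"
    and FTC: "\<And>a b. a \<le> b \<Longrightarrow> f b - f a = (LINT x:{a..b}|lborel. \<i> * g x)"
    unfolding momentum_op_def by blast
  \<comment> \<open>\<open>h\<close> is the right-hand side of the resolvent equation on the Fourier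
    side; dividing by \<open>x - \<i>\<close>, which has modulus at least 1, gives a domain vector
    \<open>p\<close> of position.\<close>
  define h where "h = Rep_l2 (L2_fourier 1 (L2_class g - \<i> *\<^sub>C L2_class f))"
  have h: "square_integrable h" "?G (L2_class h) = L2_class g - \<i> *\<^sub>C L2_class f"
    using L2_fourier_inverse[of 1] by (auto simp: h_def square_integrable_Rep)
  have [measurable]: "h \<in> borel_measurable borel" using h by (auto intro: square_integrable_measurable)
  have ne: "complex_of_real x - \<i> \<noteq> 0" for x by (auto simp: complex_eq_iff)
  define m where "m x = 1 / (complex_of_real x - \<i>)" for x
  have [measurable]: "m \<in> borel_measurable borel" by (simp add: m_def[abs_def])
  have norm_ne: "cmod (complex_of_real x - \<i>) = sqrt (x\<^sup>2 + 1)" for x by (simp add: cmod_def)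
  have m: "cmod (m x) \<le> 1" "cmod (of_real x * m x) \<le> 1" for x
    using add_nonneg_pos[OF zero_le_power2[of x] zero_less_one]
    by (auto simp: m_def norm_mult norm_divide norm_ne divide_le_eq_1 real_le_rsqrt)
  define p where "p x = m x * h x" for x
  have p: "square_integrable p" "square_integrable (\<lambda>x. of_real x * p x)"
    using square_integrable_mult_bounded[OF h(1) _ m(1)] square_integrable_mult_bounded[OF h(1) _ m(2)]
    by (simp_all add: p_def[abs_def] mult.assoc)
  have pos: "(L2_class p, L2_class (\<lambda>x. of_real x * p x)) \<in> position_op"
    using p unfolding position_op_def by blast
  from momentum_op_L2_fourier[OF pos] obtain f' g' where
    f': "?G (L2_class p) = L2_class f'" "square_integrable f'"
    and g': "?G (L2_class (\<lambda>x. of_real x * p x)) = L2_class g'" "square_integrable g'"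
    and FTC': "\<And>a b. a \<le> b \<Longrightarrow> f' b - f' a = (LINT x:{a..b}|lborel. \<i> * g' x)"
    unfolding momentum_op_def by blast
  have [measurable]: "f \<in> borel_measurable borel" "g \<in> borel_measurable borel"
    "f' \<in> borel_measurable borel" "g' \<in> borel_measurable borel"
    using f g f' g' by (auto intro: square_integrable_measurable)
  have "of_real x * p x - \<i> * p x = h x" for x
  proof -
    have "of_real x * p x - \<i> * p x = (complex_of_real x - \<i>) * m x * h x"
      by (simp add: p_def algebra_simps)
    then show ?thesis using ne[of x] by (simp add: m_def)
  qed
  then have "L2_class (\<lambda>x. of_real x * p x) - \<i> *\<^sub>C L2_class p = L2_class h"
    using p by (simp add: L2_class_scaleC L2_class_diff square_integrable_cmult)
  then have "L2_class g' - \<i> *\<^sub>C L2_class f' = L2_class g - \<i> *\<^sub>C L2_class f"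
    using h(2) f' g' by (metis G bounded_clinear_diff bounded_clinear_scaleC)
  then have "L2_class (\<lambda>x. g' x - \<i> * f' x) = L2_class (\<lambda>x. g x - \<i> * f x)"
    using f g f' g' by (simp add: L2_class_scaleC L2_class_diff square_integrable_cmult)
  then have AE: "AE x in lborel. g' x - \<i> * f' x = g x - \<i> * f x"
    using f g f' g' by (subst (asm) L2_class_eq_iff) (auto intro: square_integrable_diff square_integrable_cmult)
  \<comment> \<open>Pairing with the indicator shows that a square-integrable function is integrable
    on bounded intervals.\<close>
  have set_int: "set_integrable lborel {a..b} (\<lambda>x. \<i> * u x)" if u: "square_integrable u" for u a b
    using square_integrable_cnj_mult[OF square_integrable_indicator[of "{a..b}" a b] square_integrable_cmult[OF u, of \<i>]]
    by (simp add: set_integrable_def scaleR_conv_of_real) (simp add: indicator_def if_distrib of_bool_def cong: if_cong)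
  \<comment> \<open>The difference lies in the kernel of the momentum operator minus
    \<open>\<i>\<close>, an equation that reads \<open>w' = - w\<close>.\<close>
  have w: "f x - f' x = 0" for x
  proof (rule square_integrable_decay_zero)
    show "square_integrable (\<lambda>x. f x - f' x)" by (rule square_integrable_diff[OF f f'(2)])
    fix a b :: real assume "a \<le> b"
    have "(f b - f' b) - (f a - f' a) = (LINT x:{a..b}|lborel. \<i> * g x) - (LINT x:{a..b}|lborel. \<i> * g' x)"
      using FTC[OF \<open>a \<le> b\<close>] FTC'[OF \<open>a \<le> b\<close>] by (simp add: algebra_simps)
    also have "\<dots> = (LINT x:{a..b}|lborel. \<i> * g x - \<i> * g' x)"
      by (rule set_integral_diff(2)[symmetric]) (intro set_int g g')+
    also have "\<dots> = (LINT x:{a..b}|lborel. - (f x - f' x))"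
      unfolding set_lebesgue_integral_def
    proof (rule integral_cong_AE)
      show "AE x in lborel. indicator {a..b} x *\<^sub>R (\<i> * g x - \<i> * g' x) = indicator {a..b} x *\<^sub>R - (f x - f' x)"
        using AE
      proof eventually_elim
        case (elim x)
        then have "g x - g' x = \<i> * (f x - f' x)" by (simp add: algebra_simps)
        then have "\<i> * (g x - g' x) = \<i> * (\<i> * (f x - f' x))" by (simp only:)
        then have "\<i> * (g x - g' x) = - (f x - f' x)" by (simp only: complex_i_mult_minus)
        then show ?case by (simp only: right_diff_distrib)
      qed
    qed measurable
    finally show "(f b - f' b) - (f a - f' a) = (LINT x:{a..b}|lborel. - (f x - f' x))" .
  qed
  then have "f = f'" by auto
  moreover have "L2_class g = L2_class g'"
    using AE g g'(2) by (subst L2_class_eq_iff) (auto simp: \<open>f = f'\<close> elim!: eventually_mono)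
  ultimately have "z = map_prod ?G ?G (L2_class p, L2_class (\<lambda>x. of_real x * p x))"
    by (simp add: z f' g')
  then show "z \<in> map_prod ?G ?G ` position_op" using pos by (rule image_eqI)
qed

lemma fun_calc_momentum:
  "f \<in> bcontfun \<Longrightarrow> fun_calc f momentum_op = (\<lambda>\<psi>. L2_fourier (- 1) (mult_op f (L2_fourier 1 \<psi>)))"
  unfolding momentum_op_eq using fun_calc_unitary_position[OF unitary_pair_L2_fourier[of "- 1"]] by simp

lemma bcontfun_continuous: "f \<in> bcontfun \<Longrightarrow> continuous_on UNIV f"
  by (simp add: bcontfun_def)

section \<open>Topologically invariant means\<close>

lemma bcontfun_mult_left:
  fixes f :: "real \<Rightarrow> complex"
  assumes f: "f \<in> bcontfun"
  shows "(\<lambda>x. c * f x) \<in> bcontfun"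
proof -
  obtain C where C: "\<And>x. norm (f x) \<le> C" using bcontfun_bound[OF f] by blast
  show ?thesis
  proof (rule bcontfun_normI[where b = "cmod c * C"])
    show "continuous_on UNIV (\<lambda>x. c * f x)"
      by (intro continuous_intros bcontfun_continuous f)
    show "norm (c * f x) \<le> cmod c * C" for x
      by (simp add: norm_mult mult_left_mono C)
  qed
qed

text \<open>The shift falls on the continuous factor \<open>f\<close>, so dominated convergence
  applies even though \<open>g\<close> is only integrable.\<close>

lemma bcontfun_fun_conv:
  assumes f: "f \<in> bcontfun" and g: "integrable lborel g"
  shows "fun_conv f g \<in> bcontfun"
proof -
  obtain C where C: "\<And>x. norm (f x) \<le> C" using bcontfun_bound[OF f] by blast
  have [measurable]: "f \<in> borel_measurable borel" "g \<in> borel_measurable borel"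
    using bcontfun_measurable[OF f] g by auto
  have bound: "norm (f (u - p) * complex_of_real (g p)) \<le> C * norm (g p)" for u p
    by (simp add: norm_mult mult_right_mono C)
  have Cg: "integrable lborel (\<lambda>p. C * norm (g p))" using g by simp
  have int: "integrable lborel (\<lambda>p. f (u - p) * complex_of_real (g p))" for u
  proof (rule Bochner_Integration.integrable_bound[OF Cg])
    show "AE p in lborel. norm (f (u - p) * complex_of_real (g p)) \<le> norm (C * norm (g p))"
      unfolding real_norm_def[of "C * _"] by (intro AE_I2 order_trans[OF bound abs_ge_self])
  qed measurable
  show ?thesis
  proof (rule bcontfun_normI)
    show "norm (fun_conv f g u) \<le> (LINT p|lborel. C * norm (g p))" for u
      unfolding fun_conv_def
      by (rule Bochner_Integration.integral_norm_bound_integral[OF int Cg bound])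
    show "continuous_on UNIV (fun_conv f g)"
      unfolding continuous_on_sequentially comp_def fun_conv_def
    proof (intro allI ballI impI, elim conjE)
      fix x :: "nat \<Rightarrow> real" and a assume x: "x \<longlonglongrightarrow> a"
      show "(\<lambda>n. LINT p|lborel. f (x n - p) * complex_of_real (g p)) \<longlonglongrightarrow> (LINT p|lborel. f (a - p) * complex_of_real (g p))"
      proof (rule integral_dominated_convergence[OF _ _ Cg])
        show "AE p in lborel. (\<lambda>n. f (x n - p) * complex_of_real (g p)) \<longlonglongrightarrow> f (a - p) * complex_of_real (g p)"
        proof (intro AE_I2 tendsto_mult tendsto_const)
          fix p
          have "isCont f (a - p)" using bcontfun_continuous[OF f] by (simp add: continuous_on_eq_continuous_at)
          then show "(\<lambda>n. f (x n - p)) \<longlonglongrightarrow> f (a - p)"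
            by (rule isCont_tendsto_compose) (intro tendsto_intros x)
        qed
      qed (use bound in auto)
    qed
  qed
qed

section \<open>Estimates for means\<close>

context
  fixes \<eta> :: "(real \<Rightarrow> complex) \<Rightarrow> complex"
  assumes mean: "is_mean \<eta>"
begin

lemma mean_add: "f \<in> bcontfun \<Longrightarrow> g \<in> bcontfun \<Longrightarrow> \<eta> (\<lambda>x. f x + g x) = \<eta> f + \<eta> g"
  and mean_mult: "f \<in> bcontfun \<Longrightarrow> \<eta> (\<lambda>x. c * f x) = c * \<eta> f"
  and mean_nonneg: "f \<in> bcontfun \<Longrightarrow> (\<And>x. f x \<in> \<real>\<^sub>\<ge>\<^sub>0) \<Longrightarrow> \<eta> f \<in> \<real>\<^sub>\<ge>\<^sub>0"
  using mean by (simp_all add: is_mean_def)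

lemma mean_const: "\<eta> (\<lambda>x. c) = c"
  using mean mean_mult[OF const_bcontfun[of 1], of c] by (simp add: is_mean_def)

lemma mean_diff: "f \<in> bcontfun \<Longrightarrow> g \<in> bcontfun \<Longrightarrow> \<eta> (\<lambda>x. f x - g x) = \<eta> f - \<eta> g"
  using mean_add[OF _ bcontfun_mult_left, of f g "-1"] mean_mult[of g "-1"] by simp

text \<open>Applying positivity to \<open>C - f\<close> settles both claims at once: its mean is
  real, and it is nonnegative.\<close>

lemma mean_real_bound:
  assumes f: "(\<lambda>x. complex_of_real (f x)) \<in> bcontfun" and C: "\<And>x. \<bar>f x\<bar> \<le> C"
  shows "Im (\<eta> (\<lambda>x. complex_of_real (f x))) = 0" "Re (\<eta> (\<lambda>x. complex_of_real (f x))) \<le> C"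
proof -
  have "\<eta> (\<lambda>x. complex_of_real C - complex_of_real (f x)) \<in> \<real>\<^sub>\<ge>\<^sub>0"
  proof (rule mean_nonneg[OF minus_cont[OF const_bcontfun f]])
    show "complex_of_real C - complex_of_real (f x) \<in> \<real>\<^sub>\<ge>\<^sub>0" for x
      using C[of x] by (auto simp: complex_nonneg_Reals_iff)
  qed
  then have "complex_of_real C - \<eta> (\<lambda>x. complex_of_real (f x)) \<in> \<real>\<^sub>\<ge>\<^sub>0"
    by (simp add: mean_diff[OF const_bcontfun f] mean_const)
  then show "Im (\<eta> (\<lambda>x. complex_of_real (f x))) = 0" "Re (\<eta> (\<lambda>x. complex_of_real (f x))) \<le> C"
    by (auto simp: complex_nonneg_Reals_iff)
qed

text \<open>After multiplication by a phase the mean is its own modulus, so only the mean of the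
  real part counts; the imaginary part has a real mean and contributes nothing to it.\<close>

lemma mean_bound:
  assumes f: "f \<in> bcontfun" and C: "\<And>x. cmod (f x) \<le> C"
  shows "cmod (\<eta> f) \<le> C"
proof -
  define c where "c = cnj (sgn (\<eta> f))"
  have c: "cmod c \<le> 1" by (simp add: c_def norm_sgn)
  define g where "g x = c * f x" for x
  have g: "g \<in> bcontfun" unfolding g_def[abs_def] by (rule bcontfun_mult_left[OF f])
  have g_le: "cmod (g x) \<le> C" for x
    using mult_mono[OF c C[of x]] by (simp add: g_def norm_mult)
  have Re_le: "\<bar>Re (g x)\<bar> \<le> C" and Im_le: "\<bar>Im (g x)\<bar> \<le> C" for x
    using abs_Re_le_cmod[of "g x"] abs_Im_le_cmod[of "g x"] g_le[of x] by linarith+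
  have parts: "(\<lambda>x. complex_of_real (Re (g x))) \<in> bcontfun" "(\<lambda>x. complex_of_real (Im (g x))) \<in> bcontfun"
    by (auto intro!: bcontfun_normI[where b = C] continuous_on_of_real continuous_on_Re continuous_on_Im
        bcontfun_continuous[OF g] simp: Re_le Im_le)
  have "\<eta> g = \<eta> (\<lambda>x. complex_of_real (Re (g x)) + \<i> * complex_of_real (Im (g x)))"
    by (simp flip: complex_eq)
  also have "\<dots> = \<eta> (\<lambda>x. complex_of_real (Re (g x))) + \<i> * \<eta> (\<lambda>x. complex_of_real (Im (g x)))"
    by (simp add: mean_add bcontfun_mult_left parts mean_mult)
  finally have "Re (\<eta> g) \<le> C"
    using mean_real_bound[OF parts(1) Re_le] mean_real_bound(1)[OF parts(2) Im_le] by simp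
  moreover have "\<eta> g = complex_of_real (cmod (\<eta> f))"
    unfolding g_def[abs_def] mean_mult[OF f] c_def
    by (cases "\<eta> f = 0") (simp_all add: sgn_eq field_simps complex_norm_square[symmetric] power2_eq_square)
  ultimately show ?thesis by simp
qed

text \<open>Convolving with the uniform density on \<open>{0..N}\<close> makes a function vanishing at infinity
  uniformly small.\<close>

lemma mean_eq_limit:
  assumes inv: "topologically_invariant \<eta>" and a: "a \<in> bcontfun"
    and lim: "\<And>\<epsilon>. 0 < \<epsilon> \<Longrightarrow> \<exists>R. \<forall>s. R \<le> \<bar>s\<bar> \<longrightarrow> cmod (a s - L) \<le> \<epsilon>"
  shows "\<eta> a = L"
proof -
  define b where "b s = a s - L" for s
  have b: "b \<in> bcontfun" unfolding b_def[abs_def] by (rule minus_cont[OF a const_bcontfun])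
  have [measurable]: "b \<in> borel_measurable borel" by (rule bcontfun_measurable[OF b])
  obtain C where C: "\<And>x. norm (b x) \<le> C" using bcontfun_bound[OF b] by blast
  then have "0 \<le> C" using norm_ge_zero order_trans by blast
  have "cmod (\<eta> b) \<le> 2 * \<epsilon>" if eps: "0 < \<epsilon>" for \<epsilon>
  proof -
    obtain R0 where R0: "\<And>s. R0 \<le> \<bar>s\<bar> \<Longrightarrow> cmod (b s) \<le> \<epsilon>" using lim[OF eps] by (auto simp: b_def)
    define R where "R = max R0 1"
    have R: "R > 0" "\<And>s. R \<le> \<bar>s\<bar> \<Longrightarrow> cmod (b s) \<le> \<epsilon>" using R0 by (auto simp: R_def)
    \<comment> \<open>The window meets the region where \<open>b\<close> may be large in length at
      most \<open>2 * R\<close>, contributing at most \<open>2 * R * C / N\<close>. This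
      \<open>N\<close> makes that at most \<open>\<epsilon>\<close>, and the added 1 keeps it
      positive.\<close>
    define N where "N = 2 * R * C / \<epsilon> + 1"
    have N: "N > 0" using R \<open>0 \<le> C\<close> eps by (auto simp: N_def intro!: add_nonneg_pos divide_nonneg_pos)
    have N_le: "2 * R * C / N \<le> \<epsilon>"
      using N eps by (simp add: divide_le_eq) (simp add: N_def field_simps)
    define g where "g p = indicator {0..N} p / N" for p :: real
    have g: "integrable lborel g" "\<And>p. 0 \<le> g p" "(LINT p|lborel. g p) = 1"
      using N by (auto simp: g_def[abs_def] emeasure_lborel_Icc_eq)
    have "cmod (fun_conv b g u) \<le> 2 * \<epsilon>" for u
    proof -
      have int: "integrable lborel (\<lambda>p. \<epsilon> * g p + C / N * indicator {u - R..u + R} p)"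
        using g(1) by (intro Bochner_Integration.integrable_add integrable_mult_right) (auto simp: emeasure_lborel_Icc_eq)
      have le: "norm (b (u - p) * complex_of_real (g p)) \<le> \<epsilon> * g p + C / N * indicator {u - R..u + R} p" for p
      proof (cases "p \<in> {u - R..u + R}")
        case True
        have "norm (b (u - p) * complex_of_real (g p)) \<le> C * (1 / N)"
          unfolding norm_mult using C N \<open>0 \<le> C\<close> by (intro mult_mono) (auto simp: g_def indicator_def norm_divide)
        moreover have "0 \<le> \<epsilon> * g p" using eps g(2) by simp
        ultimately show ?thesis using True by simp
      next
        case False
        then have "cmod (b (u - p)) \<le> \<epsilon>" by (intro R) auto
        then show ?thesis using False g(2)[of p] by (simp add: norm_mult mult_right_mono)
      qed
      have "cmod (fun_conv b g u) \<le> (LINT p|lborel. \<epsilon> * g p + C / N * indicator {u - R..u + R} p)"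
        unfolding fun_conv_def
      proof (rule Bochner_Integration.integral_norm_bound_integral)
        show "integrable lborel (\<lambda>p. b (u - p) * complex_of_real (g p))"
        proof (rule Bochner_Integration.integrable_bound[OF int])
          have [measurable]: "g \<in> borel_measurable borel" using g(1) by auto
          show "(\<lambda>p. b (u - p) * complex_of_real (g p)) \<in> borel_measurable lborel" by measurable
          show "AE p in lborel. norm (b (u - p) * complex_of_real (g p))
              \<le> norm (\<epsilon> * g p + C / N * indicator {u - R..u + R} p)"
            unfolding real_norm_def[of "_ + _"] by (intro AE_I2 order_trans[OF le abs_ge_self])
        qed
      qed (rule int, rule le)
      also have "\<dots> = \<epsilon> * 1 + C / N * (2 * R)"
        using g R by (subst Bochner_Integration.integral_add) (auto simp: emeasure_lborel_Icc_eq)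
      also have "\<dots> \<le> 2 * \<epsilon>" using N_le by (simp add: mult_ac)
      finally show ?thesis .
    qed
    then have "cmod (\<eta> (fun_conv b g)) \<le> 2 * \<epsilon>"
      by (rule mean_bound[OF bcontfun_fun_conv[OF b g(1)]])
    moreover have "\<eta> (fun_conv b g) = \<eta> b"
      using inv b g unfolding topologically_invariant_def by blast
    ultimately show ?thesis by simp
  qed
  \<comment> \<open>This choice bounds the modulus by half of itself.\<close>
  from this[of "cmod (\<eta> b) / 4"] have "\<eta> b = 0" by (cases "\<eta> b = 0") auto
  then show ?thesis
    using mean_diff[OF a const_bcontfun[of L]] by (simp add: b_def[abs_def] mean_const)
qed

end

section \<open>Wave packets\<close>

text \<open>Continuity makes the packets continuous in \<open>s\<close>, the decay at infinity
  localizes them at 0, and the bound by 1 gives the Lipschitz constant in momentum.\<close>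

definition width :: "real \<Rightarrow> real" where
  "width s = 1 / (1 + \<bar>s\<bar>)"

lemma width_pos: "0 < width s" and width_le_one: "width s \<le> 1"
  by (auto simp: width_def)

lemma continuous_width: "continuous_on UNIV width"
  unfolding width_def by (intro continuous_intros) (auto simp: add_nonneg_eq_0_iff)

definition packet_fun :: "real \<Rightarrow> real \<Rightarrow> real \<Rightarrow> complex" where
  "packet_fun s p x = complex_of_real (1 / sqrt (width s)) * (cis (p * x) * indicator {0<..width s} x)"

lemma measurable_packet_fun [measurable]: "packet_fun s p \<in> borel_measurable borel"
  unfolding packet_fun_def[abs_def] by measurable

lemma cmod_packet_fun: "cmod (packet_fun s p x) = (1 / sqrt (width s)) * indicator {0<..width s} x"
  using width_pos[of s] by (auto simp: packet_fun_def norm_mult norm_divide indicator_def)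

lemma cmod_packet_fun_square: "(cmod (packet_fun s p x))\<^sup>2 = 1 / width s * indicator {0<..width s} x"
  using width_pos[of s] by (auto simp: cmod_packet_fun power_divide indicator_def)

lemma integrable_indicator_width: "integrable lborel (indicator {0<..width s} :: real \<Rightarrow> real)"
  using width_pos[of s] by simp

lemma square_integrable_packet_fun: "square_integrable (packet_fun s p)"
  using integrable_indicator_width by (simp add: square_integrable_def cmod_packet_fun_square)

lemma integrable_packet_fun: "integrable lborel (packet_fun s p)"
proof (rule Bochner_Integration.integrable_bound)
  show "integrable lborel (\<lambda>x. 1 / sqrt (width s) * indicator {0<..width s} x)"
    by (intro integrable_mult_right integrable_indicator_width)
qed (use width_pos[of s] in \<open>auto simp: cmod_packet_fun\<close>)

definition packet :: "real \<Rightarrow> real \<Rightarrow> l2" where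
  "packet s p = L2_class (packet_fun s p)"

lemma norm_packet [simp]: "norm (packet s p) = 1"
proof -
  have "(norm (packet s p))\<^sup>2 = 1"
    using width_pos[of s] by (simp add: packet_def norm_L2_class square_integrable_packet_fun cmod_packet_fun_square)
  then show ?thesis using norm_ge_zero[of "packet s p"] by (simp add: power2_eq_1_iff)
qed

text \<open>The phases at \<open>x\<close> differ by at most \<open>\<bar>(p - q) * x\<bar>\<close>,
  and the packet lives in the unit interval.\<close>

lemma norm_packet_diff_momentum: "norm (packet s p - packet s q) \<le> \<bar>p - q\<bar>"
proof (rule power2_le_imp_le)
  have si: "square_integrable (\<lambda>x. packet_fun s p x - packet_fun s q x)"
    by (intro square_integrable_diff square_integrable_packet_fun)
  have "(norm (packet s p - packet s q))\<^sup>2 = (LINT x|lborel. (cmod (packet_fun s p x - packet_fun s q x))\<^sup>2)"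
    by (simp add: packet_def L2_class_diff square_integrable_packet_fun norm_L2_class si)
  also have "\<dots> \<le> (LINT x|lborel. (1 / width s * (p - q)\<^sup>2) * indicator {0<..width s} x)"
  proof (rule integral_mono)
    show "integrable lborel (\<lambda>x. (cmod (packet_fun s p x - packet_fun s q x))\<^sup>2)"
      using si by (simp add: square_integrable_def)
    show "integrable lborel (\<lambda>x. (1 / width s * (p - q)\<^sup>2) * indicator {0<..width s} x)"
      by (intro integrable_mult_right integrable_indicator_width)
    fix x
    have "(cmod (packet_fun s p x - packet_fun s q x))\<^sup>2
        = 1 / width s * (cmod (cis (p * x) - cis (q * x)))\<^sup>2 * indicator {0<..width s} x"
      using width_pos[of s]
      by (auto simp: packet_fun_def norm_mult norm_divide power_mult_distrib power_divide indicator_def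
          simp flip: right_diff_distrib diff_divide_distrib)
    moreover have "(cmod (cis (p * x) - cis (q * x)))\<^sup>2 \<le> (p - q)\<^sup>2" if "x \<in> {0<..width s}"
    proof -
      have "(cmod (cis (p * x) - cis (q * x)))\<^sup>2 \<le> ((p - q) * x)\<^sup>2"
        using one_minus_cos_le[of "(p - q) * x"] by (simp add: cmod_cis_diff algebra_simps)
      also have "\<dots> \<le> (p - q)\<^sup>2 * 1"
        unfolding power_mult_distrib using that width_le_one[of s]
        by (intro mult_left_mono power_le_one) auto
      finally show ?thesis by simp
    qed
    ultimately show "(cmod (packet_fun s p x - packet_fun s q x))\<^sup>2
        \<le> (1 / width s * (p - q)\<^sup>2) * indicator {0<..width s} x"
      using width_pos[of s] by (auto simp: indicator_def divide_right_mono)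
  qed
  also have "\<dots> = \<bar>p - q\<bar>\<^sup>2" using width_pos[of s] by simp
  finally show "(norm (packet s p - packet s q))\<^sup>2 \<le> \<bar>p - q\<bar>\<^sup>2" .
qed simp

text \<open>The distance of two unit vectors with the given overlap. Equal momenta have cancelling
  phases, so \<open>p\<close> does not enter; this provides the uniformity needed under the inner
  mean.\<close>

definition packet_dist :: "real \<Rightarrow> real \<Rightarrow> real" where
  "packet_dist s t = sqrt (2 - 2 * (min (width s) (width t) / (sqrt (width s) * sqrt (width t))))"

lemma norm_packet_diff_width: "norm (packet s p - packet t p) = packet_dist s t"
proof -
  have "cinner (packet s p) (packet t p) = (LINT x|lborel. complex_of_real
      (1 / (sqrt (width s) * sqrt (width t)) * indicator {0<..min (width s) (width t)} x))"
    unfolding packet_def cinner_L2_class[OF square_integrable_packet_fun square_integrable_packet_fun]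
  proof (intro Bochner_Integration.integral_cong refl)
    fix x
    have "cnj (cis (p * x)) * cis (p * x) = 1" by (simp add: cis_cnj cis_mult)
    then show "cnj (packet_fun s p x) * packet_fun t p x = complex_of_real
      (1 / (sqrt (width s) * sqrt (width t)) * indicator {0<..min (width s) (width t)} x)"
      by (auto simp: packet_fun_def indicator_def)
  qed
  also have "\<dots> = complex_of_real (min (width s) (width t) / (sqrt (width s) * sqrt (width t)))"
    unfolding integral_complex_of_real using width_pos[of s] width_pos[of t] by simp
  finally have "inner (packet s p) (packet t p) = min (width s) (width t) / (sqrt (width s) * sqrt (width t))"
    by (simp add: inner_l2_def)
  then have "(norm (packet s p - packet t p))\<^sup>2 = 2 - 2 * (min (width s) (width t) / (sqrt (width s) * sqrt (width t)))"
    using norm_eq_1[of "packet s p"] norm_eq_1[of "packet t p"]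
    by (simp add: power2_norm_eq_inner inner_diff_left inner_diff_right inner_commute)
  then show ?thesis unfolding packet_dist_def by (metis norm_ge_zero real_sqrt_unique)
qed

lemma packet_dist_tendsto: "((\<lambda>s. packet_dist s t) \<longlongrightarrow> 0) (at t)"
proof -
  have w: "isCont width t" using continuous_width by (simp add: continuous_on_eq_continuous_at)
  have "((\<lambda>s. packet_dist s t) \<longlongrightarrow> packet_dist t t) (at t)"
    unfolding packet_dist_def using w width_pos[of t]
    by (intro tendsto_intros) (auto simp: isCont_def)
  moreover have "packet_dist t t = 0"
    using width_pos[of t] by (simp add: packet_dist_def)
  ultimately show ?thesis by simp
qed


section \<open>Expectations in the packets\<close>

definition packet_expectation :: "(l2 \<Rightarrow> l2) \<Rightarrow> real \<Rightarrow> real \<Rightarrow> complex" where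
  "packet_expectation A s p = cinner (packet s p) (A (packet s p))"

lemma cmod_packet_expectation:
  assumes "bounded_clinear A"
  shows "cmod (packet_expectation A s p) \<le> onorm A"
  using cmod_cinner_le[of "packet s p" "A (packet s p)"]
    onorm[OF bounded_clinear_bounded_linear[OF assms], of "packet s p"]
  by (simp add: packet_expectation_def)

lemma packet_expectation_diff:
  assumes A: "bounded_clinear A"
  shows "cmod (packet_expectation A s p - packet_expectation A t q)
    \<le> 2 * onorm A * norm (packet s p - packet t q)"
proof -
  note on = onorm[OF bounded_clinear_bounded_linear[OF A]]
  have eq: "packet_expectation A s p - packet_expectation A t q =
      cinner (packet s p - packet t q) (A (packet s p)) + cinner (packet t q) (A (packet s p - packet t q))"
    by (simp add: packet_expectation_def cinner_diff_left cinner_diff_right bounded_clinear_diff[OF A])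
  have "cmod (cinner (packet s p - packet t q) (A (packet s p))) \<le> norm (packet s p - packet t q) * (onorm A * 1)"
    using on[of "packet s p"] by (intro order_trans[OF cmod_cinner_le] mult_left_mono) auto
  moreover have "cmod (cinner (packet t q) (A (packet s p - packet t q))) \<le> 1 * (onorm A * norm (packet s p - packet t q))"
    using cmod_cinner_le[of "packet t q" "A (packet s p - packet t q)"] on[of "packet s p - packet t q"] by simp
  ultimately show ?thesis
    unfolding eq by (intro order_trans[OF norm_triangle_ineq]) (simp add: mult_ac)
qed

lemma bcontfun_packet_expectation:
  assumes A: "bounded_clinear A"
  shows "packet_expectation A s \<in> bcontfun"
proof (rule bcontfun_normI[OF _ cmod_packet_expectation[OF A]])
  have "dist (packet_expectation A s q) (packet_expectation A s p) \<le> 2 * onorm A * dist q p" for p q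
  proof -
    have "0 \<le> onorm A" using bounded_clinear_bounded_linear[OF A] by (rule onorm_pos_le)
    then show ?thesis
      using packet_expectation_diff[OF A, of s q s p] norm_packet_diff_momentum[of s q p]
        mult_left_mono[of "norm (packet s q - packet s p)" "\<bar>q - p\<bar>" "2 * onorm A"]
      by (simp add: dist_norm)
  qed
  then have "(2 * onorm A)-lipschitz_on UNIV (packet_expectation A s)"
    using onorm_pos_le[OF bounded_clinear_bounded_linear[OF A]] by (intro lipschitz_onI) auto
  then show "continuous_on UNIV (packet_expectation A s)"
    by (rule lipschitz_on_continuous_on)
qed

text \<open>Modulation by \<open>p\<close> shifts the Fourier transform by \<open>p\<close>, so the
  momentum density of every packet of the same width is a translate of one density. Reflecting that
  density produces a convolution; its total mass is 1 by unitarity.\<close>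

lemma packet_expectation_momentum:
  assumes f: "f \<in> bcontfun"
  obtains g where "integrable lborel g" "\<And>k. 0 \<le> g k" "(LINT k|lborel. g k) = 1"
    "packet_expectation (fun_calc f momentum_op) s = fun_conv f g"
proof -
  define h where "h p k = of_real fourier_norm * fourier 1 (packet_fun s p) k" for p k
  have h: "square_integrable (h p)" "L2_fourier 1 (packet s p) = L2_class (h p)" for p
    using L2_fourier_L2_class[of 1, OF _ square_integrable_packet_fun integrable_packet_fun]
    by (auto simp: h_def[abs_def] packet_def)
  have shift: "h p k = h 0 (k - p)" for p k
  proof -
    have "cis (- (k * x)) * packet_fun s p x = cis (- ((k - p) * x)) * packet_fun s 0 x" for x
    proof -
      have "cis (- (k * x)) * cis (p * x) = cis (- ((k - p) * x))" by (simp add: cis_mult algebra_simps)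
      then show ?thesis by (simp add: packet_fun_def mult_ac)
    qed
    then show ?thesis by (simp add: h_def fourier_def)
  qed
  define g where "g q = (cmod (h 0 (- q)))\<^sup>2" for q
  have h_int: "integrable lborel (\<lambda>k. (cmod (h 0 k))\<^sup>2)"
    using h(1) by (simp add: square_integrable_def)
  have "(LINT k|lborel. (cmod (h 0 k))\<^sup>2) = (norm (L2_fourier 1 (packet s 0)))\<^sup>2"
    by (simp add: h norm_L2_class)
  also have "\<dots> = 1" by (simp add: norm_L2_fourier)
  finally have h_norm: "(LINT k|lborel. (cmod (h 0 k))\<^sup>2) = 1" .
  show thesis
  proof
    show "integrable lborel g"
      using lborel_integrable_real_affine[OF h_int, of "-1" 0] by (simp add: g_def[abs_def])
    show "0 \<le> g k" for k by (simp add: g_def)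
    show "(LINT k|lborel. g k) = 1"
      using lborel_integral_real_affine[of "-1" "\<lambda>k. (cmod (h 0 k))\<^sup>2" 0] by (simp add: g_def h_norm)
    show "packet_expectation (fun_calc f momentum_op) s = fun_conv f g"
    proof
      fix p
      have "packet_expectation (fun_calc f momentum_op) s p
          = cinner (L2_fourier 1 (packet s p)) (mult_op f (L2_fourier 1 (packet s p)))"
        by (simp add: packet_expectation_def fun_calc_momentum[OF f] L2_fourier_adjoint)
      also have "\<dots> = (LINT k|lborel. f k * complex_of_real ((cmod (h 0 (k - p)))\<^sup>2))"
        unfolding h(2) cinner_mult_op[OF f h(1)] by (simp only: shift[of p])
      \<comment> \<open>Substitution \<open>k = p - q\<close>.\<close>
      also have "\<dots> = (LINT q|lborel. f (p + (-1) * q) * complex_of_real ((cmod (h 0 (p + (-1) * q - p)))\<^sup>2))"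
        using lborel_integral_real_affine[of "-1" "\<lambda>k. f k * complex_of_real ((cmod (h 0 (k - p)))\<^sup>2)" p] by simp
      also have "\<dots> = fun_conv f g p"
        by (simp add: fun_conv_def g_def)
      finally show "packet_expectation (fun_calc f momentum_op) s p = fun_conv f g p" .
    qed
  qed
qed

text \<open>The phase drops out of the squared modulus, leaving the average of \<open>f\<close> over
  \<open>{0<..width s}\<close> for every momentum.\<close>

lemma packet_expectation_position:
  assumes f: "f \<in> bcontfun"
  shows "packet_expectation (fun_calc f position_op) s p = packet_expectation (fun_calc f position_op) s 0"
    and "(\<And>x. 0 < x \<Longrightarrow> x \<le> width s \<Longrightarrow> cmod (f x - f 0) \<le> \<epsilon>) \<Longrightarrow>
      cmod (packet_expectation (fun_calc f position_op) s p - f 0) \<le> \<epsilon>"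
proof -
  obtain C where C: "\<And>x. norm (f x) \<le> C" using bcontfun_bound[OF f] by blast
  have [measurable]: "f \<in> borel_measurable borel" by (rule bcontfun_measurable[OF f])
  define d where "d x = 1 / width s * indicator {0<..width s} x" for x
  have [measurable]: "d \<in> borel_measurable borel" by (simp add: d_def[abs_def])
  have d: "integrable lborel d" "(LINT x|lborel. d x) = 1"
    using width_pos[of s] integrable_indicator_width[of s] by (auto simp: d_def[abs_def])
  have d_nonneg: "0 \<le> d x" for x using width_pos[of s] by (simp add: d_def)
  have eq: "packet_expectation (fun_calc f position_op) s p = (LINT x|lborel. f x * complex_of_real (d x))" for p
    unfolding packet_expectation_def fun_calc_position[OF f] packet_def
      cinner_mult_op[OF f square_integrable_packet_fun] cmod_packet_fun_square d_def ..
  show "packet_expectation (fun_calc f position_op) s p = packet_expectation (fun_calc f position_op) s 0"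
    by (simp only: eq)
  assume \<epsilon>: "\<And>x. 0 < x \<Longrightarrow> x \<le> width s \<Longrightarrow> cmod (f x - f 0) \<le> \<epsilon>"
  have int: "integrable lborel (\<lambda>x. f x * complex_of_real (d x))"
  proof (rule Bochner_Integration.integrable_bound)
    show "integrable lborel (\<lambda>x. C * d x)" using d by simp
    show "AE x in lborel. norm (f x * complex_of_real (d x)) \<le> norm (C * d x)"
      using C d_nonneg by (intro AE_I2) (simp add: norm_mult abs_mult mult_right_mono order_trans[OF C abs_ge_self])
  qed measurable
  have "packet_expectation (fun_calc f position_op) s p - f 0
      = (LINT x|lborel. f x * complex_of_real (d x)) - (LINT x|lborel. f 0 * complex_of_real (d x))"
    using d by (simp add: eq)
  also have "\<dots> = (LINT x|lborel. f x * complex_of_real (d x) - f 0 * complex_of_real (d x))"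
    using d int by (intro Bochner_Integration.integral_diff[symmetric]) auto
  also have "cmod \<dots> \<le> (LINT x|lborel. \<epsilon> * d x)"
  proof (rule Bochner_Integration.integral_norm_bound_integral)
    show "integrable lborel (\<lambda>x. f x * complex_of_real (d x) - f 0 * complex_of_real (d x))"
      using d int by (intro Bochner_Integration.integrable_diff) auto
    show "norm (f x * complex_of_real (d x) - f 0 * complex_of_real (d x)) \<le> \<epsilon> * d x" for x
    proof (cases "x \<in> {0<..width s}")
      case True
      then show ?thesis
        using \<epsilon>[of x] d_nonneg[of x] by (simp add: norm_mult mult_right_mono flip: left_diff_distrib)
    qed (simp add: d_def)
  qed (use d in simp)
  also have "\<dots> = \<epsilon>" using d by simp
  finally show "cmod (packet_expectation (fun_calc f position_op) s p - f 0) \<le> \<epsilon>" .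
qed

section \<open>The Dirac state\<close>

context
  fixes \<eta> :: "(real \<Rightarrow> complex) \<Rightarrow> complex"
  assumes mean: "is_mean \<eta>"
begin

text \<open>Since \<open>packet_dist\<close> is independent of \<open>p\<close>, expectations at
  nearby \<open>s\<close> differ uniformly little in \<open>p\<close>, and \<open>mean_bound\<close>
  carries this through the inner mean. Continuity makes the outer mean legitimate.\<close>

lemma bcontfun_mean_packet_expectation:
  assumes A: "bounded_clinear A"
  shows "(\<lambda>s. \<eta> (packet_expectation A s)) \<in> bcontfun"
proof (rule bcontfun_normI)
  note bc = bcontfun_packet_expectation[OF A]
  show "cmod (\<eta> (packet_expectation A s)) \<le> onorm A" for s
    by (rule mean_bound[OF mean bc cmod_packet_expectation[OF A]])
  have "((\<lambda>s. \<eta> (packet_expectation A s)) \<longlongrightarrow> \<eta> (packet_expectation A t)) (at t)" for t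
  proof (rule metric_tendsto_imp_tendsto)
    show "((\<lambda>s. 2 * onorm A * packet_dist s t) \<longlongrightarrow> 2 * onorm A * 0) (at t)"
      by (intro tendsto_intros packet_dist_tendsto)
    have "dist (\<eta> (packet_expectation A s)) (\<eta> (packet_expectation A t)) \<le> 2 * onorm A * packet_dist s t" for s
    proof -
      have "cmod (\<eta> (\<lambda>p. packet_expectation A s p - packet_expectation A t p)) \<le> 2 * onorm A * packet_dist s t"
        using packet_expectation_diff[OF A, of s _ t] norm_packet_diff_width[of s _ t]
        by (intro mean_bound[OF mean minus_cont[OF bc bc]]) metis
      then show ?thesis by (simp add: dist_norm mean_diff[OF mean bc bc])
    qed
    then show "\<forall>\<^sub>F s in at t. dist (\<eta> (packet_expectation A s)) (\<eta> (packet_expectation A t))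
        \<le> dist (2 * onorm A * packet_dist s t) (2 * onorm A * 0)"
      by (intro always_eventually allI) (simp add: dist_norm order_trans[OF _ abs_ge_self])
  qed
  then show "continuous_on UNIV (\<lambda>s. \<eta> (packet_expectation A s))"
    by (simp add: continuous_on_def)
qed

definition packet_state :: "(l2 \<Rightarrow> l2) \<Rightarrow> complex" where
  "packet_state A = \<eta> (\<lambda>s. \<eta> (packet_expectation A s))"

text \<open>Linearity and positivity pass through two means. The norm bound is
  \<open>mean_bound\<close> used twice on unit packets, and the identity attains it.\<close>

lemma is_state_packet_state: "is_state packet_state"
proof -
  note bc = bcontfun_packet_expectation and bc' = bcontfun_mean_packet_expectation
  have add: "packet_state (\<lambda>\<psi>. A \<psi> + B \<psi>) = packet_state A + packet_state B"
    if "bounded_clinear A" "bounded_clinear B" for A B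
  proof -
    have "packet_expectation (\<lambda>\<psi>. A \<psi> + B \<psi>) s = (\<lambda>p. packet_expectation A s p + packet_expectation B s p)" for s
      by (simp add: packet_expectation_def cinner_add_right fun_eq_iff)
    then show ?thesis
      using that by (simp add: packet_state_def mean_add[OF mean] bc bc')
  qed
  have scale: "packet_state (\<lambda>\<psi>. c *\<^sub>C A \<psi>) = c * packet_state A" if "bounded_clinear A" for A c
  proof -
    have "packet_expectation (\<lambda>\<psi>. c *\<^sub>C A \<psi>) s = (\<lambda>p. c * packet_expectation A s p)" for s
      by (simp add: packet_expectation_def cinner_scaleC_right fun_eq_iff)
    then show ?thesis
      using that by (simp add: packet_state_def mean_mult[OF mean] bc bc')
  qed
  have pos: "packet_state A \<in> \<real>\<^sub>\<ge>\<^sub>0" if "positive_operator A" for A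
  proof -
    have A: "bounded_clinear A" "packet_expectation A s p \<in> \<real>\<^sub>\<ge>\<^sub>0" for s p
      using that by (auto simp: positive_operator_def packet_expectation_def)
    show ?thesis
      unfolding packet_state_def by (intro mean_nonneg[OF mean] bc bc' A)
  qed
  have bound: "cmod (packet_state A) \<le> onorm A" if "bounded_clinear A" for A
    unfolding packet_state_def
    by (intro mean_bound[OF mean] bc bc' that cmod_packet_expectation)
  have "packet_expectation (\<lambda>\<psi>. \<psi>) s = (\<lambda>p. 1)" for s
    by (simp add: packet_expectation_def cinner_self fun_eq_iff)
  then have one: "packet_state (\<lambda>\<psi>. \<psi>) = 1"
    by (simp add: packet_state_def mean_const[OF mean])
  let ?S = "(\<lambda>A. cmod (packet_state A)) ` {A. bounded_clinear A \<and> onorm A \<le> 1}"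
  have le: "x \<le> 1" if "x \<in> ?S" for x
    using that bound by fastforce
  moreover have "1 \<in> ?S"
    using one by (intro image_eqI[where x = "\<lambda>\<psi>. \<psi>"]) (auto simp: bounded_clinear_id onorm_id_le)
  ultimately have "Sup ?S = 1" by (intro cSup_eq_maximum)
  moreover have "bdd_above ?S" using le by (intro bdd_aboveI[where M = 1])
  ultimately show ?thesis
    unfolding is_state_def using add scale pos by blast
qed

end

theorem theorem3p2:
  fixes \<eta> :: "(real \<Rightarrow> complex) \<Rightarrow> complex"
  assumes "is_mean \<eta>" and "topologically_invariant \<eta>"
  shows "\<exists>\<delta>. dirac_state \<eta> \<delta>"
proof
  note mean = assms(1)
  show "dirac_state \<eta> (packet_state \<eta>)"
    unfolding dirac_state_def
  proof (intro conjI ballI is_state_packet_state[OF mean])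
    fix f :: "real \<Rightarrow> complex" assume f: "f \<in> bcontfun"
    obtain C where C: "\<And>x. norm (f x) \<le> C" using bcontfun_bound[OF f] by blast
    have Q: "bounded_clinear (fun_calc f position_op)"
      unfolding fun_calc_position[OF f] by (rule bounded_clinear_mult_op[OF bcontfun_measurable[OF f] C])
    have inner: "\<eta> (packet_expectation (fun_calc f position_op) s) = packet_expectation (fun_calc f position_op) s 0" for s
    proof -
      have "packet_expectation (fun_calc f position_op) s = (\<lambda>p. packet_expectation (fun_calc f position_op) s 0)"
        by (rule ext) (rule packet_expectation_position(1)[OF f])
      then show ?thesis by (metis mean_const[OF mean])
    qed
    show "packet_state \<eta> (fun_calc f position_op) = f 0"
      unfolding packet_state_def[OF mean]
    proof (rule mean_eq_limit[OF mean assms(2) bcontfun_mean_packet_expectation[OF mean Q]])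
      fix \<epsilon> :: real assume "0 < \<epsilon>"
      have "isCont f 0" using bcontfun_continuous[OF f] by (simp add: continuous_on_eq_continuous_at)
      then obtain d where d: "0 < d" "\<And>x. \<bar>x\<bar> < d \<Longrightarrow> cmod (f x - f 0) < \<epsilon>"
        unfolding continuous_at_eps_delta using \<open>0 < \<epsilon>\<close> by (auto simp: dist_norm)
      \<comment> \<open>For \<open>\<bar>s\<bar> \<ge> 1 / d\<close> the width is strictly below
        \<open>d\<close>, thanks to the 1 in its denominator.\<close>
      have "cmod (packet_expectation (fun_calc f position_op) s 0 - f 0) \<le> \<epsilon>" if "1 / d \<le> \<bar>s\<bar>" for s
      proof (rule packet_expectation_position(2)[OF f])
        have "width s < d"
          using that d(1) by (simp add: width_def field_simps)
        then show "cmod (f x - f 0) \<le> \<epsilon>" if "0 < x" "x \<le> width s" for x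
          using d(2)[of x] that by simp
      qed
      then show "\<exists>R. \<forall>s. R \<le> \<bar>s\<bar> \<longrightarrow> cmod (\<eta> (packet_expectation (fun_calc f position_op) s) - f 0) \<le> \<epsilon>"
        unfolding inner by blast
    qed
    \<comment> \<open>The density depends on \<open>s\<close>, but invariance removes any density,
      so the outer mean sees a constant.\<close>
    have "\<eta> (packet_expectation (fun_calc f momentum_op) s) = \<eta> f" for s
    proof -
      obtain g where "integrable lborel g" "\<And>k. 0 \<le> g k" "(LINT k|lborel. g k) = 1"
        "packet_expectation (fun_calc f momentum_op) s = fun_conv f g"
        using packet_expectation_momentum[OF f] by blast
      then show ?thesis
        using assms(2) f unfolding topologically_invariant_def by simp
    qed
    then show "packet_state \<eta> (fun_calc f momentum_op) = \<eta> f"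
      by (simp add: packet_state_def[OF mean] mean_const[OF mean])
  qed
qed

end
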